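(* Let $\mathcal{G}(g,\Lambda)$ be a Gabor super-frame for $L^2(\mathbb{R}^d)$. Let $v$ be a submultiplicative weight on $\mathbb{R}^{2d}$, $m\in\mathcal{M}_v(\mathbb{R}^{2d})$, $s\ge1/2$, and let $\sigma\in C^\infty(\mathbb{R}^{2d})$. Then the following properties are equivalent: (i) There exist $c>0$, $\epsilon>0$ such that $$|\langle\sigma^w\pi(z)g,\pi(w)g\rangle|\le c\, m\Big(\frac{w+z}{2}\Big)\exp\big(-\epsilon|w-z|^{1/s}\big)\qquad\text{for all } z,w\in\mathbb{R}^{2d}.$$ (ii) There exist $c>0$, $\epsilon>0$ such that $$|\langle\sigma^w\pi(\mu)g,\pi(\lambda)g\rangle|\le c\, m\Big(\frac{\lambda+\mu}{2}\Big)\exp\big(-\epsilon|\lambda-\mu|^{1/s}\big)\qquad\text{for all } \lambda,\mu\in\Lambda.$$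
   Context: Weights: a submultiplicative weight $v$ on $\mathbb{R}^{n}$ is a continuous, positive, even function with $v(0)=1$, $v(z_1+z_2)\le v(z_1)v(z_2)$. $\mathcal{M}_v(\mathbb{R}^{n})$ is the set of measurable positive functions $m$ for which there is $C>0$ with $m(z+\zeta)\le Cv(z)m(\zeta)$ for all $z,\zeta\in\mathbb{R}^n$. Gelfand-Shilov spaces: $S^s_s(\mathbb{R}^d)$ is the space of $f\in\mathcal{S}(\mathbb{R}^d)$ such that for some $A,B,c>0$, $|x^\alpha\partial^\beta f(x)|\le cA^{|\alpha|}B^{|\beta|}(\alpha!)^s(\beta!)^s$ for all $x\in\mathbb{R}^d$, $\alpha,\beta\in\mathbb{N}^d$ (inductive limit topology); $(S^s_s)'$ is its strong dual. Gabor frames: for $z=(x,\xi)\in\mathbb{R}^{2d}$, $\pi(z)f(t)=e^{2\pi i\xi\cdot t}f(t-x)$. For a lattice $\Lambda=A\mathbb{Z}^{2d}$, $A\in GL(2d,\mathbb{R})$, and $0\ne g\in L^2(\mathbb{R}^d)$, $\mathcal{G}(g,\Lambda)=\{\pi(\lambda)g:\lambda\in\Lambda\}$ is a Gabor frame if there are $A,B>0$ with $A\|f\|_2^2\le\sum_{\lambda\in\Lambda}|\langle f,\pi(\lambda)g\rangle|^2\le B\|f\|_2^2$ for all $f\in L^2(\mathbb{R}^d)$. A dual window is $\gamma\in L^2(\mathbb{R}^d)$ such that $\mathcal{G}(\gamma,\Lambda)$ is a frame and $f=\sum_{\lambda}\langle f,\pi(\lambda)g\rangle\pi(\lambda)\gamma=\sum_\lambda\langle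 f,\pi(\lambda)\gamma\rangle\pi(\lambda)g$ for all $f\in L^2(\mathbb{R}^d)$, with unconditional convergence in $L^2$. Gabor super-frame: a Gabor frame $\mathcal{G}(g,\Lambda)$ for $L^2(\mathbb{R}^d)$ with $g=g_1\otimes\cdots\otimes g_d$, each $g_i$ being a finite linear combination $\sum_{k=0}^{n}c_kH_k$ of one-dimensional Hermite functions (so $g\in S^{1/2}_{1/2}(\mathbb{R}^d)$), $\Lambda=\Lambda_1\times\cdots\times\Lambda_d$ with $\Lambda_i=A_i\mathbb{Z}^2$, $A_i\in GL(2,\mathbb{R})$, a lattice in the $i$-th time-frequency plane $(x_i,\xi_i)$, and possessing a dual window $\gamma=\gamma_1\otimes\cdots\otimes\gamma_d\in S^{1/2}_{1/2}(\mathbb{R}^d)$. Weyl operators: formally $\sigma^wf(x)=\int\int\sigma\big(\tfrac{x+y}{2},\xi\big)e^{2\pi i(x-y)\cdot\xi}f(y)\,dy\,d\xi$; rigorously $\langle\sigma^wf,h\rangle=\langle\sigma,W(h,f)\rangle$ with $W(f,h)(x,\xi)=\int_{\mathbb{R}^d}f(x+\tfrac t2)\overline{h(x-\tfrac t2)}e^{-2\pi it\cdot\xi}\,dt$, where brackets extend $\langle f,h\rangle=\int f\overline h$; for $f,h\in S^{1/2}_{1/2}(\mathbb{R}^d)$ one has $W(h,f)\in S^{1/2}_{1/2}(\mathbb{R}^{2d})$, so $\sigma^w:S^{1/2}_{1/2}(\mathbb{R}^d)\to(S^{1/2}_{1/2})'(\mathbb{R}^d)$ is defined and continuous for $\sigma\in(S^{1/2}_{1/2})'(\mathbb{R}^{2d})$.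 The symbol $\sigma\in C^\infty(\mathbb{R}^{2d})$ is understood to define an element of $(S^{1/2}_{1/2})'(\mathbb{R}^{2d})$, so that $\sigma^w$ makes sense. *)

theory Defs
  imports "HOL-Analysis.Analysis"
begin

section \<open>Weights\<close>

text \<open>Phase space \<open>\<real>\<^sup>2\<^sup>d\<close> is rendered as \<open>(real^'d) \<times> (real^'d)\<close>, whose norm is the
  Euclidean one; notions used on both \<open>\<real>\<^sup>d\<close> and \<open>\<real>\<^sup>2\<^sup>d\<close> are stated for an arbitrary
  Euclidean space.\<close>

definition submult_weight :: "('a::euclidean_space \<Rightarrow> real) \<Rightarrow> bool" where
  "submult_weight v \<longleftrightarrow>
     continuous_on UNIV v \<and> (\<forall>z. v z > 0) \<and> (\<forall>z. v (- z) = v z) \<and> v 0 = 1 \<and>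
     (\<forall>z1 z2. v (z1 + z2) \<le> v z1 * v z2)"

definition moderate_weights :: "('a::euclidean_space \<Rightarrow> real) \<Rightarrow> ('a \<Rightarrow> real) set" where
  "moderate_weights v =
     {m. m \<in> borel_measurable lebesgue \<and> (\<forall>z. m z > 0) \<and>
         (\<exists>C>0. \<forall>z \<zeta>. m (z + \<zeta>) \<le> C * v z * m \<zeta>)}"

section \<open>Smooth functions and Gelfand--Shilov spaces\<close>

definition partial_deriv :: "'a::euclidean_space \<Rightarrow> ('a \<Rightarrow> complex) \<Rightarrow> 'a \<Rightarrow> complex" where
  "partial_deriv b f = (\<lambda>x. vector_derivative (\<lambda>t. f (x + t *\<^sub>R b)) (at 0))"

definition smooth :: "('a::euclidean_space \<Rightarrow> complex) \<Rightarrow> bool" where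
  "smooth f \<longleftrightarrow>
     (\<forall>bs. set bs \<subseteq> Basis \<longrightarrow>
        continuous_on UNIV (foldr partial_deriv bs f) \<and>
        (\<forall>b\<in>Basis. \<forall>x. (\<lambda>t::real. foldr partial_deriv bs f (x + t *\<^sub>R b)) differentiable (at 0)))"

text \<open>A multi-index is a function \<open>\<alpha> :: 'a \<Rightarrow> nat\<close> of which only the values on \<open>Basis\<close> matter.
  The order in which partial derivatives are taken in \<open>\<partial>\<^sup>\<beta>\<close> is that of a fixed enumeration of the
  basis; it is irrelevant for smooth functions, the only ones to which it is applied.\<close>

definition mi_abs :: "('a::euclidean_space \<Rightarrow> nat) \<Rightarrow> nat" where
  "mi_abs \<alpha> = (\<Sum>b\<in>Basis. \<alpha> b)"

definition mi_fact :: "('a::euclidean_space \<Rightarrow> nat) \<Rightarrow> real" where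
  "mi_fact \<alpha> = (\<Prod>b\<in>Basis. fact (\<alpha> b))"

definition mi_power :: "'a::euclidean_space \<Rightarrow> ('a \<Rightarrow> nat) \<Rightarrow> real" where
  "mi_power x \<alpha> = (\<Prod>b\<in>Basis. (x \<bullet> b) ^ \<alpha> b)"

definition basis_list :: "'a::euclidean_space list" where
  "basis_list = (SOME bs. distinct bs \<and> set bs = Basis)"

definition mi_deriv :: "('a::euclidean_space \<Rightarrow> nat) \<Rightarrow> ('a \<Rightarrow> complex) \<Rightarrow> 'a \<Rightarrow> complex" where
  "mi_deriv \<beta> = foldr (\<lambda>b. partial_deriv b ^^ \<beta> b) basis_list"

definition schwartz_space :: "('a::euclidean_space \<Rightarrow> complex) set" where
  "schwartz_space =
     {f. smooth f \<and> (\<forall>\<alpha> \<beta>. \<exists>C. \<forall>x. cmod (of_real (mi_power x \<alpha>) * mi_deriv \<beta> f x) \<le> C)}"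

definition gs_bound :: "real \<Rightarrow> real \<Rightarrow> real \<Rightarrow> real \<Rightarrow> ('a::euclidean_space \<Rightarrow> complex) \<Rightarrow> bool" where
  "gs_bound s A B c f \<longleftrightarrow>
     (\<forall>x \<alpha> \<beta>. cmod (of_real (mi_power x \<alpha>) * mi_deriv \<beta> f x)
        \<le> c * A ^ mi_abs \<alpha> * B ^ mi_abs \<beta> * mi_fact \<alpha> powr s * mi_fact \<beta> powr s)"

definition gelfand_shilov :: "real \<Rightarrow> ('a::euclidean_space \<Rightarrow> complex) set" where
  "gelfand_shilov s = {f \<in> schwartz_space. \<exists>A>0. \<exists>B>0. \<exists>c>0. gs_bound s A B c f}"

text \<open>Elements of the dual are conjugate-linear functionals, since the duality bracket extends
  \<open>\<langle>f, h\<rangle> = \<integral> f \<cdot> cnj h\<close>. The space \<open>S\<^sup>s\<^sub>s\<close> is the inductive limit over \<open>A, B\<close> of the Banach spaces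
  normed by the least \<open>c\<close> admissible in the bound, so continuity of such a functional means
  boundedness on each of these Banach spaces. Values outside \<open>S\<^sup>s\<^sub>s\<close> are irrelevant.\<close>

definition gs_dual :: "real \<Rightarrow> (('a::euclidean_space \<Rightarrow> complex) \<Rightarrow> complex) set" where
  "gs_dual s =
     {u. (\<forall>f\<in>gelfand_shilov s. \<forall>h\<in>gelfand_shilov s. u (\<lambda>x. f x + h x) = u f + u h) \<and>
         (\<forall>a. \<forall>f\<in>gelfand_shilov s. u (\<lambda>x. a * f x) = cnj a * u f) \<and>
         (\<forall>A>0. \<forall>B>0. \<exists>C. \<forall>f\<in>gelfand_shilov s. \<forall>c>0.
            gs_bound s A B c f \<longrightarrow> cmod (u f) \<le> C * c)}"

section \<open>The space \<open>L\<^sup>2\<close> and the duality bracket\<close>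

definition L2 :: "('a::euclidean_space \<Rightarrow> complex) set" where
  "L2 = {f. f \<in> borel_measurable lborel \<and> integrable lborel (\<lambda>x. (cmod (f x))\<^sup>2)}"

definition L2_norm :: "('a::euclidean_space \<Rightarrow> complex) \<Rightarrow> real" where
  "L2_norm f = sqrt (LINT x|lborel. (cmod (f x))\<^sup>2)"

definition bracket :: "('a::euclidean_space \<Rightarrow> complex) \<Rightarrow> ('a \<Rightarrow> complex) \<Rightarrow> complex" where
  "bracket f h = (LINT x|lborel. f x * cnj (h x))"

text \<open>Convergence along the net of finite subsets of the index set, i.e. unconditional
  convergence, in the norm of \<open>L\<^sup>2\<close>.\<close>

definition has_L2_sum ::
    "('i \<Rightarrow> 'a::euclidean_space \<Rightarrow> complex) \<Rightarrow> ('a \<Rightarrow> complex) \<Rightarrow> 'i set \<Rightarrow> bool" where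
  "has_L2_sum F f I \<longleftrightarrow>
     ((\<lambda>S. L2_norm (\<lambda>x. f x - (\<Sum>i\<in>S. F i x))) \<longlongrightarrow> 0) (finite_subsets_at_top I)"

text \<open>The functional defined by \<open>\<sigma>\<close> is \<open>bracket \<sigma>\<close>. Since \<open>S\<^sup>s\<^sub>s\<close> may contain no nonzero compactly
  supported functions (as for \<open>s = 1/2\<close>), local integrability of \<open>\<sigma>\<close> would not make it well defined;
  the integral is required to exist for every test function.\<close>

definition defines_gs_dual :: "real \<Rightarrow> ('a::euclidean_space \<Rightarrow> complex) \<Rightarrow> bool" where
  "defines_gs_dual s \<sigma> \<longleftrightarrow>
     (\<forall>\<phi>\<in>gelfand_shilov s. integrable lborel (\<lambda>z. \<sigma> z * cnj (\<phi> z))) \<and>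
     bracket \<sigma> \<in> gs_dual s"

section \<open>Gabor frames\<close>

definition tf_shift ::
    "(real^'d) \<times> (real^'d) \<Rightarrow> (real^'d \<Rightarrow> complex) \<Rightarrow> real^'d \<Rightarrow> complex" where
  "tf_shift z f = (\<lambda>t. cis (2 * pi * (snd z \<bullet> t)) * f (t - fst z))"

text \<open>\<open>GL\<close> is rendered as the bijective linear maps, and \<open>\<int>\<^sup>n\<close> as the points with integer
  coordinates.\<close>

definition is_lattice :: "'a::euclidean_space set \<Rightarrow> bool" where
  "is_lattice \<Lambda> \<longleftrightarrow> (\<exists>A::'a \<Rightarrow> 'a. linear A \<and> bij A \<and> \<Lambda> = A ` {k. \<forall>b\<in>Basis. k \<bullet> b \<in> \<int>})"

definition gabor_frame :: "(real^'d \<Rightarrow> complex) \<Rightarrow> ((real^'d) \<times> (real^'d)) set \<Rightarrow> bool" where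
  "gabor_frame g \<Lambda> \<longleftrightarrow>
     is_lattice \<Lambda> \<and> g \<in> L2 \<and> L2_norm g \<noteq> 0 \<and>
     (\<exists>A>0. \<exists>B>0. \<forall>f\<in>L2.
        (\<lambda>l. (cmod (bracket f (tf_shift l g)))\<^sup>2) summable_on \<Lambda> \<and>
        A * (L2_norm f)\<^sup>2 \<le> (\<Sum>\<^sub>\<infinity>l\<in>\<Lambda>. (cmod (bracket f (tf_shift l g)))\<^sup>2) \<and>
        (\<Sum>\<^sub>\<infinity>l\<in>\<Lambda>. (cmod (bracket f (tf_shift l g)))\<^sup>2) \<le> B * (L2_norm f)\<^sup>2)"

definition dual_window ::
    "(real^'d \<Rightarrow> complex) \<Rightarrow> ((real^'d) \<times> (real^'d)) set \<Rightarrow> (real^'d \<Rightarrow> complex) \<Rightarrow> bool" where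
  "dual_window g \<Lambda> \<gamma> \<longleftrightarrow>
     \<gamma> \<in> L2 \<and> gabor_frame \<gamma> \<Lambda> \<and>
     (\<forall>f\<in>L2.
        has_L2_sum (\<lambda>l t. bracket f (tf_shift l g) * tf_shift l \<gamma> t) f \<Lambda> \<and>
        has_L2_sum (\<lambda>l t. bracket f (tf_shift l \<gamma>) * tf_shift l g t) f \<Lambda>)"

section \<open>Gabor super-frames\<close>

text \<open>Hermite functions, with the dilation matching the Fourier transform with kernel
  \<open>exp (- 2 \<pi> i x \<xi>)\<close> and normalised in \<open>L\<^sup>2\<close>, so that \<open>H\<^sub>0(t) = 2\<^bsup>1/4\<^esup> exp (- \<pi> t\<^sup>2)\<close>.\<close>

definition hermite_fun :: "nat \<Rightarrow> real \<Rightarrow> real" where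
  "hermite_fun k t =
     2 powr (1/4) / sqrt (fact k) * (- 1 / (2 * sqrt pi)) ^ k *
     exp (pi * t\<^sup>2) * (deriv ^^ k) (\<lambda>r. exp (- 2 * pi * r\<^sup>2)) t"

definition hermite_combination :: "(real \<Rightarrow> complex) \<Rightarrow> bool" where
  "hermite_combination f \<longleftrightarrow>
     (\<exists>n c. f = (\<lambda>t. \<Sum>k=0..n. c k * complex_of_real (hermite_fun k t)))"

definition tensor_fun :: "('d::finite \<Rightarrow> real \<Rightarrow> complex) \<Rightarrow> real^'d \<Rightarrow> complex" where
  "tensor_fun f = (\<lambda>x. \<Prod>i\<in>UNIV. f i (x $ i))"

text \<open>\<open>\<Lambda>\<^sub>1 \<times> \<dots> \<times> \<Lambda>\<^sub>d\<close>, where \<open>\<Lambda>\<^sub>i\<close> lies in the plane of the variables \<open>(x\<^sub>i, \<xi>\<^sub>i)\<close>.\<close>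

definition product_lattice ::
    "('d::finite \<Rightarrow> (real \<times> real) set) \<Rightarrow> ((real^'d) \<times> (real^'d)) set" where
  "product_lattice L = {(x, \<xi>). \<forall>i. (x $ i, \<xi> $ i) \<in> L i}"

definition gabor_super_frame ::
    "(real^'d \<Rightarrow> complex) \<Rightarrow> ((real^'d) \<times> (real^'d)) set \<Rightarrow> bool" where
  "gabor_super_frame g \<Lambda> \<longleftrightarrow>
     gabor_frame g \<Lambda> \<and>
     (\<exists>g'. (\<forall>i. hermite_combination (g' i)) \<and> g = tensor_fun g') \<and>
     (\<exists>L. (\<forall>i. is_lattice (L i)) \<and> \<Lambda> = product_lattice L) \<and>
     (\<exists>\<gamma> \<gamma>'. dual_window g \<Lambda> \<gamma> \<and> \<gamma> = tensor_fun \<gamma>' \<and> \<gamma> \<in> gelfand_shilov (1/2))"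

section \<open>Weyl operators\<close>

definition wigner ::
    "(real^'d \<Rightarrow> complex) \<Rightarrow> (real^'d \<Rightarrow> complex) \<Rightarrow> (real^'d) \<times> (real^'d) \<Rightarrow> complex" where
  "wigner f h = (\<lambda>(x, \<xi>). LINT t|lborel.
     f (x + t /\<^sub>R 2) * cnj (h (x - t /\<^sub>R 2)) * cis (- (2 * pi * (t \<bullet> \<xi>))))"

text \<open>The Weyl operator with symbol \<open>u \<in> (S\<^sup>1\<^sup>/\<^sup>2\<^sub>1\<^sub>/\<^sub>2)'(\<real>\<^sup>2\<^sup>d)\<close> maps \<open>f\<close> to the functional
  \<open>h \<mapsto> \<langle>u, W(h, f)\<rangle>\<close>.\<close>

definition weyl_op ::
    "(((real^'d) \<times> (real^'d) \<Rightarrow> complex) \<Rightarrow> complex) \<Rightarrow>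
     (real^'d \<Rightarrow> complex) \<Rightarrow> (real^'d \<Rightarrow> complex) \<Rightarrow> complex" where
  "weyl_op u f = (\<lambda>h. u (wigner h f))"

end

theory Submission
  imports Defs "HOL-Probability.Distributions"
begin

text \<open>Expand \<open>\<pi>(z)g = \<Sum>\<^bsub>\<mu>\<^esub> \<langle>\<pi>(z)g, \<pi>(\<mu>)\<gamma>\<rangle> \<pi>(\<mu>)g\<close> with the dual window. As \<open>g\<close> and \<open>\<gamma>\<close> lie in
  \<open>S\<^bsup>1/2\<^esup>\<^bsub>1/2\<^esub>\<close>, the coefficients decay like a Gaussian in \<open>z - \<mu>\<close>. Since \<open>1/s \<le> 2\<close> and \<open>v\<close> grows at most
  exponentially, this Gaussian absorbs the cost of replacing \<open>\<mu>\<close> by \<open>z\<close> in the weight and in the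
  exponential, and what remains is a Gaussian sum over \<open>\<Lambda>\<close>, bounded uniformly in \<open>z\<close>. So the bound
  on \<open>\<Lambda> \<times> \<Lambda>\<close> extends to one variable in phase space; replacing \<open>\<sigma>\<close> by its conjugate exchanges the two
  variables, and a second application gives the bound everywhere.

  Applying \<open>\<sigma>\<^sup>w\<close> termwise needs no topology on \<open>S\<^bsup>1/2\<^esup>\<^bsub>1/2\<^esub>\<close>: Gaussians are test functions, so \<open>\<sigma>\<close> is
  integrable against every Gaussian, while \<open>W(\<pi>(w)g, \<pi>(z)g)\<close> is dominated by a Gaussian centred at
  \<open>(w + z)/2\<close>.\<close>


section \<open>Gaussians\<close>

text \<open>The exponent 1/2 enters through the factor \<open>sqrt (fact k)\<close>: bounds M A^k
  \<open>sqrt (fact k)\<close> on the products with k-th powers are, up to constants, the same as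
  Gaussian decay. This equivalence serves twice, for powers of x in the Gelfand-Shilov estimates and
  for powers of the frequency after integration by parts. All that the argument takes from g and
  \<gamma> is Gaussian decay of the pure derivatives in each coordinate direction, the predicate
  \<open>gauss_class\<close>. It is stable under multiplication by coordinates, so Hermite
  combinations are reached from a single Gaussian by building up polynomials.

  The obstacle is that the Gabor expansion converges only in L^2, while \<sigma> can be integrated
  only against Gaussian decay. Two facts about cross-Wigner distributions bridge the gap: their
  value at a point is L^2-continuous in the second window, so partial sums converge pointwise, and
  the decay of the coefficients supplies one majorant for all partial sums. In the final estimate
  the Gaussian rate e of the coefficients is split into e/4 for the weight, e/4 for the exponential
  and e/2 for the lattice sum.\<close>

lemma norm_add_sq_le: "(norm (a + b))\<^sup>2 \<le> 2 * (norm a)\<^sup>2 + 2 * (norm (b::'a::real_normed_vector))\<^sup>2"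
proof -
  have "(norm (a + b))\<^sup>2 \<le> (norm a + norm b)\<^sup>2"
    by (intro power_mono norm_triangle_ineq norm_ge_zero)
  also have "\<dots> \<le> 2 * (norm a)\<^sup>2 + 2 * (norm b)\<^sup>2"
    using zero_le_power2[of "norm a - norm b"] by (simp add: power2_sum power2_diff)
  finally show ?thesis .
qed

lemma norm_sq_eq_sum_Basis: "(norm x)\<^sup>2 = (\<Sum>b\<in>Basis. (x \<bullet> b)\<^sup>2)"
  by (simp add: norm_eq_sqrt_inner euclidean_inner[of x x] power2_eq_square sum_nonneg)

text \<open>Differentiating f' = -2 d t f, where f = exp(-d t^2), another k + 1 times by Leibniz'
  rule gives this three-term recurrence, the one of the Hermite polynomials. The recursive form
  turns both differentiation and the factorial bounds into inductions.\<close>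

fun gauss_deriv :: "real \<Rightarrow> nat \<Rightarrow> real \<Rightarrow> real" where
  "gauss_deriv d 0 t = exp (- d * t\<^sup>2)"
| "gauss_deriv d (Suc 0) t = - 2 * d * t * exp (- d * t\<^sup>2)"
| "gauss_deriv d (Suc (Suc k)) t =
     - 2 * d * t * gauss_deriv d (Suc k) t - 2 * d * real (Suc k) * gauss_deriv d k t"

text \<open>Merges the last two clauses: at \<open>k = 0\<close> the truncated index
  \<open>k - 1\<close> is harmless because its coefficient vanishes.\<close>

lemma gauss_deriv_Suc:
  "gauss_deriv d (Suc k) t = - 2 * d * t * gauss_deriv d k t - 2 * d * real k * gauss_deriv d (k - 1) t"
  by (cases k) auto

lemma has_derivative_gauss_deriv:
  "(gauss_deriv d k has_real_derivative gauss_deriv d (Suc k) t) (at t)"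
proof (induction k arbitrary: t rule: less_induct)
  case (less k)
  consider "k = 0" | "k = 1" | j where "k = Suc (Suc j)"
    by (metis One_nat_def not0_implies_Suc)
  then show ?case
  proof cases
    case 1
    have "((\<lambda>t. exp (- d * t\<^sup>2)) has_real_derivative (- 2 * d * t * exp (- d * t\<^sup>2))) (at t)"
      by (auto intro!: derivative_eq_intros)
    moreover have "gauss_deriv d 0 = (\<lambda>t. exp (- d * t\<^sup>2))" by (rule ext) simp
    ultimately show ?thesis using 1 by simp
  next
    case 2
    have "((\<lambda>t. - 2 * d * t * exp (- d * t\<^sup>2)) has_real_derivative gauss_deriv d 2 t) (at t)"
      by (auto intro!: derivative_eq_intros simp: numeral_2_eq_2 algebra_simps)
    moreover have "gauss_deriv d (Suc 0) = (\<lambda>t. - 2 * d * t * exp (- d * t\<^sup>2))" by (rule ext) simp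
    ultimately show ?thesis using 2 by (simp add: numeral_2_eq_2)
  next
    case 3
    have *: "(gauss_deriv d (Suc j) has_real_derivative gauss_deriv d (Suc (Suc j)) t) (at t)"
         "(gauss_deriv d j has_real_derivative gauss_deriv d (Suc j) t) (at t)"
      using less[of "Suc j" t] less[of j t] 3 by auto
    \<comment> \<open>The product rule on the factor t yields one more copy of -2 d
      \<open>gauss_deriv d (Suc j)\<close>, which raises the coefficient j + 1 to j + 2.\<close>
    have "((\<lambda>t. - 2 * d * t * gauss_deriv d (Suc j) t - 2 * d * real (Suc j) * gauss_deriv d j t)
       has_real_derivative gauss_deriv d (Suc k) t) (at t)"
      by (rule derivative_eq_intros * refl)+ (simp add: 3 algebra_simps)
    moreover have "gauss_deriv d (Suc (Suc j)) =
        (\<lambda>t. - 2 * d * t * gauss_deriv d (Suc j) t - 2 * d * real (Suc j) * gauss_deriv d j t)"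
      by (rule ext) simp
    ultimately show ?thesis using 3 by simp
  qed
qed

lemma fact_add_le: "fact (a + k) \<le> (2 ^ (a + k) * fact a * fact k :: real)"
proof -
  have "fact (a + k) = (fact a * fact k * ((a + k) choose a) :: nat)"
    using binomial_fact_lemma[of a "a + k"] by simp
  also have "\<dots> \<le> fact a * fact k * 2 ^ (a + k)"
    by (intro mult_left_mono binomial_le_pow2) auto
  finally have "real (fact (a + k)) \<le> real (fact a * fact k * 2 ^ (a + k))"
    by (rule of_nat_mono)
  then show ?thesis by (simp add: mult_ac)
qed

text \<open>After squaring, this says that the term of index a in the series of exp(2 d t^2) is at
  most the whole sum.\<close>

lemma power_exp_le:
  fixes t d :: real
  assumes "d > 0"
  shows "\<bar>t\<bar> ^ a * exp (- d * t\<^sup>2) \<le> (1 / sqrt (2 * d)) ^ a * sqrt (fact a)"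
proof (rule power2_le_imp_le)
  have "(2 * d * t\<^sup>2) ^ a / fact a \<le> exp (2 * d * t\<^sup>2)"
  proof -
    have s: "(\<lambda>n. (2 * d * t\<^sup>2) ^ n / fact n) sums exp (2 * d * t\<^sup>2)"
      using exp_converges[of "2 * d * t\<^sup>2"] by (simp add: field_simps)
    have "(\<Sum>n\<in>{a}. (2 * d * t\<^sup>2) ^ n / fact n) \<le> exp (2 * d * t\<^sup>2)"
      unfolding sums_unique[OF s] by (rule sum_le_suminf) (use s assms in \<open>auto simp: sums_iff\<close>)
    then show ?thesis by simp
  qed
  then have "(2 * d) ^ a * t\<^sup>2 ^ a \<le> fact a * exp (2 * d * t\<^sup>2)"
    by (simp add: divide_simps power_mult_distrib mult_ac)
  then have "t\<^sup>2 ^ a \<le> fact a * exp (2 * d * t\<^sup>2) / (2 * d) ^ a"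
    using assms by (simp add: divide_simps mult_ac)
  then have "t\<^sup>2 ^ a * exp (- 2 * d * t\<^sup>2) \<le> fact a * exp (2 * d * t\<^sup>2) / (2 * d) ^ a * exp (- 2 * d * t\<^sup>2)"
    by (rule mult_right_mono) simp
  also have "\<dots> = fact a / (2 * d) ^ a"
    by (simp add: exp_minus)
  finally have "t\<^sup>2 ^ a * exp (- 2 * d * t\<^sup>2) \<le> fact a / (2 * d) ^ a" .
  moreover have "(\<bar>t\<bar> ^ a * exp (- d * t\<^sup>2))\<^sup>2 = t\<^sup>2 ^ a * exp (- 2 * d * t\<^sup>2)"
  proof -
    have "(\<bar>t\<bar> ^ a)\<^sup>2 = t\<^sup>2 ^ a"
      by (metis power2_abs power_mult mult.commute)
    moreover have "(exp (- d * t\<^sup>2))\<^sup>2 = exp (- 2 * d * t\<^sup>2)"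
      by (simp flip: exp_double)
    ultimately show ?thesis by (simp add: power_mult_distrib)
  qed
  moreover have "((1 / sqrt (2 * d)) ^ a * sqrt (fact a))\<^sup>2 = fact a / (2 * d) ^ a"
  proof -
    have "((1 / sqrt (2 * d)) ^ a)\<^sup>2 = ((1 / sqrt (2 * d))\<^sup>2) ^ a"
      by (metis power_mult mult.commute)
    also have "(1 / sqrt (2 * d))\<^sup>2 = 1 / (2 * d)"
      using assms by (simp add: power_divide del: real_sqrt_mult)
    finally show ?thesis by (simp add: power_mult_distrib power_divide)
  qed
  ultimately show "(\<bar>t\<bar> ^ a * exp (- d * t\<^sup>2))\<^sup>2 \<le> ((1 / sqrt (2 * d)) ^ a * sqrt (fact a))\<^sup>2"
    by simp
qed (use assms in auto)

text \<open>The induction runs on the bound A^a B^k \<open>sqrt (fact (a + k))\<close>, because the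
  recurrence trades a derivative for a power of t and so preserves a + k in its leading term. Only
  at the end is the factorial split by \<open>fact_add_le\<close>, at the price of a factor
  \<open>sqrt 2\<close> in both constants.\<close>

lemma gauss_deriv_bound:
  assumes "d > 0"
  obtains A B where "A > 0" "B > 0"
    "\<And>a k t. \<bar>t ^ a * gauss_deriv d k t\<bar> \<le> A ^ a * B ^ k * sqrt (fact a) * sqrt (fact k)"
proof -
  define A where "A = 1 / sqrt (2 * d)"
  \<comment> \<open>The two terms of the recurrence contribute the fractions 2 d A / B and 2 d / B^2
    of the target bound; this B makes their sum at most 1.\<close>
  define B where "B = 1 + 2 * d * A + 2 * d"
  have A: "A > 0" and B: "B \<ge> 1" using assms by (auto simp: A_def B_def)
  have AB: "2 * d * A / B + 2 * d / B\<^sup>2 \<le> 1"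
  proof -
    have "2 * d / B \<le> 2 * d" using B assms by (simp add: divide_le_eq)
    then have "2 * d * A + 2 * d / B \<le> B" by (simp add: B_def)
    then have "(2 * d * A + 2 * d / B) / B \<le> 1" using B by simp
    then show ?thesis by (simp add: add_divide_distrib power2_eq_square)
  qed
  have bnd: "\<bar>t\<bar> ^ a * \<bar>gauss_deriv d k t\<bar> \<le> A ^ a * B ^ k * sqrt (fact (a + k))" for a k t
  proof (induction k arbitrary: a rule: less_induct)
    case (less k)
    show ?case
    proof (cases k)
      case 0
      then show ?thesis using power_exp_le[OF assms, of t a] by (simp add: A_def)
    next
      case (Suc j)
      define X where "X = A ^ a * B ^ k * sqrt (fact (a + k))"
      have X: "X \<ge> 0" using A B by (simp add: X_def)
      have 1: "\<bar>t\<bar> ^ Suc a * \<bar>gauss_deriv d j t\<bar> \<le> (A / B) * X"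
        using less[of j "Suc a"] Suc B by (simp add: X_def)
      have 2: "real j * (\<bar>t\<bar> ^ a * \<bar>gauss_deriv d (j - 1) t\<bar>) \<le> (1 / B\<^sup>2) * X"
      proof (cases j)
        case 0
        then show ?thesis using X B by simp
      next
        case (Suc i)
        have "\<bar>t\<bar> ^ a * \<bar>gauss_deriv d i t\<bar> \<le> A ^ a * B ^ i * sqrt (fact (a + i))"
          using less[of i a] Suc \<open>k = Suc j\<close> by simp
        then have "real j * (\<bar>t\<bar> ^ a * \<bar>gauss_deriv d i t\<bar>) \<le> real j * (A ^ a * B ^ i * sqrt (fact (a + i)))"
          by (rule mult_left_mono) simp
        also have "\<dots> = A ^ a * B ^ i * (real j * sqrt (fact (a + i)))" by simp
        \<comment> \<open>Passing from i to k = i + 2 gains two factors under the root, each at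
          least j, which pays for the coefficient j.\<close>
        also have "real j * sqrt (fact (a + i)) \<le> sqrt (fact (a + k))"
        proof -
          have "real j * sqrt (fact (a + i)) = sqrt ((real j)\<^sup>2 * fact (a + i))"
            by (simp add: real_sqrt_mult)
          also have "\<dots> \<le> sqrt (fact (a + k))"
          proof (rule real_sqrt_le_mono)
            have "(real j)\<^sup>2 * fact (a + i) \<le> (real (a + i + 2) * real (a + i + 1)) * fact (a + i)"
              unfolding power2_eq_square
              by (intro mult_right_mono mult_mono) (auto simp: Suc)
            also have "\<dots> = fact (a + k)"
              using Suc \<open>k = Suc j\<close> by (simp add: algebra_simps)
            finally show "(real j)\<^sup>2 * fact (a + i) \<le> fact (a + k)" .
          qed
          finally show ?thesis .
        qed
        then have "A ^ a * B ^ i * (real j * sqrt (fact (a + i))) \<le> A ^ a * B ^ i * sqrt (fact (a + k))"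
          using A B by (intro mult_left_mono) auto
        also have "\<dots> = (1 / B\<^sup>2) * X"
          using Suc \<open>k = Suc j\<close> B by (simp add: X_def power2_eq_square)
        finally show ?thesis using Suc by simp
      qed
      have "\<bar>t\<bar> ^ a * \<bar>gauss_deriv d k t\<bar>
          \<le> \<bar>t\<bar> ^ a * (2 * d * \<bar>t\<bar> * \<bar>gauss_deriv d j t\<bar> + 2 * d * real j * \<bar>gauss_deriv d (j - 1) t\<bar>)"
        unfolding Suc gauss_deriv_Suc
        by (intro mult_left_mono order_trans[OF abs_triangle_ineq4]) (use assms in \<open>auto simp: abs_mult\<close>)
      also have "\<dots> = 2 * d * (\<bar>t\<bar> ^ Suc a * \<bar>gauss_deriv d j t\<bar>)
          + 2 * d * (real j * (\<bar>t\<bar> ^ a * \<bar>gauss_deriv d (j - 1) t\<bar>))"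
        by (simp add: algebra_simps)
      also have "\<dots> \<le> 2 * d * ((A / B) * X) + 2 * d * ((1 / B\<^sup>2) * X)"
        by (intro add_mono mult_left_mono 1 2) (use assms in auto)
      also have "\<dots> = (2 * d * A / B + 2 * d / B\<^sup>2) * X" by (simp add: algebra_simps)
      also have "\<dots> \<le> X" using mult_right_mono[OF AB X] by simp
      finally show ?thesis by (simp add: X_def)
    qed
  qed
  have "\<bar>t ^ a * gauss_deriv d k t\<bar> \<le> (sqrt 2 * A) ^ a * (sqrt 2 * B) ^ k * sqrt (fact a) * sqrt (fact k)" for a k t
  proof -
    have "\<bar>t ^ a * gauss_deriv d k t\<bar> \<le> A ^ a * B ^ k * sqrt (fact (a + k))"
      using bnd[of t a k] by (simp add: abs_mult power_abs)
    also have "\<dots> \<le> A ^ a * B ^ k * sqrt (2 ^ (a + k) * fact a * fact k)"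
      using A B by (intro mult_left_mono real_sqrt_le_mono fact_add_le) auto
    also have "\<dots> = (sqrt 2 * A) ^ a * (sqrt 2 * B) ^ k * sqrt (fact a) * sqrt (fact k)"
      by (simp add: real_sqrt_mult power_mult_distrib power_add real_sqrt_power)
    finally show ?thesis .
  qed
  then show thesis using A B by (intro that[of "sqrt 2 * A" "sqrt 2 * B"]) auto
qed

text \<open>The mixed partial derivative of order \<open>n\<close> of exp(-d |x|^2). As the Gaussian
  factorizes over the coordinates, a further derivative along b only raises \<open>n b\<close>, so
  the family is closed under all iterated partial derivatives.\<close>

definition gauss_partial :: "real \<Rightarrow> ('a \<Rightarrow> nat) \<Rightarrow> 'a::euclidean_space \<Rightarrow> complex" where
  "gauss_partial d n x = (\<Prod>b\<in>Basis. complex_of_real (gauss_deriv d (n b) (x \<bullet> b)))"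

lemma gauss_partial_0: "gauss_partial d (\<lambda>_. 0) x = of_real (exp (- d * (norm x)\<^sup>2))"
proof -
  have "(norm x)\<^sup>2 = (\<Sum>b\<in>Basis. (x \<bullet> b)\<^sup>2)"
    by (rule norm_sq_eq_sum_Basis)
  then show ?thesis
    by (simp add: gauss_partial_def exp_sum sum_distrib_left sum_negf[symmetric])
qed

lemma gauss_partial_deriv:
  assumes "b \<in> Basis"
  shows "((\<lambda>r. gauss_partial d n (x + r *\<^sub>R b)) has_vector_derivative gauss_partial d (n(b := Suc (n b))) x) (at 0)"
proof -
  let ?R = "\<Prod>c\<in>Basis - {b}. complex_of_real (gauss_deriv d (n c) (x \<bullet> c))"
  have split: "gauss_partial d n' (x + r *\<^sub>R b) = of_real (gauss_deriv d (n' b) (x \<bullet> b + r)) * ?R"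
    if "\<And>c. c \<noteq> b \<Longrightarrow> n' c = n c" for r n'
  proof -
    have "(\<Prod>c\<in>Basis - {b}. complex_of_real (gauss_deriv d (n' c) ((x + r *\<^sub>R b) \<bullet> c))) = ?R"
      by (rule prod.cong) (use assms that in \<open>auto simp: inner_add_left inner_not_same_Basis\<close>)
    then show ?thesis
      unfolding gauss_partial_def using assms by (subst prod.remove[of _ b]) (auto simp: inner_add_left)
  qed
  have "((\<lambda>r. gauss_deriv d (n b) (r + x \<bullet> b)) has_real_derivative gauss_deriv d (Suc (n b)) (0 + x \<bullet> b)) (at 0)"
    by (rule DERIV_shift[THEN iffD1, OF has_derivative_gauss_deriv])
  then have "((\<lambda>r. gauss_deriv d (n b) (x \<bullet> b + r)) has_real_derivative gauss_deriv d (Suc (n b)) (x \<bullet> b + 0)) (at 0)"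
    by (simp add: add.commute)
  then have "((\<lambda>r. complex_of_real (gauss_deriv d (n b) (x \<bullet> b + r)) * ?R) has_vector_derivative
      of_real (gauss_deriv d (Suc (n b)) (x \<bullet> b + 0)) * ?R) (at 0)"
    by (intro has_vector_derivative_mult_left has_vector_derivative_of_real)
       (simp add: has_real_derivative_iff_has_vector_derivative)
  then show ?thesis
    using split[of n] split[of "n(b := Suc (n b))" 0] by simp
qed

lemma partial_deriv_gauss_partial:
  "b \<in> Basis \<Longrightarrow> partial_deriv b (gauss_partial d n) = gauss_partial d (n(b := Suc (n b)))"
  unfolding partial_deriv_def by (intro ext vector_derivative_at gauss_partial_deriv)

lemma foldr_partial_deriv_gauss_partial:
  "set bs \<subseteq> Basis \<Longrightarrow> \<exists>n'. foldr partial_deriv bs (gauss_partial d n) = gauss_partial d n'"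
  by (induction bs) (auto simp: partial_deriv_gauss_partial)

lemma partial_deriv_power_gauss_partial:
  assumes "b \<in> Basis"
  shows "(partial_deriv b ^^ k) (gauss_partial d n) = gauss_partial d (n(b := n b + k))"
  by (induction k) (auto simp: partial_deriv_gauss_partial assms fun_upd_def intro!: arg_cong[where f = "gauss_partial d"])

lemma basis_list: "distinct (basis_list :: 'a::euclidean_space list)" "set (basis_list :: 'a list) = Basis"
proof -
  have "\<exists>bs :: 'a list. distinct bs \<and> set bs = Basis"
    using finite_distinct_list[OF finite_Basis] by blast
  from someI_ex[OF this]
  show "distinct (basis_list :: 'a list)" "set (basis_list :: 'a list) = Basis"
    unfolding basis_list_def by blast+
qed

lemma mi_deriv_gauss_partial:
  "mi_deriv \<beta> (gauss_partial d (\<lambda>_. 0)) = (gauss_partial d \<beta> :: 'a::euclidean_space \<Rightarrow> _)"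
proof -
  have "foldr (\<lambda>b. partial_deriv b ^^ \<beta> b) bs (gauss_partial d (\<lambda>_. 0))
      = gauss_partial d (\<lambda>b. if b \<in> set bs then \<beta> b else 0)"
    if "distinct bs" "set bs \<subseteq> Basis" for bs :: "'a list"
    using that
    by (induction bs)
       (auto simp: partial_deriv_power_gauss_partial intro!: arg_cong[where f = "gauss_partial d"])
  from this[OF basis_list(1)] show ?thesis
    by (auto simp: basis_list mi_deriv_def gauss_partial_def[abs_def])
qed

lemma continuous_gauss_partial: "continuous_on UNIV (gauss_partial d n)"
proof -
  have "continuous_on UNIV (\<lambda>x. gauss_deriv d (n b) (x \<bullet> b))" for b :: 'a
  proof (rule continuous_on_compose2[of UNIV "gauss_deriv d (n b)"])
    show "continuous_on UNIV (gauss_deriv d (n b))"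
      by (intro continuous_at_imp_continuous_on ballI DERIV_isCont[OF has_derivative_gauss_deriv])
  qed (auto intro!: continuous_intros)
  then show ?thesis
    unfolding gauss_partial_def[abs_def] by (intro continuous_on_prod continuous_on_of_real)
qed

lemma real_sqrt_prod: "sqrt (prod f A) = (\<Prod>x\<in>A. sqrt (f x))"
  by (induction A rule: infinite_finite_induct) (auto simp: real_sqrt_mult)

text \<open>The one-dimensional bounds multiply over the coordinates, and their
  \<open>sqrt (fact _)\<close> is exactly the power 1/2 of the factorial. Two uses follow:
  integrability of \<sigma> against Gaussians, and the starting point for Hermite functions.\<close>

lemma gaussian_in_gelfand_shilov:
  assumes "d > 0"
  shows "(\<lambda>x::'a::euclidean_space. complex_of_real (exp (- d * (norm x)\<^sup>2))) \<in> gelfand_shilov (1 / 2)"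
proof -
  let ?f = "gauss_partial d (\<lambda>_. 0) :: 'a \<Rightarrow> complex"
  obtain A B where AB: "A > 0" "B > 0" and
    bnd: "\<And>a k t. \<bar>t ^ a * gauss_deriv d k t\<bar> \<le> A ^ a * B ^ k * sqrt (fact a) * sqrt (fact k)"
    using gauss_deriv_bound[OF assms] by metis
  have gs: "gs_bound (1 / 2) A B 1 ?f"
    unfolding gs_bound_def
  proof (intro allI)
    fix x :: 'a and \<alpha> \<beta> :: "'a \<Rightarrow> nat"
    have "of_real (mi_power x \<alpha>) * mi_deriv \<beta> ?f x
        = complex_of_real (\<Prod>b\<in>Basis. (x \<bullet> b) ^ \<alpha> b * gauss_deriv d (\<beta> b) (x \<bullet> b))"
      by (simp add: mi_deriv_gauss_partial mi_power_def gauss_partial_def prod.distrib)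
    then have "cmod (of_real (mi_power x \<alpha>) * mi_deriv \<beta> ?f x)
        = (\<Prod>b\<in>Basis. \<bar>(x \<bullet> b) ^ \<alpha> b * gauss_deriv d (\<beta> b) (x \<bullet> b)\<bar>)"
      by (simp only: norm_of_real abs_prod)
    also have "\<dots> \<le> (\<Prod>b\<in>Basis. A ^ \<alpha> b * B ^ \<beta> b * sqrt (fact (\<alpha> b)) * sqrt (fact (\<beta> b)))"
      by (intro prod_mono) (auto intro: bnd)
    also have "\<dots> = A ^ mi_abs \<alpha> * B ^ mi_abs \<beta> * mi_fact \<alpha> powr (1/2) * mi_fact \<beta> powr (1/2)"
    proof -
      have "mi_fact \<eta> powr (1/2) = (\<Prod>b\<in>Basis. sqrt (fact (\<eta> b)))" for \<eta> :: "'a \<Rightarrow> nat"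
        unfolding mi_fact_def by (subst powr_half_sqrt) (auto simp: real_sqrt_prod intro!: prod_nonneg)
      then show ?thesis by (simp only: prod.distrib mi_abs_def power_sum)
    qed
    finally show "cmod (of_real (mi_power x \<alpha>) * mi_deriv \<beta> ?f x)
        \<le> 1 * A ^ mi_abs \<alpha> * B ^ mi_abs \<beta> * mi_fact \<alpha> powr (1/2) * mi_fact \<beta> powr (1/2)"
      by simp
  qed
  have "smooth ?f"
    unfolding smooth_def
  proof (intro allI impI conjI ballI)
    fix bs :: "'a list" assume "set bs \<subseteq> Basis"
    then obtain n where n: "foldr partial_deriv bs ?f = gauss_partial d n"
      using foldr_partial_deriv_gauss_partial by blast
    show "continuous_on UNIV (foldr partial_deriv bs ?f)"
      unfolding n by (rule continuous_gauss_partial)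
    show "(\<lambda>t. foldr partial_deriv bs ?f (x + t *\<^sub>R b)) differentiable (at 0)" if "b \<in> Basis" for x b
      unfolding n using gauss_partial_deriv[OF that] by (rule differentiableI_vector)
  qed
  moreover have "\<exists>C. \<forall>x. cmod (of_real (mi_power x \<alpha>) * mi_deriv \<beta> ?f x) \<le> C" for \<alpha> \<beta>
    using gs unfolding gs_bound_def by blast
  ultimately have "?f \<in> gelfand_shilov (1 / 2)"
    using gs AB unfolding gelfand_shilov_def schwartz_space_def mem_Collect_eq
    by (metis zero_less_one)
  then show ?thesis by (simp add: gauss_partial_0[abs_def])
qed

text \<open>Converse to \<open>power_exp_le\<close>. Squaring the bounds, dividing by (2 A^2)^j j!
  and summing over j gives an exponential series on the left and a geometric series of ratio 1/2 on
  the right.\<close>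

lemma gaussian_decay_of_power_bounds:
  fixes y V M A :: real
  assumes bnd: "\<And>j. \<bar>y\<bar> ^ j * V \<le> M * A ^ j * sqrt (fact j)" and "A > 0" "V \<ge> 0" "M \<ge> 0"
  shows "V \<le> 2 * M * exp (- (1 / (4 * A\<^sup>2)) * y\<^sup>2)"
proof (rule power2_le_imp_le)
  let ?u = "y\<^sup>2 / (2 * A\<^sup>2)"
  have s: "(\<lambda>j. V\<^sup>2 * (?u ^ j / fact j)) sums (V\<^sup>2 * exp ?u)"
    using sums_mult[OF exp_converges[of ?u], of "V\<^sup>2"] by (simp only: real_scaleR_def divide_inverse_commute)
  have s2: "(\<lambda>j. M\<^sup>2 * (1/2) ^ j) sums (M\<^sup>2 * (1 / (1 - 1/2)))"
    by (intro sums_mult geometric_sums) auto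
  have "V\<^sup>2 * exp ?u \<le> M\<^sup>2 * (1 / (1 - 1/2))"
  proof (rule sums_le[OF _ s s2])
    fix j
    have "(\<bar>y\<bar> ^ j * V)\<^sup>2 \<le> (M * A ^ j * sqrt (fact j))\<^sup>2"
      by (intro power_mono bnd) (use assms in auto)
    moreover have "(\<bar>y\<bar> ^ j)\<^sup>2 = y\<^sup>2 ^ j" "(A ^ j)\<^sup>2 = (A\<^sup>2) ^ j"
      by (metis power2_abs power_mult mult.commute)+
    ultimately have "y\<^sup>2 ^ j * V\<^sup>2 \<le> M\<^sup>2 * (A\<^sup>2) ^ j * fact j"
      by (simp add: power_mult_distrib)
    then have "(y\<^sup>2 ^ j * V\<^sup>2) / (2 ^ j * (A\<^sup>2) ^ j * fact j) \<le> (M\<^sup>2 * (A\<^sup>2) ^ j * fact j) / (2 ^ j * (A\<^sup>2) ^ j * fact j)"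
      by (rule divide_right_mono) simp
    also have "\<dots> = M\<^sup>2 * (1/2) ^ j" using \<open>A > 0\<close> by (simp add: power_divide)
    finally show "V\<^sup>2 * (?u ^ j / fact j) \<le> M\<^sup>2 * (1/2) ^ j"
      by (simp add: power_divide power_mult_distrib mult.commute)
  qed
  then have "V\<^sup>2 * exp ?u * exp (- ?u) \<le> 2 * M\<^sup>2 * exp (- ?u)"
    by (intro mult_right_mono) auto
  then have "V\<^sup>2 \<le> 2 * M\<^sup>2 * exp (- ?u)" by (simp add: exp_minus field_simps)
  also have "\<dots> \<le> 4 * M\<^sup>2 * exp (- ?u)" by (intro mult_right_mono) auto
  also have "\<dots> = (2 * M * exp (- (1 / (4 * A\<^sup>2)) * y\<^sup>2))\<^sup>2"
  proof -
    have "(exp (- (1 / (4 * A\<^sup>2)) * y\<^sup>2))\<^sup>2 = exp (- ?u)"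
      unfolding exp_double[symmetric] by simp
    then show ?thesis unfolding power_mult_distrib by simp
  qed
  finally show "V\<^sup>2 \<le> (2 * M * exp (- (1 / (4 * A\<^sup>2)) * y\<^sup>2))\<^sup>2" .
qed (use assms in auto)

section \<open>Gaussian decay of all derivatives\<close>

text \<open>The chain \<open>F\<close> consists of the iterated derivatives of \<open>f\<close> in the direction \<open>b\<close>. The bound is the
  condition defining \<open>S\<^bsup>1/2\<^esup>\<^bsub>1/2\<^esub>\<close>, with the powers of \<open>x\<close> summed to a Gaussian.\<close>

definition gauss_chain :: "'a \<Rightarrow> real \<Rightarrow> real \<Rightarrow> real \<Rightarrow> ('a::euclidean_space \<Rightarrow> complex) \<Rightarrow> bool" where
  "gauss_chain b C B d f \<longleftrightarrow> (\<exists>F. F 0 = f \<and>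
     (\<forall>k. continuous_on UNIV (F k)) \<and>
     (\<forall>k x. ((\<lambda>r. F k (x + r *\<^sub>R b)) has_vector_derivative F (Suc k) x) (at 0)) \<and>
     (\<forall>k x. cmod (F k x) \<le> C * B ^ k * sqrt (fact k) * exp (- d * (norm x)\<^sup>2)))"

text \<open>The constants are common to all coordinate directions, and mixed derivatives do not
  occur: frequency decay is obtained along one coordinate at a time. Leaving the constants
  existential lets each closure property worsen them freely.\<close>

definition gauss_class :: "('a::euclidean_space \<Rightarrow> complex) \<Rightarrow> bool" where
  "gauss_class f \<longleftrightarrow> (\<exists>C>0. \<exists>B>0. \<exists>d>0. \<forall>b\<in>Basis. gauss_chain b C B d f)"

text \<open>The largest coordinate carries at least the average share of the squared norm. This
  turns decay in one coordinate into decay in the norm.\<close>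

lemma ex_Basis_norm_le:
  fixes x :: "'a::euclidean_space"
  shows "\<exists>b\<in>Basis. (norm x)\<^sup>2 \<le> real DIM('a) * (x \<bullet> b)\<^sup>2"
proof (rule ccontr)
  assume "\<not> ?thesis"
  then have *: "(x \<bullet> b)\<^sup>2 < (norm x)\<^sup>2 / real DIM('a)" if "b \<in> Basis" for b
    using that by (auto simp: field_simps not_le)
  have "(norm x)\<^sup>2 = (\<Sum>b\<in>Basis. (x \<bullet> b)\<^sup>2)"
    by (rule norm_sq_eq_sum_Basis)
  also have "\<dots> < (\<Sum>b\<in>(Basis::'a set). (norm x)\<^sup>2 / real DIM('a))"
    by (intro sum_strict_mono *) auto
  also have "\<dots> = (norm x)\<^sup>2" by simp
  finally show False by simp
qed

text \<open>Multi-indices concentrated on one basis vector suffice: derivatives along b, and powers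
  along a coordinate e that dominates x. For fixed x and k, the bounds over all powers j sum to a
  Gaussian in that coordinate.\<close>

lemma gelfand_shilov_gauss_class:
  fixes f :: "'a::euclidean_space \<Rightarrow> complex"
  assumes "f \<in> gelfand_shilov (1 / 2)"
  shows "gauss_class f"
proof -
  from assms obtain A B c where AB: "A > 0" "B > 0" "c > 0" and gs: "gs_bound (1/2) A B c f"
    and sm: "smooth f"
    by (auto simp: gelfand_shilov_def schwartz_space_def)
  \<comment> \<open>1 / (4 A^2) is the rate from summing the powers; the dimension is lost in
    passing from the dominant coordinate to the norm.\<close>
  define d where "d = 1 / (4 * A\<^sup>2) / real DIM('a)"
  have "gauss_chain b (2 * c) B d f" if b: "b \<in> Basis" for b
    unfolding gauss_chain_def
  proof (intro exI[of _ "\<lambda>k. (partial_deriv b ^^ k) f"] conjI allI)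
    fix k x
    have eq: "(partial_deriv b ^^ k) f = foldr partial_deriv (replicate k b) f" for k
      by (induction k) auto
    show "continuous_on UNIV ((partial_deriv b ^^ k) f)"
      unfolding eq using sm b unfolding smooth_def by (metis (full_types) in_set_replicate subsetI)
    have "(\<lambda>t. (partial_deriv b ^^ k) f (x + t *\<^sub>R b)) differentiable (at 0)"
      unfolding eq using sm b unfolding smooth_def by (metis (full_types) in_set_replicate subsetI)
    then show "((\<lambda>r. (partial_deriv b ^^ k) f (x + r *\<^sub>R b)) has_vector_derivative (partial_deriv b ^^ Suc k) f x) (at 0)"
      by (simp add: partial_deriv_def vector_derivative_works)
    have "foldr (\<lambda>c. partial_deriv c ^^ (if c = b then k else 0)) bs f
        = (if b \<in> set bs then (partial_deriv b ^^ k) f else f)" if "distinct bs" for bs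
      using that by (induction bs) auto
    from this[OF basis_list(1)] have mi: "mi_deriv (\<lambda>c. if c = b then k else 0) f = (partial_deriv b ^^ k) f"
      using b by (simp add: mi_deriv_def basis_list)
    obtain e where e: "e \<in> Basis" "(norm x)\<^sup>2 \<le> real DIM('a) * (x \<bullet> e)\<^sup>2"
      using ex_Basis_norm_le by blast
    have ind: "mi_abs (\<lambda>c. if c = e then j else 0) = j" "mi_fact (\<lambda>c. if c = e then j else 0) = fact j"
      "mi_power x (\<lambda>c. if c = e then j else 0) = (x \<bullet> e) ^ j" if "e \<in> Basis" for e :: 'a and j x
      using that by (auto simp: mi_abs_def mi_fact_def mi_power_def if_distrib[of fact] if_distrib[of "\<lambda>j. _ ^ j"] cong: if_cong)
    have "cmod ((partial_deriv b ^^ k) f x) \<le> 2 * (c * B ^ k * sqrt (fact k)) * exp (- (1 / (4 * A\<^sup>2)) * (x \<bullet> e)\<^sup>2)"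
    proof (rule gaussian_decay_of_power_bounds)
      fix j
      show "\<bar>x \<bullet> e\<bar> ^ j * cmod ((partial_deriv b ^^ k) f x) \<le> c * B ^ k * sqrt (fact k) * A ^ j * sqrt (fact j)"
        using gs[unfolded gs_bound_def, rule_format, of x "\<lambda>c. if c = e then j else 0" "\<lambda>c. if c = b then k else 0"]
        by (simp add: ind b e mi powr_half_sqrt norm_mult norm_power mult_ac)
    qed (use AB in auto)
    also have "\<dots> \<le> 2 * (c * B ^ k * sqrt (fact k)) * exp (- d * (norm x)\<^sup>2)"
    proof (intro mult_left_mono)
      have "(1 / (4 * A\<^sup>2) / real DIM('a)) * (norm x)\<^sup>2 \<le> (1 / (4 * A\<^sup>2) / real DIM('a)) * (real DIM('a) * (x \<bullet> e)\<^sup>2)"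
        by (intro mult_left_mono e) auto
      then show "exp (- (1 / (4 * A\<^sup>2)) * (x \<bullet> e)\<^sup>2) \<le> exp (- d * (norm x)\<^sup>2)"
        by (simp add: d_def)
    qed (use AB in auto)
    finally show "cmod ((partial_deriv b ^^ k) f x) \<le> 2 * c * B ^ k * sqrt (fact k) * exp (- d * (norm x)\<^sup>2)"
      by (simp add: mult_ac)
  qed auto
  moreover have "d > 0" using AB by (simp add: d_def)
  ultimately show ?thesis unfolding gauss_class_def using AB
    by (intro exI[of _ "2 * c"] conjI exI[of _ B] exI[of _ d]) auto
qed


section \<open>Integrability of Gaussians and affine changes of variables\<close>

lemma integrable_gaussian:
  assumes "d > 0"
  shows "integrable lborel (\<lambda>x::'a::euclidean_space. exp (- d * (norm x)\<^sup>2))"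
proof (rule integrableI_nonneg)
  have 1: "integrable lborel (\<lambda>t::real. exp (- d * t\<^sup>2))"
  proof -
    \<comment> \<open>Standard deviation of the normal density proportional to exp(-d t^2).\<close>
    let ?s = "1 / sqrt (2 * d)"
    have s: "?s\<^sup>2 = 1 / (2 * d)" "?s > 0"
      using assms by (simp_all add: power_divide del: real_sqrt_mult)
    have "integrable lborel (\<lambda>t. sqrt (2 * pi * ?s\<^sup>2) * normal_density 0 ?s t)"
      using s by (intro integrable_mult_right integrable_normal_density) auto
    moreover have "sqrt (2 * pi * ?s\<^sup>2) * normal_density 0 ?s t = exp (- d * t\<^sup>2)" for t
      unfolding normal_density_def s(1) using assms by simp
    ultimately show ?thesis by simp
  qed
  have eq: "ennreal (exp (- d * (norm x)\<^sup>2)) = (\<Prod>b\<in>Basis. ennreal (exp (- d * (x \<bullet> b)\<^sup>2)))" for x :: 'a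
  proof -
    have "(norm x)\<^sup>2 = (\<Sum>b\<in>Basis. (x \<bullet> b)\<^sup>2)"
      by (rule norm_sq_eq_sum_Basis)
    then have "exp (- d * (norm x)\<^sup>2) = (\<Prod>b\<in>Basis. exp (- d * (x \<bullet> b)\<^sup>2))"
      by (simp only: sum_distrib_left exp_sum finite_Basis)
    then show ?thesis by (simp add: prod_ennreal)
  qed
  have "(\<integral>\<^sup>+x. ennreal (exp (- d * (norm (x::'a))\<^sup>2)) \<partial>lborel)
      = (\<Prod>b\<in>(Basis::'a set). (\<integral>\<^sup>+t. ennreal (exp (- d * t\<^sup>2)) \<partial>lborel))"
    unfolding eq by (rule nn_integral_lborel_prod[where f = "\<lambda>_ t. ennreal (exp (- d * t\<^sup>2))"]) auto
  also have "\<dots> < \<infinity>"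
  proof -
    have "(\<integral>\<^sup>+t. ennreal (exp (- d * t\<^sup>2)) \<partial>lborel) < \<infinity>"
      using 1 by (simp add: integrable_iff_bounded)
    then show ?thesis by (simp add: power_less_top_ennreal)
  qed
  finally show "(\<integral>\<^sup>+x. ennreal (exp (- d * (norm (x::'a))\<^sup>2)) \<partial>lborel) < \<infinity>" .
qed auto

lemma lborel_integral_affine:
  fixes f :: "'a::euclidean_space \<Rightarrow> 'b::{banach, second_countable_topology}"
  assumes [measurable]: "f \<in> borel_measurable borel" and "c \<noteq> 0"
  shows "(LINT x|lborel. f x) = \<bar>c\<bar> ^ DIM('a) *\<^sub>R (LINT x|lborel. f (t + c *\<^sub>R x))"
    "integrable lborel (\<lambda>x. f (t + c *\<^sub>R x)) \<longleftrightarrow> integrable lborel f"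
proof -
  have "(LINT x|lborel. f x) = (LINT x|density (distr lborel borel (\<lambda>x. t + c *\<^sub>R x)) (\<lambda>_. \<bar>c\<bar> ^ DIM('a)). f x)"
    using lborel_affine[OF \<open>c \<noteq> 0\<close>, of t] by (metis (no_types, lifting))
  also have "\<dots> = \<bar>c\<bar> ^ DIM('a) *\<^sub>R (LINT x|lborel. f (t + c *\<^sub>R x))"
    by (subst integral_density) (auto simp: integral_distr)
  finally show "(LINT x|lborel. f x) = \<bar>c\<bar> ^ DIM('a) *\<^sub>R (LINT x|lborel. f (t + c *\<^sub>R x))" .
  have "integrable lborel f \<longleftrightarrow> integrable (density (distr lborel borel (\<lambda>x. t + c *\<^sub>R x)) (\<lambda>_. \<bar>c\<bar> ^ DIM('a))) f"
    using lborel_affine[OF \<open>c \<noteq> 0\<close>, of t] by (metis (no_types, lifting))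
  also have "\<dots> \<longleftrightarrow> integrable lborel (\<lambda>x. f (t + c *\<^sub>R x))"
  proof (subst integrable_density)
    let ?k = "\<bar>c\<bar> ^ DIM('a)"
    have k: "?k \<noteq> 0" using \<open>c \<noteq> 0\<close> by simp
    have "integrable lborel (\<lambda>x. f (t + c *\<^sub>R x))" if "integrable lborel (\<lambda>x. ?k *\<^sub>R f (t + c *\<^sub>R x))"
      using integrable_scaleR_right[OF that, of "inverse ?k"] k by simp
    then show "integrable (distr lborel borel (\<lambda>x. t + c *\<^sub>R x)) (\<lambda>x. ?k *\<^sub>R f x) \<longleftrightarrow>
        integrable lborel (\<lambda>x. f (t + c *\<^sub>R x))"
      by (subst integrable_distr_eq) auto
  qed auto
  finally show "integrable lborel (\<lambda>x. f (t + c *\<^sub>R x)) \<longleftrightarrow> integrable lborel f" by simp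
qed

lemma lborel_integral_translate:
  fixes f :: "'a::euclidean_space \<Rightarrow> 'b::{banach, second_countable_topology}"
  assumes "f \<in> borel_measurable borel"
  shows "(LINT x|lborel. f (x + t)) = (LINT x|lborel. f x)"
    "integrable lborel (\<lambda>x. f (x + t)) \<longleftrightarrow> integrable lborel f"
  using lborel_integral_affine[OF assms, of 1 t] by (simp_all add: add.commute)

section \<open>Closure properties of the class of functions with Gaussian-decaying
  derivatives\<close>

lemma gauss_chain_mono:
  assumes "gauss_chain b C B d f" "C \<le> C'" "B \<le> B'" "d' \<le> d" "0 \<le> C" "0 \<le> B"
  shows "gauss_chain b C' B' d' f"
proof -
  have "C * B ^ k * sqrt (fact k) * exp (- d * (norm x)\<^sup>2)
      \<le> C' * B' ^ k * sqrt (fact k) * exp (- d' * (norm x)\<^sup>2)" for k and x :: 'a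
    using assms by (intro mult_mono power_mono) (auto intro: mult_right_mono)
  note bnd = this
  obtain F where F: "F 0 = f" "\<And>k. continuous_on UNIV (F k)"
    "\<And>k x. ((\<lambda>r. F k (x + r *\<^sub>R b)) has_vector_derivative F (Suc k) x) (at 0)"
    "\<And>k x. cmod (F k x) \<le> C * B ^ k * sqrt (fact k) * exp (- d * (norm x)\<^sup>2)"
    using assms(1) unfolding gauss_chain_def by blast
  then show ?thesis
    unfolding gauss_chain_def by (intro exI[of _ F] conjI allI order_trans[OF F(4) bnd]) auto
qed

lemma gauss_chain_add:
  assumes "gauss_chain b C B d f" "gauss_chain b C' B d h"
  shows "gauss_chain b (C + C') B d (\<lambda>x. f x + h x)"
proof -
  obtain F where F: "F 0 = f" "\<And>k. continuous_on UNIV (F k)"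
    "\<And>k x. ((\<lambda>r. F k (x + r *\<^sub>R b)) has_vector_derivative F (Suc k) x) (at 0)"
    "\<And>k x. cmod (F k x) \<le> C * B ^ k * sqrt (fact k) * exp (- d * (norm x)\<^sup>2)"
    using assms(1) unfolding gauss_chain_def by blast
  obtain H where H: "H 0 = h" "\<And>k. continuous_on UNIV (H k)"
    "\<And>k x. ((\<lambda>r. H k (x + r *\<^sub>R b)) has_vector_derivative H (Suc k) x) (at 0)"
    "\<And>k x. cmod (H k x) \<le> C' * B ^ k * sqrt (fact k) * exp (- d * (norm x)\<^sup>2)"
    using assms(2) unfolding gauss_chain_def by blast
  show ?thesis
    unfolding gauss_chain_def
  proof (intro exI[of _ "\<lambda>k x. F k x + H k x"] conjI allI)
    fix k x
    have "cmod (F k x + H k x) \<le> C * B ^ k * sqrt (fact k) * exp (- d * (norm x)\<^sup>2)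
        + C' * B ^ k * sqrt (fact k) * exp (- d * (norm x)\<^sup>2)"
      by (intro norm_triangle_mono F H)
    then show "cmod (F k x + H k x) \<le> (C + C') * B ^ k * sqrt (fact k) * exp (- d * (norm x)\<^sup>2)"
      by (simp add: distrib_right)
  qed (auto intro: F H continuous_on_add has_vector_derivative_add simp: F(1) H(1))
qed

lemma gauss_chain_cmult:
  assumes "gauss_chain b C B d f"
  shows "gauss_chain b (cmod a * C) B d (\<lambda>x. a * f x)"
proof -
  obtain F where F: "F 0 = f" "\<And>k. continuous_on UNIV (F k)"
    "\<And>k x. ((\<lambda>r. F k (x + r *\<^sub>R b)) has_vector_derivative F (Suc k) x) (at 0)"
    "\<And>k x. cmod (F k x) \<le> C * B ^ k * sqrt (fact k) * exp (- d * (norm x)\<^sup>2)"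
    using assms(1) unfolding gauss_chain_def by blast
  show ?thesis
    unfolding gauss_chain_def
  proof (intro exI[of _ "\<lambda>k x. a * F k x"] conjI allI)
    fix k x
    show "cmod (a * F k x) \<le> cmod a * C * B ^ k * sqrt (fact k) * exp (- d * (norm x)\<^sup>2)"
      using mult_left_mono[OF F(4)[of k x], of "cmod a"] by (simp add: norm_mult mult.assoc)
  qed (auto intro: F continuous_on_mult_left has_vector_derivative_mult_right simp: F(1))
qed

text \<open>By Leibniz' rule the k-th derivative of (x . c) f has just two terms, since x . c is
  affine. The unbounded factor x . c costs half of the Gaussian, and the factor k costs the doubling
  of B.\<close>

lemma gauss_chain_coord:
  assumes "gauss_chain b C B d f" "C \<ge> 0" "B > 0" "d > 0" "norm b \<le> 1" "norm c \<le> 1"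
  shows "gauss_chain b (C * (1 / sqrt d + 1 / B)) (2 * B) (d / 2) (\<lambda>x. of_real (x \<bullet> c) * f x)"
proof -
  obtain F where F: "F 0 = f" "\<And>k. continuous_on UNIV (F k)"
    "\<And>k x. ((\<lambda>r. F k (x + r *\<^sub>R b)) has_vector_derivative F (Suc k) x) (at 0)"
    "\<And>k x. cmod (F k x) \<le> C * B ^ k * sqrt (fact k) * exp (- d * (norm x)\<^sup>2)"
    using assms(1) unfolding gauss_chain_def by blast
  \<comment> \<open>For \<open>k = 0\<close> the second term vanishes through its coefficient,
    whatever \<open>F (k - 1)\<close> is.\<close>
  let ?H = "\<lambda>k x. of_real (x \<bullet> c) * F k x + of_real (real k * (b \<bullet> c)) * F (k - 1) x"
  have bc: "\<bar>b \<bullet> c\<bar> \<le> 1"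
    using Cauchy_Schwarz_ineq2[of b c] mult_mono[OF assms(5,6)] by simp
  show ?thesis
    unfolding gauss_chain_def
  proof (intro exI[of _ ?H] conjI allI)
    fix k x
    show "?H 0 = (\<lambda>x. of_real (x \<bullet> c) * f x)" by (simp add: F(1))
    show "continuous_on UNIV (?H k)"
      by (intro continuous_intros F)
    show "((\<lambda>r. ?H k (x + r *\<^sub>R b)) has_vector_derivative ?H (Suc k) x) (at 0)"
    proof -
      have 1: "((\<lambda>r. complex_of_real ((x + r *\<^sub>R b) \<bullet> c)) has_vector_derivative of_real (b \<bullet> c)) (at 0)"
      proof (rule has_vector_derivative_of_real)
        have "((\<lambda>r. x \<bullet> c + r * (b \<bullet> c)) has_real_derivative (b \<bullet> c)) (at 0)"
          by (auto intro!: derivative_eq_intros)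
        then show "((\<lambda>r. (x + r *\<^sub>R b) \<bullet> c) has_real_derivative (b \<bullet> c)) (at 0)"
          by (simp add: inner_add_left)
      qed
      have 2: "((\<lambda>r. of_real (real k * (b \<bullet> c)) * F (k - 1) (x + r *\<^sub>R b)) has_vector_derivative
          of_real (real k * (b \<bullet> c)) * F k x) (at 0)"
      proof (cases k)
        case (Suc j)
        then show ?thesis using has_vector_derivative_mult_right[OF F(3)[of j x], of "of_real (real k * (b \<bullet> c))"] by simp
      qed simp
      have "((\<lambda>r. of_real ((x + r *\<^sub>R b) \<bullet> c) * F k (x + r *\<^sub>R b)) has_vector_derivative
          of_real (x \<bullet> c) * F (Suc k) x + of_real (b \<bullet> c) * F k x) (at 0)"
        using has_vector_derivative_mult[OF 1 F(3)[of k x]] by simp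
      from has_vector_derivative_add[OF this 2] show ?thesis
        by (simp add: algebra_simps)
    qed
    show "cmod (?H k x) \<le> C * (1 / sqrt d + 1 / B) * (2 * B) ^ k * sqrt (fact k) * exp (- (d / 2) * (norm x)\<^sup>2)"
    proof -
      let ?E = "exp (- (d / 2) * (norm x)\<^sup>2)"
      let ?K = "(2 * B) ^ k * sqrt (fact k) * ?E"
      have ee: "exp (- d * (norm x)\<^sup>2) = ?E * ?E"
        by (simp flip: exp_add)
      have e1: "norm x * ?E \<le> 1 / sqrt d"
        using power_exp_le[of "d / 2" "norm x" 1] assms by simp
      have BK: "B ^ k * sqrt (fact k) * ?E \<le> ?K"
        using assms by (intro mult_right_mono power_mono) auto
      have "cmod (of_real (x \<bullet> c) * F k x) \<le> norm x * (C * B ^ k * sqrt (fact k) * exp (- d * (norm x)\<^sup>2))"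
        unfolding norm_mult norm_of_real
        using Cauchy_Schwarz_ineq2[of x c] mult_left_mono[OF assms(6), of "norm x"]
        by (intro mult_mono F) auto
      also have "\<dots> = C * (norm x * ?E) * (B ^ k * sqrt (fact k) * ?E)"
        unfolding ee by (simp only: mult_ac)
      also have "\<dots> \<le> C * (1 / sqrt d) * ?K"
        using assms by (intro mult_mono e1 BK) auto
      finally have A1: "cmod (of_real (x \<bullet> c) * F k x) \<le> C * (1 / sqrt d) * ?K" .
      have A2: "cmod (of_real (real k * (b \<bullet> c)) * F (k - 1) x) \<le> C * (1 / B) * ?K"
      proof (cases k)
        case 0
        then show ?thesis using assms by simp
      next
        case (Suc j)
        \<comment> \<open>One \<open>sqrt (real k)\<close> completes \<open>sqrt (fact j)\<close> to
          \<open>sqrt (fact k)\<close>; the other is absorbed by 2^k.\<close>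
        have "real k \<le> 2 ^ k * sqrt (real k)"
        proof -
          have "sqrt (real k) \<le> real k"
            using Suc by (intro real_le_lsqrt) (auto simp: power2_eq_square)
          also have "\<dots> \<le> 2 ^ k"
            using less_exp[of k] by (metis of_nat_less_numeral_power_cancel_iff less_imp_le)
          finally have "sqrt (real k) * sqrt (real k) \<le> 2 ^ k * sqrt (real k)"
            by (rule mult_right_mono) simp
          then show ?thesis by simp
        qed
        have "cmod (of_real (real k * (b \<bullet> c)) * F (k - 1) x)
            \<le> real k * (C * B ^ j * sqrt (fact j) * exp (- d * (norm x)\<^sup>2))"
          unfolding norm_mult norm_of_real
        proof (rule mult_mono)
          show "\<bar>real k * (b \<bullet> c)\<bar> \<le> real k" using bc by (simp add: abs_mult mult_left_le)
          show "cmod (F (k - 1) x) \<le> C * B ^ j * sqrt (fact j) * exp (- d * (norm x)\<^sup>2)"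
            using F(4)[of j x] Suc by simp
        qed auto
        also have "\<dots> \<le> (2 ^ k * sqrt (real k)) * (C * B ^ j * sqrt (fact j) * ?E)"
          using assms by (intro mult_mono \<open>real k \<le> _\<close>) auto
        also have "\<dots> = C * (1 / B) * ?K"
          using Suc assms by (simp add: power_mult_distrib real_sqrt_mult)
        finally show ?thesis .
      qed
      have "cmod (?H k x) \<le> C * (1 / sqrt d) * ?K + C * (1 / B) * ?K"
        by (rule norm_triangle_mono[OF A1 A2])
      also have "\<dots> = C * (1 / sqrt d + 1 / B) * (2 * B) ^ k * sqrt (fact k) * ?E"
        by (simp only: distrib_left distrib_right mult.assoc)
      finally show ?thesis .
    qed
  qed
qed

lemma gauss_classI:
  assumes "C > 0" "B > 0" "d > 0" "\<And>b. b \<in> Basis \<Longrightarrow> gauss_chain b C B d f"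
  shows "gauss_class f"
  using assms unfolding gauss_class_def by blast

lemma gauss_class_add:
  assumes "gauss_class f" "gauss_class h"
  shows "gauss_class (\<lambda>x. f x + h x)"
proof -
  obtain C B d where f: "C > 0" "B > 0" "d > 0" "\<And>b. b \<in> Basis \<Longrightarrow> gauss_chain b C B d f"
    using assms(1) unfolding gauss_class_def by blast
  obtain C' B' d' where h: "C' > 0" "B' > 0" "d' > 0" "\<And>b. b \<in> Basis \<Longrightarrow> gauss_chain b C' B' d' h"
    using assms(2) unfolding gauss_class_def by blast
  have "gauss_chain b (C + C') (max B B') (min d d') (\<lambda>x. f x + h x)" if "b \<in> Basis" for b
    using gauss_chain_mono[OF f(4)[OF that], of C "max B B'" "min d d'"]
      gauss_chain_mono[OF h(4)[OF that], of C' "max B B'" "min d d'"] f h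
    by (intro gauss_chain_add) auto
  then show ?thesis using f h by (intro gauss_classI[of "C + C'" "max B B'" "min d d'"]) auto
qed

lemma gauss_class_cmult:
  assumes "gauss_class f"
  shows "gauss_class (\<lambda>x. a * f x)"
proof -
  obtain C B d where f: "C > 0" "B > 0" "d > 0" "\<And>b. b \<in> Basis \<Longrightarrow> gauss_chain b C B d f"
    using assms(1) unfolding gauss_class_def by blast
  have "gauss_chain b ((cmod a + 1) * C) B d (\<lambda>x. a * f x)" if "b \<in> Basis" for b
    using gauss_chain_mono[OF gauss_chain_cmult[OF f(4)[OF that], of a], of "(cmod a + 1) * C" B d] f
    by (simp add: distrib_right)
  moreover have "(cmod a + 1) * C > 0" using f by (intro mult_pos_pos add_nonneg_pos) auto
  ultimately show ?thesis using f by (intro gauss_classI[of "(cmod a + 1) * C" B d]) auto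
qed

lemma gauss_class_coord:
  assumes "gauss_class f" "norm c \<le> 1"
  shows "gauss_class (\<lambda>x. of_real (x \<bullet> c) * f x)"
proof -
  obtain C B d where f: "C > 0" "B > 0" "d > 0" "\<And>b. b \<in> Basis \<Longrightarrow> gauss_chain b C B d f"
    using assms(1) unfolding gauss_class_def by blast
  have "gauss_chain b (C * (1 / sqrt d + 1 / B)) (2 * B) (d / 2) (\<lambda>x. of_real (x \<bullet> c) * f x)"
    if "b \<in> Basis" for b
    using f assms that by (intro gauss_chain_coord f) auto
  moreover have "C * (1 / sqrt d + 1 / B) > 0"
    using f by (intro mult_pos_pos add_pos_pos) auto
  ultimately show ?thesis using f by (intro gauss_classI[of "C * (1 / sqrt d + 1 / B)" "2 * B" "d / 2"]) auto
qed

text \<open>Horner's scheme: \<open>pCons a p\<close> adds a multiple of f to a coordinate multiple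
  of the previous function.\<close>

lemma gauss_class_poly:
  assumes "gauss_class f" "norm c \<le> 1"
  shows "gauss_class (\<lambda>x. poly p (of_real (x \<bullet> c)) * f x)"
proof (induction p)
  case 0
  then show ?case using gauss_class_cmult[OF assms(1), of 0] by simp
next
  case (pCons a p)
  show ?case
    using gauss_class_add[OF gauss_class_cmult[OF assms(1), of a] gauss_class_coord[OF pCons(2) assms(2)]]
    by (simp add: algebra_simps)
qed

section \<open>Hermite functions and their tensor products\<close>

lemma gauss_deriv_eq_poly: "\<exists>p. \<forall>t. gauss_deriv d k t = poly p t * exp (- d * t\<^sup>2)"
proof (induction k rule: less_induct)
  case (less k)
  consider "k = 0" | "k = 1" | j where "k = Suc (Suc j)"
    by (metis One_nat_def not0_implies_Suc)
  then show ?case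
  proof cases
    case 1
    then show ?thesis by (intro exI[of _ "[:1:]"]) auto
  next
    case 2
    then show ?thesis by (intro exI[of _ "[:0, - 2 * d:]"]) auto
  next
    case 3
    obtain p q where pq: "\<And>t. gauss_deriv d j t = poly p t * exp (- d * t\<^sup>2)"
        "\<And>t. gauss_deriv d (Suc j) t = poly q t * exp (- d * t\<^sup>2)"
      using less[of j] less[of "Suc j"] 3 by auto
    show ?thesis
      by (rule exI[of _ "[:0, - 2 * d:] * q - smult (2 * d * real (Suc j)) p"])
         (auto simp: 3 pq algebra_simps)
  qed
qed

text \<open>The definition is Rodrigues' formula, so the k-th derivative is
  \<open>gauss_deriv\<close> with d = 2 \<pi>; the prefactor exp(\<pi> t^2) cancels half of its
  exponent.\<close>

lemma hermite_fun_eq_poly: "\<exists>p. \<forall>t. hermite_fun k t = poly p t * exp (- pi * t\<^sup>2)"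
proof -
  have "(deriv ^^ k) (\<lambda>r. exp (- 2 * pi * r\<^sup>2)) = gauss_deriv (2 * pi) k"
  proof (induction k)
    case (Suc k)
    have "(deriv ^^ Suc k) (\<lambda>r. exp (- 2 * pi * r\<^sup>2)) = deriv (gauss_deriv (2 * pi) k)"
      using Suc by simp
    also have "\<dots> = gauss_deriv (2 * pi) (Suc k)"
      by (rule ext, rule DERIV_imp_deriv, rule has_derivative_gauss_deriv)
    finally show ?case .
  qed (auto simp: fun_eq_iff)
  moreover obtain p where p: "\<And>t. gauss_deriv (2 * pi) k t = poly p t * exp (- (2 * pi) * t\<^sup>2)"
    using gauss_deriv_eq_poly by blast
  moreover have "exp (pi * t\<^sup>2) * exp (- (2 * pi) * t\<^sup>2) = exp (- pi * t\<^sup>2)" for t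
    unfolding exp_add[symmetric] by simp
  ultimately show ?thesis
    by (intro exI[of _ "smult (2 powr (1/4) / sqrt (fact k) * (- 1 / (2 * sqrt pi)) ^ k) p"])
       (simp add: hermite_fun_def)
qed

lemma poly_map_poly_of_real:
  "poly (map_poly complex_of_real q) (of_real t) = of_real (poly q t)"
  by (induction q) (auto simp: map_poly_pCons)

lemma hermite_combination_eq_poly:
  assumes "hermite_combination f"
  shows "\<exists>p. \<forall>t. f t = poly p (of_real t) * of_real (exp (- pi * t\<^sup>2))"
proof -
  obtain n c where f: "f = (\<lambda>t. \<Sum>k=0..n. c k * complex_of_real (hermite_fun k t))"
    using assms unfolding hermite_combination_def by blast
  obtain q where q: "\<And>k t. hermite_fun k t = poly (q k) t * exp (- pi * t\<^sup>2)"
    using hermite_fun_eq_poly by metis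
  show ?thesis
    by (intro exI[of _ "\<Sum>k=0..n. smult (c k) (map_poly of_real (q k))"] allI)
       (simp add: f q poly_sum sum_distrib_right mult.assoc poly_map_poly_of_real)
qed

text \<open>The Gaussian factors multiply to exp(-\<pi> |x|^2), which lies in the class. The
  polynomial factors are attached one coordinate at a time, by induction over the set of coordinates
  already treated.\<close>

lemma gauss_class_hermite_tensor:
  fixes g' :: "'d::finite \<Rightarrow> real \<Rightarrow> complex"
  assumes "\<And>i. hermite_combination (g' i)"
  shows "gauss_class (tensor_fun g')"
proof -
  obtain p where p: "\<And>i t. g' i t = poly (p i) (of_real t) * of_real (exp (- pi * t\<^sup>2))"
    using hermite_combination_eq_poly[OF assms] by metis
  let ?G = "\<lambda>x::real^'d. complex_of_real (exp (- pi * (norm x)\<^sup>2))"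
  have "gauss_class (\<lambda>x::real^'d. (\<Prod>i\<in>I. poly (p i) (of_real (x $ i))) * ?G x)" if "finite I" for I
    using that
  proof (induction I)
    case empty
    show ?case using gelfand_shilov_gauss_class[OF gaussian_in_gelfand_shilov[OF pi_gt_zero], where 'a="real^'d"]
      by simp
  next
    case (insert i I)
    show ?case
      using gauss_class_poly[OF insert(3), of "axis i 1" "p i"] insert(1,2)
      by (simp add: inner_axis mult.assoc)
  qed
  from this[of UNIV] have "gauss_class (\<lambda>x::real^'d. (\<Prod>i\<in>UNIV. poly (p i) (of_real (x $ i))) * ?G x)"
    by simp
  moreover have "tensor_fun g' = (\<lambda>x. (\<Prod>i\<in>UNIV. poly (p i) (of_real (x $ i))) * ?G x)"
  proof
    fix x :: "real^'d"
    have "(norm x)\<^sup>2 = (\<Sum>i\<in>UNIV. (x $ i)\<^sup>2)"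
      unfolding power2_norm_eq_inner inner_vec_def by (simp add: power2_eq_square)
    then have "exp (- pi * (norm x)\<^sup>2) = (\<Prod>i\<in>UNIV. exp (- pi * (x $ i)\<^sup>2))"
      by (simp only: sum_distrib_left exp_sum finite)
    then show "tensor_fun g' x = (\<Prod>i\<in>UNIV. poly (p i) (of_real (x $ i))) * ?G x"
      by (simp add: tensor_fun_def p prod.distrib)
  qed
  ultimately show ?thesis by simp
qed

text \<open>Pascal's rule in the form of the inductive step of Leibniz' formula: the right side is
  what the product rule makes of the sum of order n.\<close>

lemma sum_binomial_Suc:
  fixes a b :: "nat \<Rightarrow> 'a::comm_ring_1"
  shows "(\<Sum>j\<le>Suc n. of_nat (Suc n choose j) * (a j * b (Suc n - j)))
       = (\<Sum>j\<le>n. of_nat (n choose j) * (a (Suc j) * b (n - j) + a j * b (Suc (n - j))))"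
proof -
  have "(\<Sum>j\<le>n. of_nat (n choose j) * (a j * b (Suc (n - j)))) = (\<Sum>j\<le>Suc n. of_nat (n choose j) * (a j * b (Suc n - j)))"
    by (auto intro!: sum.cong simp: Suc_diff_le binomial_eq_0)
  also have "\<dots> = a 0 * b (Suc n) + (\<Sum>j\<le>n. of_nat (n choose Suc j) * (a (Suc j) * b (n - j)))"
    by (subst sum.atMost_Suc_shift) (simp add: binomial_eq_0)
  finally show ?thesis
    by (subst sum.atMost_Suc_shift) (simp add: sum.distrib algebra_simps)
qed

text \<open>The point is that the constant of the chain decays in the translation x. From |x|^2
  \<le> 2 |t|^2 + 2 |t - x|^2, the two Gaussians leave rate d/4 for x and d/2 for t. In Leibniz'
  formula j! (n - j)! \<le> n! keeps a single \<open>sqrt (fact n)\<close>, and the binomial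
  coefficients sum to 2^n, hence \<open>2 * B\<close>.\<close>

lemma gauss_chain_mult_translate:
  assumes "gauss_chain b C B d P" "gauss_chain b C' B d Q" "C \<ge> 0" "C' \<ge> 0" "B > 0" "d > 0"
  shows "gauss_chain b (C * C' * exp (- (d / 4) * (norm x)\<^sup>2)) (2 * B) (d / 2) (\<lambda>t. P t * cnj (Q (t - x)))"
proof -
  obtain F where F: "F 0 = P" "\<And>k. continuous_on UNIV (F k)"
    "\<And>k x. ((\<lambda>r. F k (x + r *\<^sub>R b)) has_vector_derivative F (Suc k) x) (at 0)"
    "\<And>k x. cmod (F k x) \<le> C * B ^ k * sqrt (fact k) * exp (- d * (norm x)\<^sup>2)"
    using assms(1) unfolding gauss_chain_def by blast
  obtain H where H: "H 0 = Q" "\<And>k. continuous_on UNIV (H k)"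
    "\<And>k x. ((\<lambda>r. H k (x + r *\<^sub>R b)) has_vector_derivative H (Suc k) x) (at 0)"
    "\<And>k x. cmod (H k x) \<le> C' * B ^ k * sqrt (fact k) * exp (- d * (norm x)\<^sup>2)"
    using assms(2) unfolding gauss_chain_def by blast
  let ?G = "\<lambda>n t. \<Sum>j\<le>n. of_nat (n choose j) * (F j t * cnj (H (n - j) (t - x)))"
  show ?thesis
    unfolding gauss_chain_def
  proof (intro exI[of _ ?G] conjI allI)
    fix n t
    show "?G 0 = (\<lambda>t. P t * cnj (Q (t - x)))" by (simp add: F H)
    have "continuous_on UNIV (\<lambda>t. H k (t - x))" for k
      by (rule continuous_on_compose2[OF H(2)]) (auto intro!: continuous_intros)
    then show "continuous_on UNIV (?G n)"
      by (intro continuous_intros F)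
    have "((\<lambda>r. cnj (H k (t - x + r *\<^sub>R b))) has_vector_derivative cnj (H (Suc k) (t - x))) (at 0)" for k
      using has_vector_derivative_cnj[OF H(3)[of k "t - x"]] .
    then have H': "((\<lambda>r. cnj (H k (t + r *\<^sub>R b - x))) has_vector_derivative cnj (H (Suc k) (t - x))) (at 0)" for k
      by (simp add: algebra_simps)
    have "((\<lambda>r. ?G n (t + r *\<^sub>R b)) has_vector_derivative
      (\<Sum>j\<le>n. of_nat (n choose j) * (F j (t + 0 *\<^sub>R b) * cnj (H (Suc (n - j)) (t - x)) +
          F (Suc j) t * cnj (H (n - j) (t + 0 *\<^sub>R b - x))))) (at 0)"
      by (intro has_vector_derivative_sum has_vector_derivative_mult_right has_vector_derivative_mult F H')
    also have "(\<Sum>j\<le>n. of_nat (n choose j) * (F j (t + 0 *\<^sub>R b) * cnj (H (Suc (n - j)) (t - x)) +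
          F (Suc j) t * cnj (H (n - j) (t + 0 *\<^sub>R b - x)))) = ?G (Suc n) t"
      unfolding sum_binomial_Suc[of n "\<lambda>j. F j t" "\<lambda>j. cnj (H j (t - x))"] by (simp add: add.commute)
    finally show "((\<lambda>r. ?G n (t + r *\<^sub>R b)) has_vector_derivative ?G (Suc n) t) (at 0)" .
    let ?E = "exp (- (d / 4) * (norm x)\<^sup>2) * exp (- (d / 2) * (norm t)\<^sup>2)"
    have E: "exp (- d * (norm t)\<^sup>2) * exp (- d * (norm (t - x))\<^sup>2) \<le> ?E"
    proof -
      have "(norm x)\<^sup>2 \<le> 2 * (norm t)\<^sup>2 + 2 * (norm (t - x))\<^sup>2"
        using norm_add_sq_le[of t "x - t"] by (simp add: norm_minus_commute)
      then have "d / 4 * (norm x)\<^sup>2 \<le> d / 4 * (2 * (norm t)\<^sup>2 + 2 * (norm (t - x))\<^sup>2)"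
        using assms by (intro mult_left_mono) auto
      moreover have "d / 2 * (norm (t - x))\<^sup>2 \<le> d * (norm (t - x))\<^sup>2"
        using assms by (intro mult_right_mono) auto
      ultimately show ?thesis unfolding exp_add[symmetric] by (simp add: algebra_simps)
    qed
    have "cmod (of_nat (n choose j) * (F j t * cnj (H (n - j) (t - x))))
       \<le> of_nat (n choose j) * (C * C' * B ^ n * sqrt (fact n) * ?E)" if "j \<le> n" for j
    proof -
      have "fact j * fact (n - j) * (n choose j) = (fact n :: nat)"
        using binomial_fact_lemma[OF that] .
      moreover have "n choose j \<ge> 1" using that by (simp add: Suc_leI)
      ultimately have "fact j * fact (n - j) \<le> (fact n :: nat)"
        by (metis mult.right_neutral mult_le_mono2)
      then have "real (fact j * fact (n - j)) \<le> real (fact n)" by (rule of_nat_mono)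
      then have "sqrt (fact j * fact (n - j)) \<le> sqrt (fact n)" by simp
      then have sq: "sqrt (fact j) * sqrt (fact (n - j)) \<le> sqrt (fact n)" by (simp add: real_sqrt_mult)
      have "cmod (F j t * cnj (H (n - j) (t - x)))
         \<le> (C * B ^ j * sqrt (fact j) * exp (- d * (norm t)\<^sup>2)) * (C' * B ^ (n - j) * sqrt (fact (n - j)) * exp (- d * (norm (t - x))\<^sup>2))"
        unfolding norm_mult complex_mod_cnj using assms by (intro mult_mono F H) auto
      also have "\<dots> = C * C' * (B ^ j * B ^ (n - j)) * (sqrt (fact j) * sqrt (fact (n - j))) *
          (exp (- d * (norm t)\<^sup>2) * exp (- d * (norm (t - x))\<^sup>2))"
        by (simp only: mult_ac)
      also have "B ^ j * B ^ (n - j) = B ^ n" using that by (simp flip: power_add)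
      also have "C * C' * B ^ n * (sqrt (fact j) * sqrt (fact (n - j))) *
          (exp (- d * (norm t)\<^sup>2) * exp (- d * (norm (t - x))\<^sup>2)) \<le> C * C' * B ^ n * sqrt (fact n) * ?E"
        using assms by (intro mult_mono sq E) auto
      finally show ?thesis
        by (simp only: norm_mult norm_of_nat) (rule mult_left_mono, auto)
    qed
    then have "cmod (?G n t) \<le> (\<Sum>j\<le>n. of_nat (n choose j) * (C * C' * B ^ n * sqrt (fact n) * ?E))"
      by (intro sum_norm_le) auto
    also have "\<dots> = (\<Sum>j\<le>n. real (n choose j)) * (C * C' * B ^ n * sqrt (fact n) * ?E)"
      by (simp only: sum_distrib_right)
    also have "(\<Sum>j\<le>n. real (n choose j)) = 2 ^ n"
      using choose_row_sum[of n] by (metis of_nat_numeral of_nat_power of_nat_sum)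
    finally show "cmod (?G n t) \<le> C * C' * exp (- (d / 4) * (norm x)\<^sup>2) * (2 * B) ^ n * sqrt (fact n) * exp (- (d / 2) * (norm t)\<^sup>2)"
      by (simp only: power_mult_distrib mult_ac)
  qed
qed


section \<open>Decay of short-time Fourier transforms\<close>

text \<open>Makes a Gaussian locally uniform: half of the rate pays for moving the centre by at most
  1. It serves below both as a majorant for difference quotients and in comparing a lattice sum with
  an integral.\<close>

lemma gaussian_shift_le:
  fixes t y :: "'a::real_inner"
  assumes "norm y \<le> 1" "d > 0"
  shows "exp (- d * (norm (t + y))\<^sup>2) \<le> exp d * exp (- (d / 2) * (norm t)\<^sup>2)"
proof -
  have "(norm t)\<^sup>2 \<le> 2 * (norm (t + y))\<^sup>2 + 2 * (norm y)\<^sup>2"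
    using norm_add_sq_le[of "t + y" "- y"] by simp
  also have "\<dots> \<le> 2 * (norm (t + y))\<^sup>2 + 2"
    using power_le_one[OF norm_ge_zero assms(1), of 2] by simp
  finally have "d / 2 * (norm t)\<^sup>2 \<le> d / 2 * (2 * (norm (t + y))\<^sup>2 + 2)"
    using assms by (intro mult_left_mono) auto
  then show ?thesis unfolding exp_add[symmetric] by (simp add: algebra_simps)
qed

text \<open>Integration by parts without Fubini: the difference quotients of \<open>G\<close> integrate to zero by
  translation invariance and converge dominatedly.\<close>

lemma integral_directional_deriv_zero:
  fixes G G' :: "'a::euclidean_space \<Rightarrow> complex"
  assumes cont: "continuous_on UNIV G" "continuous_on UNIV G'"
    and deriv: "\<And>x. ((\<lambda>r. G (x + r *\<^sub>R b)) has_vector_derivative G' x) (at 0)"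
    and G: "\<And>x. cmod (G x) \<le> M * exp (- d * (norm x)\<^sup>2)"
    and G': "\<And>x. cmod (G' x) \<le> M * exp (- d * (norm x)\<^sup>2)"
    and "d > 0" "norm b \<le> 1" "M \<ge> 0"
  shows "(LINT x|lborel. G' x) = 0"
proof -
  have [measurable]: "G \<in> borel_measurable borel" "G' \<in> borel_measurable borel"
    using cont by (auto intro: borel_measurable_continuous_onI)
  have intG: "integrable lborel G"
    by (rule Bochner_Integration.integrable_bound[OF integrable_mult_right[OF integrable_gaussian[OF \<open>d > 0\<close>], of M]])
       (use G \<open>M \<ge> 0\<close> in auto)
  \<comment> \<open>Increments of size at most 1 keep all shifted points within the range of
    \<open>gaussian_shift_le\<close>.\<close>
  define h where "h n = 1 / real (Suc n)" for n
  have h: "h n > 0" "h n \<le> 1" for n by (auto simp: h_def)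
  define D where "D n x = (1 / h n) *\<^sub>R (G (x + h n *\<^sub>R b) - G x)" for n x
  have [measurable]: "D n \<in> borel_measurable borel" for n
    unfolding D_def by measurable
  have "(LINT x|lborel. D n x) = 0" for n
  proof -
    have "integrable lborel (\<lambda>x. G (x + h n *\<^sub>R b))"
      using intG by (subst lborel_integral_translate) auto
    then show ?thesis
      unfolding D_def using intG lborel_integral_translate(1)[of G "h n *\<^sub>R b"] by simp
  qed
  moreover have "(\<lambda>n. LINT x|lborel. D n x) \<longlonglongrightarrow> (LINT x|lborel. G' x)"
  proof (rule integral_dominated_convergence[where w = "\<lambda>x. M * exp d * exp (- (d / 2) * (norm x)\<^sup>2)"])
    show "integrable lborel (\<lambda>x::'a. M * exp d * exp (- (d / 2) * (norm x)\<^sup>2))"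
      by (intro integrable_mult_right integrable_gaussian) (use \<open>d > 0\<close> in auto)
    show "AE x in lborel. (\<lambda>n. D n x) \<longlonglongrightarrow> G' x"
    proof (rule AE_I2)
      fix x :: 'a
      have "((\<lambda>r. (G (x + r *\<^sub>R b) - G x - r *\<^sub>R G' x) /\<^sub>R \<bar>r\<bar>) \<longlongrightarrow> 0) (at 0)"
        using deriv[of x] by (simp add: has_vector_derivative_def has_derivative_def)
      moreover have "filterlim h (at 0) sequentially"
      proof -
        have "h \<longlonglongrightarrow> 0"
          unfolding h_def[abs_def] using LIMSEQ_inverse_real_of_nat by (simp add: inverse_eq_divide)
        then show ?thesis
          unfolding filterlim_at using h by (auto intro!: always_eventually simp: less_imp_neq[THEN not_sym])
      qed
      ultimately have "(\<lambda>n. (G (x + h n *\<^sub>R b) - G x - h n *\<^sub>R G' x) /\<^sub>R \<bar>h n\<bar>) \<longlonglongrightarrow> 0"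
        by (rule filterlim_compose)
      moreover have "(G (x + h n *\<^sub>R b) - G x - h n *\<^sub>R G' x) /\<^sub>R \<bar>h n\<bar> = D n x - G' x" for n
        using h[of n] by (simp add: D_def scaleR_diff_right divide_inverse)
      ultimately show "(\<lambda>n. D n x) \<longlonglongrightarrow> G' x"
        by (simp add: LIM_zero_iff)
    qed
    fix n
    show "AE x in lborel. norm (D n x) \<le> M * exp d * exp (- (d / 2) * (norm x)\<^sup>2)"
    proof (rule AE_I2)
      fix x :: 'a
      let ?K = "M * exp d * exp (- (d / 2) * (norm x)\<^sup>2)"
      have der: "((\<lambda>s. G (x + s *\<^sub>R b)) has_vector_derivative G' (x + r *\<^sub>R b)) (at r)" for r
      proof -
        have "((\<lambda>s. G ((x + r *\<^sub>R b) + s *\<^sub>R b)) \<circ> (\<lambda>s. s - r) has_vector_derivative 1 *\<^sub>R G' (x + r *\<^sub>R b)) (at r)"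
          by (rule vector_diff_chain_at)
             (use deriv[of "x + r *\<^sub>R b"] in \<open>auto intro!: derivative_eq_intros\<close>)
        then show ?thesis by (simp add: o_def algebra_simps)
      qed
      \<comment> \<open>Mean value inequality along the segment: the difference quotient is bounded
        by the supremum of the derivative over shifts of length at most 1, hence by a Gaussian free
        of n.\<close>
      have "norm (G (x + h n *\<^sub>R b) - G (x + 0 *\<^sub>R b)) \<le> ?K * norm (h n - 0)"
      proof (rule differentiable_bound[of "{0..1::real}"])
        fix r :: real assume r: "r \<in> {0..1}"
        show "((\<lambda>s. G (x + s *\<^sub>R b)) has_derivative (\<lambda>s. s *\<^sub>R G' (x + r *\<^sub>R b))) (at r within {0..1})"
          using der[of r] by (simp add: has_vector_derivative_def has_derivative_at_withinI)
        have "norm (G' (x + r *\<^sub>R b)) \<le> M * exp (- d * (norm (x + r *\<^sub>R b))\<^sup>2)" by (rule G')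
        also have "\<dots> \<le> M * (exp d * exp (- (d / 2) * (norm x)\<^sup>2))"
          using r assms mult_mono[of "\<bar>r\<bar>" 1 "norm b" 1] by (intro mult_left_mono gaussian_shift_le) auto
        finally have "norm (G' (x + r *\<^sub>R b)) \<le> ?K" by (simp add: mult.assoc)
        then show "onorm (\<lambda>s. s *\<^sub>R G' (x + r *\<^sub>R b)) \<le> ?K"
          by (intro onorm_le) (simp only: norm_scaleR real_norm_def mult.commute[of ?K] mult_left_mono abs_ge_zero)
      qed (use h[of n] in auto)
      then show "norm (D n x) \<le> ?K"
        using h[of n] by (simp add: D_def divide_simps mult_ac)
    qed
  qed auto
  ultimately have "(\<lambda>n. 0) \<longlonglongrightarrow> (LINT x|lborel. G' x)" by simp
  then show ?thesis by (simp add: LIMSEQ_const_iff)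
qed

text \<open>With y = 2 \<pi> (\<xi> . b), each integration by parts multiplies the integral by i y.
  So |y|^k times the integral of f is the modulus of the integral of the k-th derivative, whose
  growth C B^k \<open>sqrt (fact k)\<close> is the hypothesis of
  \<open>gaussian_decay_of_power_bounds\<close>.\<close>

lemma gauss_chain_fourier_bound:
  fixes f :: "'a::euclidean_space \<Rightarrow> complex"
  assumes "gauss_chain b C B d f" "norm b \<le> 1" "C \<ge> 0" "B > 0" "d > 0"
  shows "cmod (LINT t|lborel. f t * cis (- (2 * pi * (\<xi> \<bullet> t))))
     \<le> 2 * C * (LINT t|lborel. exp (- d * (norm (t::'a))\<^sup>2)) * exp (- (1 / (4 * B\<^sup>2)) * (2 * pi * (\<xi> \<bullet> b))\<^sup>2)"
proof -
  obtain F where F: "F 0 = f" "\<And>k. continuous_on UNIV (F k)"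
    "\<And>k x. ((\<lambda>r. F k (x + r *\<^sub>R b)) has_vector_derivative F (Suc k) x) (at 0)"
    "\<And>k x. cmod (F k x) \<le> C * B ^ k * sqrt (fact k) * exp (- d * (norm x)\<^sup>2)"
    using assms(1) unfolding gauss_chain_def by blast
  have [measurable]: "F k \<in> borel_measurable borel" for k
    using F(2) by (auto intro: borel_measurable_continuous_onI)
  let ?y = "2 * pi * (\<xi> \<bullet> b)"
  let ?e = "\<lambda>t. cis (- (2 * pi * (\<xi> \<bullet> t)))"
  define I where "I k = (LINT t|lborel. F k t * ?e t)" for k
  have e_cont: "continuous_on UNIV ?e"
    by (intro continuous_intros)
  then have [measurable]: "?e \<in> borel_measurable borel"
    by (rule borel_measurable_continuous_onI)
  have int: "integrable lborel (\<lambda>t. F k t * ?e t)" for k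
    by (rule Bochner_Integration.integrable_bound[OF integrable_mult_right[OF integrable_gaussian[OF \<open>d > 0\<close>], of "C * B ^ k * sqrt (fact k)"]])
       (use F(4)[of k] assms in \<open>auto simp: norm_mult abs_mult\<close>)
  have step: "I (Suc k) = \<i> * of_real ?y * I k" for k
  proof -
    let ?G' = "\<lambda>t. F (Suc k) t * ?e t - \<i> * of_real ?y * (F k t * ?e t)"
    \<comment> \<open>A common bound for the product \<open>F k\<close> times the exponential and
      for its derivative; the last two summands come from the two terms of the product rule.\<close>
    let ?M = "C * B ^ k * sqrt (fact k) + C * B ^ Suc k * sqrt (fact (Suc k)) + \<bar>?y\<bar> * (C * B ^ k * sqrt (fact k))"
    have "(LINT t|lborel. ?G' t) = 0"
    proof (rule integral_directional_deriv_zero[where G = "\<lambda>t. F k t * ?e t" and b = b and d = d and M = ?M])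
      fix x
      have "((\<lambda>r. cis (- (2 * pi * (\<xi> \<bullet> (x + r *\<^sub>R b))))) has_vector_derivative - (\<i> * of_real ?y) * ?e x) (at 0)"
      proof -
        have "((\<lambda>r. - (2 * pi * (\<xi> \<bullet> x)) - ?y * r) has_real_derivative - ?y) (at 0)"
          by (auto intro!: derivative_eq_intros)
        then have "((\<lambda>r. \<i> * complex_of_real (- (2 * pi * (\<xi> \<bullet> x)) - ?y * r)) has_vector_derivative \<i> * of_real (- ?y)) (at 0)"
          by (intro has_vector_derivative_mult_right has_vector_derivative_of_real)
        from field_vector_diff_chain_at[OF this DERIV_exp]
        have "((\<lambda>r. cis (- (2 * pi * (\<xi> \<bullet> x)) - ?y * r)) has_vector_derivative \<i> * of_real (- ?y) * cis (- (2 * pi * (\<xi> \<bullet> x)) - ?y * 0)) (at 0)"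
          by (simp only: o_def cis_conv_exp)
        moreover have eq: "- (2 * pi * (\<xi> \<bullet> x)) - ?y * r = - (2 * pi * (\<xi> \<bullet> (x + r *\<^sub>R b)))" for r
          by (simp add: inner_add_right algebra_simps)
        ultimately show ?thesis
          unfolding eq by (simp only: scaleR_zero_left add_0_right of_real_minus mult_minus_right)
      qed
      from has_vector_derivative_mult[OF F(3)[of k x] this]
      show "((\<lambda>r. F k (x + r *\<^sub>R b) * ?e (x + r *\<^sub>R b)) has_vector_derivative ?G' x) (at 0)"
        by (simp add: algebra_simps)
      let ?E = "exp (- d * (norm x)\<^sup>2)"
      have p: "0 \<le> C * B ^ k * sqrt (fact k) * ?E" "0 \<le> C * B ^ Suc k * sqrt (fact (Suc k)) * ?E"
        using assms by auto
      have q: "cmod (\<i> * of_real ?y * (F k x * ?e x)) \<le> \<bar>?y\<bar> * (C * B ^ k * sqrt (fact k) * ?E)"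
        unfolding norm_mult norm_ii norm_of_real norm_cis mult_1 mult_1_right
        by (intro mult_left_mono F) auto
      have "cmod (F k x * ?e x) \<le> C * B ^ k * sqrt (fact k) * ?E"
        using F(4)[of k x] by (simp add: norm_mult)
      also have "\<dots> \<le> C * B ^ k * sqrt (fact k) * ?E + C * B ^ Suc k * sqrt (fact (Suc k)) * ?E
          + \<bar>?y\<bar> * (C * B ^ k * sqrt (fact k) * ?E)"
        using p(2) mult_nonneg_nonneg[OF abs_ge_zero[of ?y] p(1)] by linarith
      finally show "cmod (F k x * ?e x) \<le> ?M * ?E" by (simp only: distrib_right mult.assoc)
      have "cmod (F (Suc k) x * ?e x) \<le> C * B ^ Suc k * sqrt (fact (Suc k)) * ?E"
        using F(4)[of "Suc k" x] by (simp add: norm_mult)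
      then have "cmod (?G' x) \<le> C * B ^ Suc k * sqrt (fact (Suc k)) * ?E + \<bar>?y\<bar> * (C * B ^ k * sqrt (fact k) * ?E)"
        using q by (intro order_trans[OF norm_triangle_ineq4] add_mono)
      also have "\<dots> \<le> C * B ^ k * sqrt (fact k) * ?E + C * B ^ Suc k * sqrt (fact (Suc k)) * ?E
          + \<bar>?y\<bar> * (C * B ^ k * sqrt (fact k) * ?E)"
        using p(1) by linarith
      finally show "cmod (?G' x) \<le> ?M * ?E" by (simp only: distrib_right mult.assoc)
    next
      show "0 \<le> ?M" using assms by auto
      show "continuous_on UNIV (\<lambda>t. F k t * ?e t)" "continuous_on UNIV ?G'"
        by (intro continuous_on_mult continuous_on_diff continuous_on_const F e_cont)+
    qed (rule assms)+
    then show ?thesis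
      using int unfolding I_def by (simp add: Bochner_Integration.integral_diff)
  qed
  have norm_I: "cmod (I k) = \<bar>?y\<bar> ^ k * cmod (I 0)" for k
    by (induction k) (auto simp: step norm_mult abs_mult)
  let ?L = "LINT t|lborel. exp (- d * (norm (t::'a))\<^sup>2)"
  have "\<bar>?y\<bar> ^ k * cmod (I 0) \<le> (C * ?L) * B ^ k * sqrt (fact k)" for k
  proof -
    have "cmod (I k) \<le> (LINT t|lborel. C * B ^ k * sqrt (fact k) * exp (- d * (norm (t::'a))\<^sup>2))"
      unfolding I_def
    proof (rule Bochner_Integration.integral_norm_bound_integral)
      show "integrable lborel (\<lambda>t::'a. C * B ^ k * sqrt (fact k) * exp (- d * (norm t)\<^sup>2))"
        by (intro integrable_mult_right integrable_gaussian assms)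
    qed (use int F(4)[of k] in \<open>auto simp: norm_mult\<close>)
    also have "\<dots> = C * B ^ k * sqrt (fact k) * ?L"
      by (rule integral_mult_right_zero)
    finally show ?thesis unfolding norm_I[of k] by (simp only: mult_ac)
  qed
  then have "cmod (I 0) \<le> 2 * (C * ?L) * exp (- (1 / (4 * B\<^sup>2)) * ?y\<^sup>2)"
    using assms by (intro gaussian_decay_of_power_bounds) (auto intro!: mult_nonneg_nonneg)
  then show ?thesis by (simp add: I_def F(1) mult.assoc)
qed

text \<open>Decay in x comes from the constant of the product chain, decay in \<xi> from its Fourier
  transform along a coordinate b that dominates \<xi>.\<close>

lemma gauss_class_stft_decay:
  fixes P Q :: "'a::euclidean_space \<Rightarrow> complex"
  assumes "gauss_class P" "gauss_class Q"
  obtains K e where "K > 0" "e > 0"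
    "\<And>x \<xi>. cmod (LINT t|lborel. P t * cnj (Q (t - x)) * cis (- (2 * pi * (\<xi> \<bullet> t))))
        \<le> K * exp (- e * ((norm x)\<^sup>2 + (norm \<xi>)\<^sup>2))"
proof -
  obtain C1 B1 d1 where P: "C1 > 0" "B1 > 0" "d1 > 0" "\<And>b. b \<in> Basis \<Longrightarrow> gauss_chain b C1 B1 d1 P"
    using assms(1) unfolding gauss_class_def by blast
  obtain C2 B2 d2 where Q: "C2 > 0" "B2 > 0" "d2 > 0" "\<And>b. b \<in> Basis \<Longrightarrow> gauss_chain b C2 B2 d2 Q"
    using assms(2) unfolding gauss_class_def by blast
  define B d where "B = max B1 B2" and "d = min d1 d2"
  have Bd: "B > 0" "d > 0" using P Q by (auto simp: B_def d_def)
  let ?L = "LINT t|lborel. exp (- (d / 2) * (norm (t::'a))\<^sup>2)"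
  \<comment> \<open>\<open>2 * B\<close> is the derivative constant of the product, 2 \<pi> stems
    from the exponential, and the dimension from using a single coordinate of \<xi>.\<close>
  define a where "a = (1 / (4 * (2 * B)\<^sup>2)) * (2 * pi)\<^sup>2 / DIM('a)"
  have a: "a > 0" using Bd by (simp add: a_def)
  define e where "e = min (d / 4) a"
  show thesis
  \<comment> \<open>The summand 1 makes the constant positive without a lower bound on the integral
    \<open>?L\<close>.\<close>
  proof (rule that[of "2 * C1 * C2 * ?L + 1" e])
    show "0 < 2 * C1 * C2 * ?L + 1" using P Q by (intro add_nonneg_pos) auto
    show "0 < e" using a Bd by (simp add: e_def)
    fix x \<xi> :: 'a
    obtain b where b: "b \<in> Basis" "(norm \<xi>)\<^sup>2 \<le> real DIM('a) * (\<xi> \<bullet> b)\<^sup>2"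
      using ex_Basis_norm_le by blast
    have "gauss_chain b (C1 * C2 * exp (- (d / 4) * (norm x)\<^sup>2)) (2 * B) (d / 2) (\<lambda>t. P t * cnj (Q (t - x)))"
      using P Q Bd b(1)
      by (intro gauss_chain_mult_translate gauss_chain_mono[OF P(4)] gauss_chain_mono[OF Q(4)]) (auto simp: B_def d_def)
    then have "cmod (LINT t|lborel. P t * cnj (Q (t - x)) * cis (- (2 * pi * (\<xi> \<bullet> t))))
        \<le> 2 * (C1 * C2 * exp (- (d / 4) * (norm x)\<^sup>2)) * ?L * exp (- (1 / (4 * (2 * B)\<^sup>2)) * (2 * pi * (\<xi> \<bullet> b))\<^sup>2)"
      using P Q Bd b(1) by (intro gauss_chain_fourier_bound) auto
    also have "\<dots> = (2 * C1 * C2 * ?L) * (exp (- (d / 4) * (norm x)\<^sup>2) * exp (- (1 / (4 * (2 * B)\<^sup>2)) * (2 * pi * (\<xi> \<bullet> b))\<^sup>2))"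
      by (simp only: mult_ac)
    also have "\<dots> \<le> (2 * C1 * C2 * ?L + 1) * exp (- e * ((norm x)\<^sup>2 + (norm \<xi>)\<^sup>2))"
    proof (rule mult_mono)
      have "a * (norm \<xi>)\<^sup>2 \<le> a * (real DIM('a) * (\<xi> \<bullet> b)\<^sup>2)"
        using a b(2) by (intro mult_left_mono) auto
      also have "\<dots> = (1 / (4 * (2 * B)\<^sup>2)) * (2 * pi * (\<xi> \<bullet> b))\<^sup>2"
        unfolding a_def power_mult_distrib by simp
      finally have "e * (norm \<xi>)\<^sup>2 \<le> (1 / (4 * (2 * B)\<^sup>2)) * (2 * pi * (\<xi> \<bullet> b))\<^sup>2"
        using mult_right_mono[of e a "(norm \<xi>)\<^sup>2"] by (simp add: e_def)
      moreover have "e * (norm x)\<^sup>2 \<le> d / 4 * (norm x)\<^sup>2"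
        by (intro mult_right_mono) (auto simp: e_def)
      ultimately show "exp (- (d / 4) * (norm x)\<^sup>2) * exp (- (1 / (4 * (2 * B)\<^sup>2)) * (2 * pi * (\<xi> \<bullet> b))\<^sup>2)
        \<le> exp (- e * ((norm x)\<^sup>2 + (norm \<xi>)\<^sup>2))"
        unfolding exp_add[symmetric] exp_le_cancel_iff distrib_left by linarith
    qed (use P Q in \<open>auto intro!: add_nonneg_nonneg mult_nonneg_nonneg\<close>)
    finally show "cmod (LINT t|lborel. P t * cnj (Q (t - x)) * cis (- (2 * pi * (\<xi> \<bullet> t))))
        \<le> (2 * C1 * C2 * ?L + 1) * exp (- e * ((norm x)\<^sup>2 + (norm \<xi>)\<^sup>2))" .
  qed
qed


section \<open>Continuity, reflection and square integrability\<close>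

lemma gauss_class_continuous:
  assumes "gauss_class (f :: 'a::euclidean_space \<Rightarrow> complex)"
  shows "continuous_on UNIV f"
proof -
  obtain b :: 'a where "b \<in> Basis" using nonempty_Basis by blast
  then show ?thesis using assms unfolding gauss_class_def gauss_chain_def by blast
qed

text \<open>Supplies the reflected window that appears when a cross-Wigner distribution is written
  as a short-time Fourier transform.\<close>

lemma gauss_class_reflect:
  fixes f :: "'a::euclidean_space \<Rightarrow> complex"
  assumes "gauss_class f"
  shows "gauss_class (\<lambda>x. f (- x))"
proof -
  obtain C B d where f: "C > 0" "B > 0" "d > 0" "\<And>b. b \<in> Basis \<Longrightarrow> gauss_chain b C B d f"
    using assms unfolding gauss_class_def by blast
  have "gauss_chain b C B d (\<lambda>x. f (- x))" if b: "b \<in> Basis" for b :: 'a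
  proof -
    obtain F where F: "F 0 = f" "\<And>k. continuous_on UNIV (F k)"
      "\<And>k x. ((\<lambda>r. F k (x + r *\<^sub>R b)) has_vector_derivative F (Suc k) x) (at 0)"
      "\<And>k x. cmod (F k x) \<le> C * B ^ k * sqrt (fact k) * exp (- d * (norm x)\<^sup>2)"
      using f(4)[OF b] unfolding gauss_chain_def by blast
    show ?thesis
      unfolding gauss_chain_def
    proof (intro exI[of _ "\<lambda>k x. (- 1) ^ k * F k (- x)"] conjI allI)
      fix k x
      show "(\<lambda>x. (- 1) ^ 0 * F 0 (- x)) = (\<lambda>x. f (- x))" by (simp add: F(1))
      have "continuous_on UNIV (\<lambda>x. F k (- x))"
        by (rule continuous_on_compose2[OF F(2)]) (auto intro!: continuous_intros)
      then show "continuous_on UNIV (\<lambda>x. (- 1) ^ k * F k (- x))"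
        by (intro continuous_intros)
      have "((\<lambda>r. F k (- x + r *\<^sub>R b)) \<circ> uminus has_vector_derivative (- 1) *\<^sub>R F (Suc k) (- x)) (at 0)"
        by (rule vector_diff_chain_at) (use F(3)[of k "- x"] in \<open>auto intro!: derivative_eq_intros\<close>)
      moreover have "(\<lambda>r. F k (- x + r *\<^sub>R b)) \<circ> uminus = (\<lambda>r. F k (- (x + r *\<^sub>R b)))"
        by (rule ext) (simp only: o_def minus_add_distrib scaleR_minus_left)
      ultimately have "((\<lambda>r. F k (- (x + r *\<^sub>R b))) has_vector_derivative (- 1) *\<^sub>R F (Suc k) (- x)) (at 0)"
        by (simp only:)
      from has_vector_derivative_mult_right[OF this, of "(- 1) ^ k"]
      show "((\<lambda>r. (- 1) ^ k * F k (- (x + r *\<^sub>R b))) has_vector_derivative (- 1) ^ Suc k * F (Suc k) (- x)) (at 0)"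
        by simp
      show "cmod ((- 1) ^ k * F k (- x)) \<le> C * B ^ k * sqrt (fact k) * exp (- d * (norm x)\<^sup>2)"
        using F(4)[of k "- x"] by (simp add: norm_mult norm_power)
    qed
  qed
  then show ?thesis using f by (intro gauss_classI[of C B d]) auto
qed

lemma gauss_class_L2:
  fixes f :: "'a::euclidean_space \<Rightarrow> complex"
  assumes "gauss_class f"
  shows "f \<in> L2"
proof -
  have [measurable]: "f \<in> borel_measurable borel"
    using gauss_class_continuous[OF assms] by (rule borel_measurable_continuous_onI)
  obtain C B d where f: "C > 0" "B > 0" "d > 0" "\<And>b. b \<in> Basis \<Longrightarrow> gauss_chain b C B d f"
    using assms unfolding gauss_class_def by blast
  have bnd: "cmod (f x) \<le> C * exp (- d * (norm x)\<^sup>2)" for x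
  proof -
    obtain b :: 'a where "b \<in> Basis" using nonempty_Basis by blast
    from f(4)[OF this] obtain F where "F 0 = f"
      "\<And>k x. cmod (F k x) \<le> C * B ^ k * sqrt (fact k) * exp (- d * (norm x)\<^sup>2)"
      unfolding gauss_chain_def by blast
    from this(2)[of 0 x] this(1) show ?thesis by simp
  qed
  have "(cmod (f x))\<^sup>2 \<le> C\<^sup>2 * exp (- d * (norm x)\<^sup>2)" for x
  proof -
    have "(cmod (f x))\<^sup>2 \<le> (C * exp (- d * (norm x)\<^sup>2))\<^sup>2" by (intro power_mono bnd) auto
    also have "\<dots> = C\<^sup>2 * (exp (- d * (norm x)\<^sup>2) * exp (- d * (norm x)\<^sup>2))"
      by (simp only: power_mult_distrib power2_eq_square[of "exp _"])
    also have "\<dots> \<le> C\<^sup>2 * (exp (- d * (norm x)\<^sup>2) * 1)"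
      using f by (intro mult_left_mono) auto
    finally show ?thesis by simp
  qed
  then have "integrable lborel (\<lambda>x. (cmod (f x))\<^sup>2)"
    by (intro Bochner_Integration.integrable_bound[OF integrable_mult_right[OF integrable_gaussian[OF \<open>d > 0\<close>], of "C\<^sup>2"]]) auto
  then show ?thesis by (simp add: L2_def)
qed

section \<open>Time-frequency shifts, their inner products and Wigner distributions\<close>

lemma tf_shift_continuous:
  assumes "continuous_on UNIV f"
  shows "continuous_on UNIV (tf_shift z f)"
proof -
  have "continuous_on UNIV (\<lambda>t. f (t - fst z))"
    by (rule continuous_on_compose2[OF assms]) (auto intro!: continuous_intros)
  then show ?thesis unfolding tf_shift_def by (intro continuous_intros)
qed

lemma tf_shift_L2:
  assumes "f \<in> L2"
  shows "tf_shift z f \<in> L2"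
proof -
  have [measurable]: "f \<in> borel_measurable borel" and int: "integrable lborel (\<lambda>x. (cmod (f x))\<^sup>2)"
    using assms by (auto simp: L2_def)
  have "continuous_on UNIV (\<lambda>t. cis (2 * pi * (snd z \<bullet> t)))" by (intro continuous_intros)
  then have [measurable]: "(\<lambda>t. cis (2 * pi * (snd z \<bullet> t))) \<in> borel_measurable borel"
    by (rule borel_measurable_continuous_onI)
  have "integrable lborel (\<lambda>x. (cmod (f (x + (- fst z))))\<^sup>2)"
    using int by (subst lborel_integral_translate(2)[where f = "\<lambda>x. (cmod (f x))\<^sup>2"]) auto
  then show ?thesis by (simp add: L2_def tf_shift_def[abs_def] norm_mult)
qed

lemma cmod_integral_cis: "cmod (LINT x|M. cis \<theta> * F x) = cmod (LINT x|M. F x)"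
  by (simp add: norm_mult)

lemma mult_rotate: "(a * b) * (x * y) = a * (x * y * b)" for a b x y :: complex
  by simp

lemma mult_cnj_rearrange: "a * x * cnj (b * y) * c = (a * cnj b * c) * (x * cnj y)" for a b c x y :: complex
  by simp

lemma mult_cnj_swap: "a * x * cnj (b * y) = (a * cnj b) * (x * cnj y)" for a b x y :: complex
  by simp

text \<open>Translating the integration variable by the time component of z reduces the inner
  product, up to a unimodular constant, to the short-time Fourier transform of g with window
  \<gamma> at \<mu> - z.\<close>

lemma tf_shift_coeff_decay:
  fixes g \<gamma> :: "real^'d \<Rightarrow> complex"
  assumes "gauss_class g" "gauss_class \<gamma>"
  obtains K e where "K > 0" "e > 0"
    "\<And>z \<mu>. cmod (bracket (tf_shift z g) (tf_shift \<mu> \<gamma>)) \<le> K * exp (- e * (norm (z - \<mu>))\<^sup>2)"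
proof -
  obtain K e where Ke: "K > 0" "e > 0"
    "\<And>x \<xi>. cmod (LINT t|lborel. g t * cnj (\<gamma> (t - x)) * cis (- (2 * pi * (\<xi> \<bullet> t))))
        \<le> K * exp (- e * ((norm x)\<^sup>2 + (norm \<xi>)\<^sup>2))"
    by (rule gauss_class_stft_decay[OF assms]) blast
  show thesis
  proof (rule that[OF Ke(1,2)])
    fix z \<mu> :: "(real^'d) \<times> (real^'d)"
    obtain z1 z2 where z: "z = (z1, z2)" by (cases z)
    obtain m1 m2 where m: "\<mu> = (m1, m2)" by (cases \<mu>)
    let ?f = "\<lambda>t. tf_shift z g t * cnj (tf_shift \<mu> \<gamma> t)"
    have "continuous_on UNIV ?f"
      by (intro continuous_intros tf_shift_continuous gauss_class_continuous assms)
    then have b1: "bracket (tf_shift z g) (tf_shift \<mu> \<gamma>) = (LINT t|lborel. ?f (t + z1))"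
      unfolding bracket_def by (subst lborel_integral_translate) (auto intro: borel_measurable_continuous_onI)
    have b2: "(LINT t|lborel. ?f (t + z1)) = (LINT t|lborel. cis (2 * pi * ((z2 - m2) \<bullet> z1)) *
        (g t * cnj (\<gamma> (t - (m1 - z1))) * cis (- (2 * pi * ((m2 - z2) \<bullet> t)))))"
    proof (intro Bochner_Integration.integral_cong refl)
      fix t
      have ph: "cis (2 * pi * (z2 \<bullet> (t + z1))) * cnj (cis (2 * pi * (m2 \<bullet> (t + z1))))
          = cis (2 * pi * ((z2 - m2) \<bullet> z1)) * cis (- (2 * pi * ((m2 - z2) \<bullet> t)))"
        unfolding cis_cnj cis_mult by (rule arg_cong[where f = cis]) (simp add: algebra_simps inner_simps)
      have sh: "t + z1 - m1 = t - (m1 - z1)" by simp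
      have "?f (t + z1) = (cis (2 * pi * (z2 \<bullet> (t + z1))) * cnj (cis (2 * pi * (m2 \<bullet> (t + z1)))))
          * (g t * cnj (\<gamma> (t - (m1 - z1))))"
        unfolding tf_shift_def z m fst_conv snd_conv sh add_diff_cancel_right' by (rule mult_cnj_swap)
      from trans[OF this[unfolded ph] mult_rotate] show "?f (t + z1) = cis (2 * pi * ((z2 - m2) \<bullet> z1)) *
        (g t * cnj (\<gamma> (t - (m1 - z1))) * cis (- (2 * pi * ((m2 - z2) \<bullet> t))))"
        .
    qed
    have b3: "cmod (bracket (tf_shift z g) (tf_shift \<mu> \<gamma>)) \<le> K * exp (- e * ((norm (m1 - z1))\<^sup>2 + (norm (m2 - z2))\<^sup>2))"
      unfolding b1 b2 cmod_integral_cis by (rule Ke(3))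
    have b4: "(norm (m1 - z1))\<^sup>2 + (norm (m2 - z2))\<^sup>2 = (norm (z - \<mu>))\<^sup>2"
      by (simp add: z m norm_prod_def norm_minus_commute)
    show "cmod (bracket (tf_shift z g) (tf_shift \<mu> \<gamma>)) \<le> K * exp (- e * (norm (z - \<mu>))\<^sup>2)"
      using b3 unfolding b4 .
  qed
qed

text \<open>Up to a unimodular factor, \<open>W(\<pi>(w)g, \<pi>(z)g)(x, \<xi>)\<close> is \<open>2\<^sup>d\<close> times the short-time Fourier
  transform of \<open>g\<close> with window \<open>g(- \<cdot>)\<close> at \<open>2((x, \<xi>) - (w + z)/2)\<close>.\<close>

lemma wigner_tf_shift_decay:
  fixes g :: "real^'d \<Rightarrow> complex"
  assumes "gauss_class g"
  obtains K e where "K > 0" "e > 0"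
    "\<And>w z \<zeta>. cmod (wigner (tf_shift w g) (tf_shift z g) \<zeta>) \<le> K * exp (- e * (norm (\<zeta> - (w + z) /\<^sub>R 2))\<^sup>2)"
proof -
  let ?D = "2 ^ DIM(real^'d) :: real"
  obtain K e where Ke: "K > 0" "e > 0"
    "\<And>x \<xi>. cmod (LINT t|lborel. g t * cnj (g (- (t - x))) * cis (- (2 * pi * (\<xi> \<bullet> t))))
        \<le> K * exp (- e * ((norm x)\<^sup>2 + (norm \<xi>)\<^sup>2))"
    by (rule gauss_class_stft_decay[OF assms gauss_class_reflect[OF assms]]) blast
  show thesis
  proof (rule that[of "?D * K" "4 * e"])
    show "?D * K > 0" "4 * e > 0" using Ke by auto
    fix w z \<zeta> :: "(real^'d) \<times> (real^'d)"
    obtain z1 z2 where z: "z = (z1, z2)" by (cases z)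
    obtain w1 w2 where w: "w = (w1, w2)" by (cases w)
    obtain x \<xi> where \<zeta>: "\<zeta> = (x, \<xi>)" by (cases \<zeta>)
    \<comment> \<open>Together these form 2 (\<zeta> - (w + z)/2), which accounts for the rate
      \<open>4 * e\<close>.\<close>
    define X \<Xi> where "X = 2 *\<^sub>R x - w1 - z1" and "\<Xi> = 2 *\<^sub>R \<xi> - w2 - z2"
    let ?f = "\<lambda>t. tf_shift w g (x + t /\<^sub>R 2) * cnj (tf_shift z g (x - t /\<^sub>R 2)) * cis (- (2 * pi * (t \<bullet> \<xi>)))"
    \<comment> \<open>Substitution chosen so that the first window is evaluated at r + w1, where the
      shift cancels and g(r) remains.\<close>
    let ?t = "\<lambda>r. - 2 *\<^sub>R (x - w1) + 2 *\<^sub>R r"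
    have c: "continuous_on UNIV (tf_shift u g)" for u
      by (intro tf_shift_continuous gauss_class_continuous assms)
    have "continuous_on UNIV ?f"
      by (intro continuous_intros continuous_on_compose2[OF c]) auto
    then have b1: "wigner (tf_shift w g) (tf_shift z g) \<zeta> = ?D *\<^sub>R (LINT r|lborel. ?f (?t r))"
      unfolding wigner_def \<zeta> prod.case
      by (subst lborel_integral_affine[where c = 2 and t = "- 2 *\<^sub>R (x - w1)"]) (auto intro: borel_measurable_continuous_onI)
    have b2: "(LINT r|lborel. ?f (?t r)) = (LINT r|lborel. cis (2 * pi * (w2 \<bullet> w1 - z2 \<bullet> (2 *\<^sub>R x - w1) + 2 * ((x - w1) \<bullet> \<xi>))) *
        (g r * cnj (g (- (r - X))) * cis (- (2 * pi * (\<Xi> \<bullet> r)))))"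
    proof (intro Bochner_Integration.integral_cong refl)
      fix r
      have 1: "x + ?t r /\<^sub>R 2 = r + w1" "x - ?t r /\<^sub>R 2 = 2 *\<^sub>R x - w1 - r"
      proof -
        have "?t r /\<^sub>R 2 = r - (x - w1)" by (simp add: scaleR_right_distrib scaleR_right_diff_distrib)
        then show "x + ?t r /\<^sub>R 2 = r + w1" "x - ?t r /\<^sub>R 2 = 2 *\<^sub>R x - w1 - r"
          by (simp_all only: scaleR_2) simp_all
      qed
      have 2: "2 *\<^sub>R x - w1 - r - z1 = - (r - X)" by (simp add: X_def)
      have ph: "cis (2 * pi * (w2 \<bullet> (r + w1))) * cnj (cis (2 * pi * (z2 \<bullet> (2 *\<^sub>R x - w1 - r)))) * cis (- (2 * pi * (?t r \<bullet> \<xi>)))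
        = cis (2 * pi * (w2 \<bullet> w1 - z2 \<bullet> (2 *\<^sub>R x - w1) + 2 * ((x - w1) \<bullet> \<xi>))) * cis (- (2 * pi * (\<Xi> \<bullet> r)))"
        unfolding cis_cnj cis_mult \<Xi>_def
        by (rule arg_cong[where f = cis]) (simp add: algebra_simps inner_simps inner_commute)
      have "?f (?t r) = (cis (2 * pi * (w2 \<bullet> (r + w1))) * cnj (cis (2 * pi * (z2 \<bullet> (2 *\<^sub>R x - w1 - r)))) * cis (- (2 * pi * (?t r \<bullet> \<xi>))))
          * (g r * cnj (g (- (r - X))))"
        unfolding 1 tf_shift_def z w fst_conv snd_conv 2 add_diff_cancel_right' by (rule mult_cnj_rearrange)
      from trans[OF this[unfolded ph] mult_rotate] show "?f (?t r) = cis (2 * pi * (w2 \<bullet> w1 - z2 \<bullet> (2 *\<^sub>R x - w1) + 2 * ((x - w1) \<bullet> \<xi>))) *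
        (g r * cnj (g (- (r - X))) * cis (- (2 * pi * (\<Xi> \<bullet> r))))"
        .
    qed
    have b3: "cmod (wigner (tf_shift w g) (tf_shift z g) \<zeta>) \<le> ?D * (K * exp (- e * ((norm X)\<^sup>2 + (norm \<Xi>)\<^sup>2)))"
      unfolding b1 b2 norm_scaleR cmod_integral_cis power_abs abs_numeral
      by (rule mult_left_mono[OF Ke(3)]) simp
    have b4: "(norm X)\<^sup>2 + (norm \<Xi>)\<^sup>2 = 4 * (norm (\<zeta> - (w + z) /\<^sub>R 2))\<^sup>2"
    proof -
      have "X = 2 *\<^sub>R (x - (w1 + z1) /\<^sub>R 2)" "\<Xi> = 2 *\<^sub>R (\<xi> - (w2 + z2) /\<^sub>R 2)"
        by (simp_all add: X_def \<Xi>_def algebra_simps)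
      then show ?thesis by (simp add: z w \<zeta> norm_prod_def power_mult_distrib)
    qed
    show "cmod (wigner (tf_shift w g) (tf_shift z g) \<zeta>) \<le> ?D * K * exp (- (4 * e) * (norm (\<zeta> - (w + z) /\<^sub>R 2))\<^sup>2)"
      using b3 unfolding b4 by (simp only: mult.assoc mult.left_commute[of e] minus_mult_left[symmetric] mult_minus_left)
  qed
qed

section \<open>Gaussian sums over lattices\<close>

text \<open>Distinct integer points differ by at least 1 in some coordinate, and an injective linear
  map is bounded below.\<close>

lemma is_lattice_separated:
  assumes "is_lattice (\<Lambda> :: 'a::euclidean_space set)"
  obtains r where "r > 0" "\<And>l m. l \<in> \<Lambda> \<Longrightarrow> m \<in> \<Lambda> \<Longrightarrow> l \<noteq> m \<Longrightarrow> r \<le> norm (l - m)"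
proof -
  obtain A :: "'a \<Rightarrow> 'a" where A: "linear A" "bij A" and \<Lambda>: "\<Lambda> = A ` {k. \<forall>b\<in>Basis. k \<bullet> b \<in> \<int>}"
    using assms unfolding is_lattice_def by blast
  obtain B where B: "B > 0" "\<And>x. B * norm x \<le> norm (A x)"
    using linear_inj_bounded_below_pos[OF A(1) bij_is_inj[OF A(2)]] by metis
  show thesis
  proof (rule that[OF B(1)])
    fix l m assume "l \<in> \<Lambda>" "m \<in> \<Lambda>" "l \<noteq> m"
    then obtain j k where jk: "l = A j" "m = A k" "\<forall>b\<in>Basis. j \<bullet> b \<in> \<int>" "\<forall>b\<in>Basis. k \<bullet> b \<in> \<int>" "j \<noteq> k"
      unfolding \<Lambda> by auto
    then obtain b where b: "b \<in> Basis" "(j - k) \<bullet> b \<noteq> 0"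
      using euclidean_eq_iff[of j k] by (auto simp: inner_diff_left)
    have "(j - k) \<bullet> b \<in> \<int>" using jk b by (simp add: inner_diff_left)
    then have "1 \<le> \<bar>(j - k) \<bullet> b\<bar>" using b(2) by (rule Ints_nonzero_abs_ge1)
    also have "\<dots> \<le> norm (j - k)" using Basis_le_norm[OF b(1)] .
    finally have "B * 1 \<le> B * norm (j - k)" using B(1) by (intro mult_left_mono) auto
    also have "\<dots> \<le> norm (l - m)" using B(2)[of "j - k"] by (simp add: jk linear_diff[OF A(1)])
    finally show "B \<le> norm (l - m)" by simp
  qed
qed

text \<open>Comparison with an integral: the balls of radius \<rho> around the points are disjoint,
  and on each the summand is at most e^d times a wider Gaussian centred at z. Translation invariance
  makes the resulting integral independent of z.\<close>

lemma gaussian_sum_separated: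
  fixes \<Lambda> :: "'a::euclidean_space set"
  assumes "r > 0" and sep: "\<And>l m. l \<in> \<Lambda> \<Longrightarrow> m \<in> \<Lambda> \<Longrightarrow> l \<noteq> m \<Longrightarrow> r \<le> norm (l - m)" and "d > 0"
  shows "\<exists>N. \<forall>S z. finite S \<longrightarrow> S \<subseteq> \<Lambda> \<longrightarrow> (\<Sum>l\<in>S. exp (- d * (norm (z - l))\<^sup>2)) \<le> N"
proof -
  \<comment> \<open>The bound r/2 makes the balls disjoint; the bound 1 allows
    \<open>gaussian_shift_le\<close>.\<close>
  define \<rho> where "\<rho> = min (r / 2) 1"
  have \<rho>: "\<rho> > 0" "\<rho> \<le> 1" "2 * \<rho> \<le> r" using assms by (auto simp: \<rho>_def)
  define V where "V = unit_ball_vol DIM('a) * \<rho> ^ DIM('a)"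
  have V: "measure lborel (ball l \<rho>) = V" for l :: 'a
    using \<rho> by (simp add: V_def content_ball)
  have "V > 0" using \<rho> by (simp add: V_def)
  let ?L = "LINT x|lborel. exp (- (d / 2) * (norm (x::'a))\<^sup>2)"
  show ?thesis
  proof (intro exI[of _ "exp d * ?L / V"] allI impI)
    fix S and z :: 'a assume S: "finite S" "S \<subseteq> \<Lambda>"
    let ?a = "\<lambda>l. exp (- d * (norm (z - l))\<^sup>2)"
    have int: "integrable lborel (\<lambda>x. exp d * exp (- (d / 2) * (norm (x - z))\<^sup>2))"
      using integrable_gaussian[of "d / 2", where 'a = 'a] \<open>d > 0\<close>
      by (intro integrable_mult_right) (use lborel_integral_translate(2)[of "\<lambda>x::'a. exp (- (d / 2) * (norm x)\<^sup>2)" "- z"] in simp)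
    have pw: "(\<Sum>l\<in>S. ?a l * indicator (ball l \<rho>) x) \<le> exp d * exp (- (d / 2) * (norm (x - z))\<^sup>2)" for x
    proof (cases "\<exists>l\<in>S. x \<in> ball l \<rho>")
      case True
      then obtain l where l: "l \<in> S" "x \<in> ball l \<rho>" by blast
      have uniq: "m = l" if "m \<in> S" "x \<in> ball m \<rho>" for m
      proof (rule ccontr)
        assume "m \<noteq> l"
        then have "r \<le> dist m l" using sep[of m l] that l S by (auto simp: dist_norm)
        also have "\<dots> < 2 * \<rho>" using dist_triangle2[of m l x] l(2) that(2) by simp
        finally show False using \<rho> by simp
      qed
      have "?a m * indicator (ball m \<rho>) x = (if m = l then ?a l else 0)" if "m \<in> S" for m
        using l(2) uniq[OF that] by (cases "x \<in> ball m \<rho>") (auto simp del: mem_ball)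
      then have "(\<Sum>m\<in>S. ?a m * indicator (ball m \<rho>) x) = (\<Sum>m\<in>S. if m = l then ?a l else 0)"
        by (intro sum.cong refl)
      also have "\<dots> = exp (- d * (norm ((x - z) + (l - x)))\<^sup>2)"
        using S l by (simp add: norm_minus_commute)
      also have "\<dots> \<le> exp d * exp (- (d / 2) * (norm (x - z))\<^sup>2)"
        using l \<rho> \<open>d > 0\<close> by (intro gaussian_shift_le) (auto simp: dist_norm)
      finally show ?thesis .
    next
      case False
      then have "(\<Sum>l\<in>S. ?a l * indicator (ball l \<rho>) x) = 0" by (intro sum.neutral) auto
      then show ?thesis by simp
    qed
    have intb: "integrable lborel (\<lambda>x. ?a l * indicator (ball l \<rho>) x)" for l
      using emeasure_lborel_ball_finite[of l \<rho>] by (intro integrable_mult_right) auto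
    have "(\<Sum>l\<in>S. ?a l) * V = (LINT x|lborel. (\<Sum>l\<in>S. ?a l * indicator (ball l \<rho>) x))"
      using intb by (simp add: Bochner_Integration.integral_sum V sum_distrib_right)
    also have "\<dots> \<le> (LINT x|lborel. exp d * exp (- (d / 2) * (norm (x - z))\<^sup>2))"
      using intb by (intro integral_mono int pw) auto
    also have "\<dots> = exp d * ?L"
      using lborel_integral_translate(1)[of "\<lambda>x::'a. exp (- (d / 2) * (norm x)\<^sup>2)" "- z"] by simp
    finally show "(\<Sum>l\<in>S. ?a l) \<le> exp d * ?L / V" using \<open>V > 0\<close> by (simp add: pos_le_divide_eq)
  qed
qed

lemma lattice_gaussian_sum:
  fixes \<Lambda> :: "'a::euclidean_space set"
  assumes "is_lattice \<Lambda>" "d > 0"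
  shows "\<exists>N. \<forall>S z. finite S \<longrightarrow> S \<subseteq> \<Lambda> \<longrightarrow> (\<Sum>l\<in>S. exp (- d * (norm (z - l))\<^sup>2)) \<le> N"
proof -
  obtain r where "r > 0" "\<And>l m. l \<in> \<Lambda> \<Longrightarrow> m \<in> \<Lambda> \<Longrightarrow> l \<noteq> m \<Longrightarrow> r \<le> norm (l - m)"
    by (rule is_lattice_separated[OF assms(1)]) blast
  then show ?thesis by (rule gaussian_sum_separated[OF _ _ assms(2)])
qed

text \<open>A summable family has countable support, and the Gaussian vanishes nowhere.\<close>

lemma is_lattice_countable:
  assumes "is_lattice (\<Lambda> :: 'a::euclidean_space set)"
  shows "countable \<Lambda>"
proof -
  obtain N where N: "\<And>S (z::'a). finite S \<Longrightarrow> S \<subseteq> \<Lambda> \<Longrightarrow> (\<Sum>l\<in>S. exp (- 1 * (norm (z - l))\<^sup>2)) \<le> N"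
    using lattice_gaussian_sum[OF assms zero_less_one] by blast
  let ?e = "\<lambda>l. exp (- 1 * (norm (0 - l))\<^sup>2) :: real"
  have bnd: "(\<Sum>l\<in>S. norm (?e l)) \<le> N" if "finite S" "S \<subseteq> \<Lambda>" for S
    using N[OF that, of 0] by simp
  have "(\<lambda>l. norm (?e l)) summable_on \<Lambda>"
  proof (rule nonneg_bdd_above_summable_on)
    show "bdd_above (sum (\<lambda>l. norm (?e l)) ` {F. F \<subseteq> \<Lambda> \<and> finite F})"
    proof (rule bdd_aboveI2)
      fix F assume "F \<in> {F. F \<subseteq> \<Lambda> \<and> finite F}"
      then show "(\<Sum>l\<in>F. norm (?e l)) \<le> N" by (intro bnd) auto
    qed
  qed simp
  then have "countable {l\<in>\<Lambda>. exp (- 1 * (norm (0 - l))\<^sup>2) \<noteq> 0}"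
    by (rule abs_summable_countable)
  then show ?thesis by simp
qed


section \<open>Cross-Wigner distributions on \<open>L\<^sup>2\<close>\<close>

lemma L2_measurable: "f \<in> L2 \<Longrightarrow> f \<in> borel_measurable borel"
  by (simp add: L2_def)

lemma borel_measurable_cnj [measurable (raw)]:
  assumes "f \<in> borel_measurable M"
  shows "(\<lambda>x. cnj (f x)) \<in> borel_measurable M"
proof -
  have "cnj \<in> borel_measurable borel"
    by (intro borel_measurable_continuous_onI continuous_intros)
  from measurable_compose[OF assms this] show ?thesis .
qed

lemma L2_add:
  assumes "f \<in> L2" "h \<in> L2"
  shows "(\<lambda>x. f x + h x) \<in> L2"
proof -
  have [measurable]: "f \<in> borel_measurable borel" "h \<in> borel_measurable borel"
    using assms by (auto intro: L2_measurable)
  have i: "integrable lborel (\<lambda>x. 2 * (cmod (f x))\<^sup>2 + 2 * (cmod (h x))\<^sup>2)"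
    using assms by (intro Bochner_Integration.integrable_add integrable_mult_right) (auto simp: L2_def)
  have "integrable lborel (\<lambda>x. (cmod (f x + h x))\<^sup>2)"
    by (rule Bochner_Integration.integrable_bound[OF i]) (use norm_add_sq_le in auto)
  then show ?thesis by (simp add: L2_def)
qed

lemma L2_cmult:
  assumes "f \<in> L2"
  shows "(\<lambda>x. a * f x) \<in> L2"
proof -
  have [measurable]: "f \<in> borel_measurable borel"
    using assms by (rule L2_measurable)
  have "integrable lborel (\<lambda>x. (cmod a)\<^sup>2 * (cmod (f x))\<^sup>2)"
    using assms by (intro integrable_mult_right) (auto simp: L2_def)
  then show ?thesis by (simp add: L2_def norm_mult power_mult_distrib)
qed

lemma L2_sum:
  assumes "finite S" "\<And>i. i \<in> S \<Longrightarrow> F i \<in> L2"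
  shows "(\<lambda>x. \<Sum>i\<in>S. F i x) \<in> L2"
  using assms
proof (induction S)
  case empty
  then show ?case by (simp add: L2_def)
next
  case (insert i S)
  then show ?case using L2_add[of "F i" "\<lambda>x. \<Sum>i\<in>S. F i x"] by simp
qed

text \<open>For fixed p the bound is linear in the norm of q, so L^2-convergence of q gives
  pointwise convergence of the Wigner distribution. It rests on a b \<le> (\<eta>/2) a^2 + b^2/(2
  \<eta>) with \<eta> equal to the norm of q, in place of the Cauchy-Schwarz inequality for
  integrals.\<close>

lemma wigner_integrable_bound:
  fixes p q :: "real^'d \<Rightarrow> complex"
  assumes p: "p \<in> L2" and q: "q \<in> L2"
  shows "integrable lborel (\<lambda>t. p (x + t /\<^sub>R 2) * cnj (q (x - t /\<^sub>R 2)) * cis (- (2 * pi * (t \<bullet> \<xi>))))" (is "integrable _ ?f")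
    and "cmod (wigner p q (x, \<xi>)) \<le> 2 ^ DIM(real^'d) * ((L2_norm p)\<^sup>2 + 1) / 2 * L2_norm q"
proof -
  let ?D = "2 ^ DIM(real^'d) :: real"
  have [measurable]: "p \<in> borel_measurable borel" "q \<in> borel_measurable borel"
    using p q by (auto intro: L2_measurable)
  have "continuous_on UNIV (\<lambda>t. cis (- (2 * pi * (t \<bullet> \<xi>))))" by (intro continuous_intros)
  then have [measurable]: "(\<lambda>t. cis (- (2 * pi * (t \<bullet> \<xi>)))) \<in> borel_measurable borel"
    by (rule borel_measurable_continuous_onI)
  let ?P = "\<lambda>t. (cmod (p (x + t /\<^sub>R 2)))\<^sup>2" and ?Q = "\<lambda>t. (cmod (q (x - t /\<^sub>R 2)))\<^sup>2"
  have aff: "x + (1/2) *\<^sub>R t = x + t /\<^sub>R 2" "x + (- 1/2) *\<^sub>R t = x - t /\<^sub>R 2" for t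
    by simp_all
  have P: "integrable lborel ?P" "(LINT t|lborel. ?P t) = ?D * (L2_norm p)\<^sup>2"
  proof -
    have i: "integrable lborel (\<lambda>y. (cmod (p y))\<^sup>2)" using p by (simp add: L2_def)
    then show "integrable lborel ?P"
      using lborel_integral_affine(2)[of "\<lambda>y. (cmod (p y))\<^sup>2" "1/2" x] unfolding aff by simp
    have "(L2_norm p)\<^sup>2 = (LINT y|lborel. (cmod (p y))\<^sup>2)"
      by (simp add: L2_norm_def)
    also have "\<dots> = (1/2) ^ DIM(real^'d) * (LINT t|lborel. ?P t)"
      using lborel_integral_affine(1)[of "\<lambda>y. (cmod (p y))\<^sup>2" "1/2" x] unfolding aff by simp
    finally show "(LINT t|lborel. ?P t) = ?D * (L2_norm p)\<^sup>2"
      by (simp add: power_one_over)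
  qed
  have Q: "integrable lborel ?Q" "(LINT t|lborel. ?Q t) = ?D * (L2_norm q)\<^sup>2"
  proof -
    have i: "integrable lborel (\<lambda>y. (cmod (q y))\<^sup>2)" using q by (simp add: L2_def)
    then show "integrable lborel ?Q"
      using lborel_integral_affine(2)[of "\<lambda>y. (cmod (q y))\<^sup>2" "- 1/2" x] unfolding aff by simp
    have "(L2_norm q)\<^sup>2 = (LINT y|lborel. (cmod (q y))\<^sup>2)"
      by (simp add: L2_norm_def)
    also have "\<dots> = (1/2) ^ DIM(real^'d) * (LINT t|lborel. ?Q t)"
      using lborel_integral_affine(1)[of "\<lambda>y. (cmod (q y))\<^sup>2" "- 1/2" x] unfolding aff by simp
    finally show "(LINT t|lborel. ?Q t) = ?D * (L2_norm q)\<^sup>2"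
      by (simp add: power_one_over)
  qed
  have amgm: "cmod (?f t) \<le> \<eta> / 2 * ?P t + 1 / (2 * \<eta>) * ?Q t" if "\<eta> > 0" for \<eta> t
  proof -
    have "0 \<le> (\<eta> * cmod (p (x + t /\<^sub>R 2)) - cmod (q (x - t /\<^sub>R 2)))\<^sup>2 / (2 * \<eta>)"
      using that by simp
    also have "\<dots> = \<eta> / 2 * ?P t + 1 / (2 * \<eta>) * ?Q t - cmod (p (x + t /\<^sub>R 2)) * cmod (q (x - t /\<^sub>R 2))"
      using that by (simp add: power2_eq_square field_simps)
    finally show ?thesis by (simp add: norm_mult)
  qed
  have int: "integrable lborel (\<lambda>t. \<eta> / 2 * ?P t + 1 / (2 * \<eta>) * ?Q t)" for \<eta>
    by (intro Bochner_Integration.integrable_add integrable_mult_right P Q)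
  show intf: "integrable lborel ?f"
  proof (rule Bochner_Integration.integrable_bound[OF int[of 1]])
    show "AE t in lborel. norm (?f t) \<le> norm (1 / 2 * ?P t + 1 / (2 * 1) * ?Q t)"
    proof (rule AE_I2)
      fix t
      show "norm (?f t) \<le> norm (1 / 2 * ?P t + 1 / (2 * 1) * ?Q t)"
        by (rule order_trans[OF amgm[OF zero_less_one, of t]]) (simp only: real_norm_def abs_ge_self)
    qed
    show "?f \<in> borel_measurable lborel" by simp
  qed
  define w where "w = cmod (wigner p q (x, \<xi>))"
  have bnd: "w \<le> \<eta> / 2 * (?D * (L2_norm p)\<^sup>2) + 1 / (2 * \<eta>) * (?D * (L2_norm q)\<^sup>2)" if "\<eta> > 0" for \<eta>
  proof -
    have "w \<le> (LINT t|lborel. \<eta> / 2 * ?P t + 1 / (2 * \<eta>) * ?Q t)"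
      unfolding w_def wigner_def prod.case
      by (rule Bochner_Integration.integral_norm_bound_integral[OF intf int amgm[OF that]])
    also have "\<dots> = (LINT t|lborel. \<eta> / 2 * ?P t) + (LINT t|lborel. 1 / (2 * \<eta>) * ?Q t)"
      by (intro Bochner_Integration.integral_add integrable_mult_right P Q)
    also have "\<dots> = \<eta> / 2 * (?D * (L2_norm p)\<^sup>2) + 1 / (2 * \<eta>) * (?D * (L2_norm q)\<^sup>2)"
      by (simp only: integral_mult_right_zero P Q)
    finally show ?thesis .
  qed
  have "L2_norm q \<ge> 0" by (simp add: L2_norm_def)
  then consider "L2_norm q = 0" | "L2_norm q > 0" by linarith
  then have "w \<le> ?D * ((L2_norm p)\<^sup>2 + 1) / 2 * L2_norm q"
  proof cases
    case 1
    have "w \<le> 0"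
    proof (rule ccontr)
      assume "\<not> w \<le> 0"
      let ?A = "?D * (L2_norm p)\<^sup>2"
      have A: "?A \<ge> 0" by simp
      \<comment> \<open>When q has norm zero only the first term of the bound survives; this \<eta>
        makes it less than w.\<close>
      have "w / (?A + 1) > 0" using A \<open>\<not> w \<le> 0\<close> by (intro divide_pos_pos) linarith+
      from bnd[OF this] have "w \<le> w / (?A + 1) / 2 * ?A" using 1 by simp
      also have "\<dots> = w * (?A / (2 * (?A + 1)))" by simp
      also have "\<dots> < w * 1"
      proof (rule mult_strict_left_mono)
        have "a / (2 * (a + 1)) < 1" if "a \<ge> 0" for a :: real
          using that by (simp add: divide_less_eq)
        from this[OF A] show "?A / (2 * (?A + 1)) < 1" .
      qed (use \<open>\<not> w \<le> 0\<close> in simp)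
      finally show False by simp
    qed
    then show ?thesis using 1 by simp
  next
    case 2
    have "w \<le> L2_norm q / 2 * (?D * (L2_norm p)\<^sup>2) + 1 / (2 * L2_norm q) * (?D * (L2_norm q)\<^sup>2)"
      by (rule bnd[OF 2])
    also have "1 / (2 * L2_norm q) * (?D * (L2_norm q)\<^sup>2) = L2_norm q / 2 * ?D"
      using 2 by (simp add: power2_eq_square)
    finally show ?thesis by (simp add: algebra_simps)
  qed
  then show "cmod (wigner p q (x, \<xi>)) \<le> ?D * ((L2_norm p)\<^sup>2 + 1) / 2 * L2_norm q"
    by (simp add: w_def)
qed

lemma wigner_diff_sum:
  fixes p f :: "real^'d \<Rightarrow> complex"
  assumes p: "p \<in> L2" and f: "f \<in> L2" and S: "finite S" "\<And>i. i \<in> S \<Longrightarrow> F i \<in> L2"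
  shows "wigner p (\<lambda>y. f y - (\<Sum>i\<in>S. b i * F i y)) \<zeta>
      = wigner p f \<zeta> - (\<Sum>i\<in>S. cnj (b i) * wigner p (F i) \<zeta>)"
proof -
  obtain x \<xi> where \<zeta>: "\<zeta> = (x, \<xi>)" by (cases \<zeta>)
  let ?I = "\<lambda>q t. p (x + t /\<^sub>R 2) * cnj (q (x - t /\<^sub>R 2)) * cis (- (2 * pi * (t \<bullet> \<xi>)))"
  have "wigner p (\<lambda>y. f y - (\<Sum>i\<in>S. b i * F i y)) \<zeta> = (LINT t|lborel. ?I f t - (\<Sum>i\<in>S. cnj (b i) * ?I (F i) t))"
    unfolding wigner_def \<zeta> prod.case
    by (intro Bochner_Integration.integral_cong refl)
       (simp add: cnj_sum sum_distrib_left sum_distrib_right algebra_simps)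
  also have "\<dots> = (LINT t|lborel. ?I f t) - (LINT t|lborel. (\<Sum>i\<in>S. cnj (b i) * ?I (F i) t))"
    using wigner_integrable_bound(1)[OF p] f S
    by (intro Bochner_Integration.integral_diff Bochner_Integration.integrable_sum integrable_mult_right) auto
  also have "(LINT t|lborel. (\<Sum>i\<in>S. cnj (b i) * ?I (F i) t)) = (\<Sum>i\<in>S. (LINT t|lborel. cnj (b i) * ?I (F i) t))"
    using wigner_integrable_bound(1)[OF p] S
    by (intro Bochner_Integration.integral_sum integrable_mult_right) auto
  finally show ?thesis
    unfolding wigner_def \<zeta> prod.case by (simp only: integral_mult_right_zero)
qed

text \<open>The integrand is jointly continuous, and a parameter integral of a jointly measurable
  function is measurable in the parameter.\<close>

lemma wigner_measurable:
  fixes p q :: "real^'d \<Rightarrow> complex"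
  assumes "continuous_on UNIV p" "continuous_on UNIV q"
  shows "wigner p q \<in> borel_measurable borel"
proof -
  let ?f = "\<lambda>(\<zeta>::(real^'d) \<times> (real^'d)) t. p (fst \<zeta> + t /\<^sub>R 2) * cnj (q (fst \<zeta> - t /\<^sub>R 2)) * cis (- (2 * pi * (t \<bullet> snd \<zeta>)))"
  have "continuous_on UNIV (case_prod ?f)"
    unfolding case_prod_beta
    by (intro continuous_intros continuous_on_compose2[OF assms(1)] continuous_on_compose2[OF assms(2)]) auto
  then have "case_prod ?f \<in> borel_measurable borel" by (rule borel_measurable_continuous_onI)
  then have "case_prod ?f \<in> borel_measurable (borel \<Otimes>\<^sub>M lborel)"
    by (simp add: borel_prod[symmetric] cong: measurable_cong_sets)
  then have "(\<lambda>\<zeta>. LINT t|lborel. ?f \<zeta> t) \<in> borel_measurable borel"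
    by (rule lborel.borel_measurable_lebesgue_integral)
  moreover have "wigner p q = (\<lambda>\<zeta>. LINT t|lborel. ?f \<zeta> t)"
    by (rule ext) (simp add: wigner_def case_prod_beta)
  ultimately show ?thesis by simp
qed

lemma wigner_swap:
  fixes p q :: "real^'d \<Rightarrow> complex"
  assumes "continuous_on UNIV p" "continuous_on UNIV q"
  shows "cnj (wigner p q \<zeta>) = wigner q p \<zeta>"
proof -
  obtain x \<xi> where \<zeta>: "\<zeta> = (x, \<xi>)" by (cases \<zeta>)
  let ?h = "\<lambda>t. cnj (p (x + t /\<^sub>R 2)) * q (x - t /\<^sub>R 2) * cis (2 * pi * (t \<bullet> \<xi>))"
  have "continuous_on UNIV ?h"
    by (intro continuous_intros continuous_on_compose2[OF assms(1)] continuous_on_compose2[OF assms(2)]) auto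
  then have m: "?h \<in> borel_measurable borel" by (rule borel_measurable_continuous_onI)
  have "cnj (wigner p q \<zeta>) = (LINT t|lborel. ?h t)"
    unfolding wigner_def \<zeta> prod.case Bochner_Integration.integral_cnj[symmetric]
    by (simp only: complex_cnj_mult complex_cnj_cnj cis_cnj minus_minus)
  also have "\<dots> = (LINT t|lborel. ?h (0 + (- 1) *\<^sub>R t))"
    using lborel_integral_affine(1)[OF m, of "- 1" 0] by simp
  also have "\<dots> = wigner q p \<zeta>"
    unfolding wigner_def \<zeta> prod.case by (intro Bochner_Integration.integral_cong refl) (simp add: mult_ac)
  finally show ?thesis .
qed

text \<open>The symbol \<open>cnj \<sigma>\<close> belongs to the formal adjoint of the Weyl
  operator, so its matrix entries are those of \<sigma> transposed and conjugated.\<close>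

lemma bracket_cnj_wigner:
  assumes "continuous_on UNIV p" "continuous_on UNIV q"
  shows "cmod (bracket (\<lambda>\<zeta>. cnj (\<sigma> \<zeta>)) (wigner p q)) = cmod (bracket \<sigma> (wigner q p))"
proof -
  have "bracket (\<lambda>\<zeta>. cnj (\<sigma> \<zeta>)) (wigner p q) = cnj (bracket \<sigma> (wigner q p))"
    unfolding bracket_def Bochner_Integration.integral_cnj[symmetric] wigner_swap[OF assms]
    by (simp only: complex_cnj_mult complex_cnj_cnj)
  then show ?thesis by simp
qed

text \<open>Unconditional convergence is a limit along the net of finite subsets, whereas dominated
  convergence needs a sequence.\<close>

lemma countable_exhaustion:
  assumes "countable \<Lambda>"
  obtains S :: "nat \<Rightarrow> 'a set" where "\<And>n. finite (S n)" "\<And>n. S n \<subseteq> \<Lambda>"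
    "filterlim S (finite_subsets_at_top \<Lambda>) sequentially"
proof -
  define S where "S n = {l\<in>\<Lambda>. to_nat_on \<Lambda> l < n}" for n
  have fin: "finite (S n)" for n
  proof (rule finite_imageD)
    show "finite (to_nat_on \<Lambda> ` S n)" by (rule finite_subset[of _ "{..<n}"]) (auto simp: S_def)
    show "inj_on (to_nat_on \<Lambda>) (S n)"
      using inj_on_to_nat_on[OF assms] by (rule inj_on_subset) (auto simp: S_def)
  qed
  have "filterlim S (finite_subsets_at_top \<Lambda>) sequentially"
    unfolding filterlim_iff eventually_finite_subsets_at_top
  proof (intro allI impI, elim exE conjE)
    fix P X assume X: "finite X" "X \<subseteq> \<Lambda>" and P: "\<forall>Y. finite Y \<and> X \<subseteq> Y \<and> Y \<subseteq> \<Lambda> \<longrightarrow> P Y"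
    obtain N where N: "\<And>l. l \<in> X \<Longrightarrow> to_nat_on \<Lambda> l < N"
      using finite_nat_set_iff_bounded[of "to_nat_on \<Lambda> ` X"] X by auto
    show "\<forall>\<^sub>F n in sequentially. P (S n)"
      using eventually_ge_at_top[of N]
    proof eventually_elim
      case (elim n)
      have "X \<subseteq> S n" using N X elim by (fastforce simp: S_def)
      then show ?case using P fin by (auto simp: S_def)
    qed
  qed
  then show thesis using fin by (intro that[of S]) (auto simp: S_def)
qed

text \<open>Recentres at the origin, where the integrability of \<sigma> is known. The factor
  depending on c does no harm for a fixed centre.\<close>

lemma gaussian_center_le:
  fixes \<zeta> c :: "'a::real_normed_vector"
  assumes "e > 0"
  shows "exp (- e * (norm (\<zeta> - c))\<^sup>2) \<le> exp (e * (norm c)\<^sup>2) * exp (- (e / 2) * (norm \<zeta>)\<^sup>2)"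
proof -
  have "(norm \<zeta>)\<^sup>2 \<le> 2 * (norm (\<zeta> - c))\<^sup>2 + 2 * (norm c)\<^sup>2"
    using norm_add_sq_le[of "\<zeta> - c" c] by simp
  then have "e / 2 * (norm \<zeta>)\<^sup>2 \<le> e / 2 * (2 * (norm (\<zeta> - c))\<^sup>2 + 2 * (norm c)\<^sup>2)"
    using assms by (intro mult_left_mono) auto
  then show ?thesis unfolding exp_add[symmetric] by (simp add: algebra_simps)
qed

text \<open>The centre (w + l)/2 wanders with l. Half of the Gaussian in z - l pays for moving it to
  the origin, the other half remains for summing over l. The growth in w + z is harmless, as the
  bound serves only as an integrable majorant for fixed w and z.\<close>

lemma gaussian_pair_le:
  fixes \<zeta> w z l :: "'a::real_normed_vector"
  assumes "e > 0" "e' > 0" and d: "d = min e' (2 * e)"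
  shows "exp (- e * (norm (z - l))\<^sup>2) * exp (- e' * (norm (\<zeta> - (w + l) /\<^sub>R 2))\<^sup>2)
     \<le> exp (d * (norm (w + z))\<^sup>2) * exp (- (d / 4) * (norm \<zeta>)\<^sup>2) * exp (- (e / 2) * (norm (z - l))\<^sup>2)"
proof -
  have "\<zeta> = (\<zeta> - (w + l) /\<^sub>R 2) + ((w + z) /\<^sub>R 2 + (l - z) /\<^sub>R 2)"
    by (simp add: algebra_simps)
  then have "(norm \<zeta>)\<^sup>2 \<le> 2 * (norm (\<zeta> - (w + l) /\<^sub>R 2))\<^sup>2 + 2 * (norm ((w + z) /\<^sub>R 2 + (l - z) /\<^sub>R 2))\<^sup>2"
    by (metis norm_add_sq_le)
  also have "\<dots> \<le> 2 * (norm (\<zeta> - (w + l) /\<^sub>R 2))\<^sup>2 + 2 * (2 * (norm ((w + z) /\<^sub>R 2))\<^sup>2 + 2 * (norm ((l - z) /\<^sub>R 2))\<^sup>2)"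
    by (intro add_left_mono mult_left_mono norm_add_sq_le) auto
  also have "\<dots> = 2 * (norm (\<zeta> - (w + l) /\<^sub>R 2))\<^sup>2 + (norm (w + z))\<^sup>2 + (norm (z - l))\<^sup>2"
    by (simp add: power_mult_distrib power_divide norm_minus_commute)
  finally have "d / 4 * (norm \<zeta>)\<^sup>2 \<le> d / 4 * (2 * (norm (\<zeta> - (w + l) /\<^sub>R 2))\<^sup>2 + (norm (w + z))\<^sup>2 + (norm (z - l))\<^sup>2)"
    using assms by (intro mult_left_mono) auto
  moreover have "d / 2 * (norm (\<zeta> - (w + l) /\<^sub>R 2))\<^sup>2 \<le> e' * (norm (\<zeta> - (w + l) /\<^sub>R 2))\<^sup>2"
    using assms by (intro mult_right_mono) auto
  moreover have "d / 4 * (norm (z - l))\<^sup>2 \<le> e / 2 * (norm (z - l))\<^sup>2"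
    using assms by (intro mult_right_mono) auto
  moreover have "d / 4 * (norm (w + z))\<^sup>2 \<le> d * (norm (w + z))\<^sup>2"
    using assms by (intro mult_right_mono) auto
  moreover have "e * (norm (z - l))\<^sup>2 = e / 2 * (norm (z - l))\<^sup>2 + e / 2 * (norm (z - l))\<^sup>2" by simp
  ultimately show ?thesis
    unfolding exp_add[symmetric] exp_le_cancel_iff distrib_left minus_mult_left[symmetric] by linarith
qed

section \<open>From the lattice to phase space\<close>

text \<open>Writing x as n times a vector of the unit ball, with n comparable to |x|, gives v(x)
  \<le> M^n, so v grows at most exponentially; any positive Gaussian rate dominates that.\<close>

lemma submult_weight_le_gaussian:
  fixes v :: "'a::euclidean_space \<Rightarrow> real"
  assumes "submult_weight v" "\<eta> > 0"
  obtains V where "V > 0" "\<And>x. v x \<le> V * exp (\<eta> * (norm x)\<^sup>2)"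
proof -
  have v: "continuous_on UNIV v" "\<And>z. v z > 0" "v 0 = 1" "\<And>y z. v (y + z) \<le> v y * v z"
    using assms(1) unfolding submult_weight_def by auto
  have "bdd_above (v ` cball 0 1)"
    by (intro compact_imp_bounded[THEN bounded_imp_bdd_above] compact_continuous_image
        continuous_on_subset[OF v(1)]) auto
  then obtain M where "\<forall>y\<in>cball 0 1. v y \<le> M"
    by (auto simp: bdd_above_def)
  then have M: "v y \<le> M" if "norm y \<le> 1" for y using that by auto
  have "M \<ge> 1" using M[of 0] v(3) by simp
  have pow: "v (real n *\<^sub>R y) \<le> v y ^ n" for n y
  proof (induction n)
    case (Suc n)
    have "v (real (Suc n) *\<^sub>R y) \<le> v y * v (real n *\<^sub>R y)"
      using v(4)[of y "real n *\<^sub>R y"] by (simp add: scaleR_left_distrib)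
    also have "\<dots> \<le> v y * v y ^ n" using Suc v(2)[of y] by (intro mult_left_mono) auto
    finally show ?case by simp
  qed (simp add: v)
  define a where "a = ln M"
  have a: "a \<ge> 0" "M = exp a" using \<open>M \<ge> 1\<close> by (simp_all add: a_def)
  have "v x \<le> exp (a\<^sup>2 / (4 * \<eta>) + 2 * a) * exp (\<eta> * (norm x)\<^sup>2)" for x
  proof -
    \<comment> \<open>The successor keeps n positive at x = 0, and the ceiling puts x/n into the
      unit ball.\<close>
    define n where "n = Suc (nat \<lceil>norm x\<rceil>)"
    have n: "n > 0" "norm x \<le> real n" "real n \<le> norm x + 2"
      using norm_ge_zero[of x] unfolding n_def by linarith+
    have "v x = v (real n *\<^sub>R (x /\<^sub>R real n))" using n by simp
    also have "\<dots> \<le> v (x /\<^sub>R real n) ^ n" by (rule pow)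
    also have "\<dots> \<le> M ^ n"
      using n v(2)[of "x /\<^sub>R real n"] by (intro power_mono M) (auto simp: divide_simps)
    also have "\<dots> = exp (real n * a)" by (simp add: a(2) exp_of_nat_mult)
    also have "\<dots> \<le> exp ((norm x + 2) * a)" using n a by (simp add: mult_right_mono)
    also have "\<dots> \<le> exp (a\<^sup>2 / (4 * \<eta>) + 2 * a + \<eta> * (norm x)\<^sup>2)"
    proof -
      \<comment> \<open>Completing the square bounds the linear exponent a |x| by a^2/(4 \<eta>) +
        \<eta> |x|^2.\<close>
      have "0 \<le> (2 * \<eta> * norm x - a)\<^sup>2 / (4 * \<eta>)" using assms(2) by simp
      also have "\<dots> = a\<^sup>2 / (4 * \<eta>) + \<eta> * (norm x)\<^sup>2 - norm x * a"
        using assms(2) by (simp add: power2_eq_square field_simps)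
      finally show ?thesis by (simp add: algebra_simps)
    qed
    finally show ?thesis by (simp add: exp_add)
  qed
  then show thesis by (intro that[of "exp (a\<^sup>2 / (4 * \<eta>) + 2 * a)"]) auto
qed

text \<open>Here s \<ge> 1/2 takes effect: p \<le> 2 bounds 2^p by 4 and lets 1 + |y - z|^2 replace
  the p-th power. Estimating through the maximum of the two distances treats p below and above 1
  alike.\<close>

lemma powr_norm_triangle_le:
  fixes x y z :: "'a::real_normed_vector"
  assumes "0 < p" "p \<le> 2"
  shows "norm (x - z) powr p \<le> 4 * norm (x - y) powr p + 4 * (1 + (norm (y - z))\<^sup>2)"
proof -
  let ?a = "norm (x - y)" and ?b = "norm (y - z)"
  have "norm (x - z) \<le> 2 * max ?a ?b" using norm_triangle_ineq[of "x - y" "y - z"] by simp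
  then have "norm (x - z) powr p \<le> (2 * max ?a ?b) powr p" using assms by (intro powr_mono2) auto
  also have "\<dots> = 2 powr p * max ?a ?b powr p" by (simp add: powr_mult)
  also have "\<dots> \<le> 4 * max ?a ?b powr p"
  proof (rule mult_right_mono)
    have "2 powr p \<le> (2::real) powr 2" using assms by (intro powr_mono) auto
    then show "2 powr p \<le> (4::real)" by simp
  qed simp
  also have "max ?a ?b powr p \<le> ?a powr p + ?b powr p" by (simp add: max_def)
  also have "?b powr p \<le> 1 + ?b\<^sup>2"
  proof (cases "?b \<le> 1")
    case True
    then have "?b powr p \<le> 1 powr p" using assms by (intro powr_mono2) auto
    then show ?thesis by (simp add: add_increasing2)
  next
    case False
    then have "?b powr p \<le> ?b powr 2" using assms by (intro powr_mono) auto
    then show ?thesis using False by (simp add: powr_numeral)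
  qed
  finally show ?thesis by simp
qed


text \<open>Termwise application of the Weyl form to an \<open>L\<^sup>2\<close>-convergent Gabor expansion. The symbol is only
  integrable against Gaussians, so the interchange is dominated convergence with a Gaussian majorant
  of the partial sums, which the decay of the coefficients provides.\<close>

lemma weyl_form_expansion_bound:
  fixes g :: "real^'d \<Rightarrow> complex" and \<sigma> :: "(real^'d) \<times> (real^'d) \<Rightarrow> complex"
  assumes g: "gauss_class g"
    and \<sigma> [measurable]: "\<sigma> \<in> borel_measurable borel"
    and \<sigma>_int: "\<And>d. d > 0 \<Longrightarrow> integrable lborel (\<lambda>\<zeta>. cmod (\<sigma> \<zeta>) * exp (- d * (norm \<zeta>)\<^sup>2))"
    and \<Lambda>: "is_lattice \<Lambda>"
    and b: "\<And>l. cmod (b l) \<le> K * exp (- e * (norm (z - l))\<^sup>2)" and Ke: "K > 0" "e > 0"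
    and expansion: "has_L2_sum (\<lambda>l t. b l * tf_shift l g t) (tf_shift z g) \<Lambda>"
    and R: "\<And>S. finite S \<Longrightarrow> S \<subseteq> \<Lambda> \<Longrightarrow>
      (\<Sum>l\<in>S. cmod (b l) * cmod (bracket \<sigma> (wigner (tf_shift w g) (tf_shift l g)))) \<le> R"
  shows "cmod (bracket \<sigma> (wigner (tf_shift w g) (tf_shift z g))) \<le> R"
proof -
  define W where "W l = wigner (tf_shift w g) (tf_shift l g)" for l
  have gc: "continuous_on UNIV (tf_shift l g)" and gL: "tf_shift l g \<in> L2" for l
    using tf_shift_continuous[OF gauss_class_continuous[OF g]] tf_shift_L2[OF gauss_class_L2[OF g]] by auto
  have [measurable]: "W l \<in> borel_measurable borel" for l
    unfolding W_def by (intro wigner_measurable gc)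
  obtain K' e' where Ke': "K' > 0" "e' > 0"
    and W: "\<And>w z \<zeta>. cmod (wigner (tf_shift w g) (tf_shift z g) \<zeta>) \<le> K' * exp (- e' * (norm (\<zeta> - (w + z) /\<^sub>R 2))\<^sup>2)"
    by (rule wigner_tf_shift_decay[OF g]) blast
  have "e / 2 > 0" using Ke by simp
  from lattice_gaussian_sum[OF \<Lambda> this]
  obtain N where N0: "\<forall>S z. finite S \<longrightarrow> S \<subseteq> \<Lambda> \<longrightarrow> (\<Sum>l\<in>S. exp (- (e / 2) * (norm (z - l))\<^sup>2)) \<le> N"
    by (rule exE)
  have N: "(\<Sum>l\<in>S. exp (- (e / 2) * (norm (z - l))\<^sup>2)) \<le> N" if "finite S" "S \<subseteq> \<Lambda>" for S
    using N0 that by blast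
  obtain S where S: "\<And>n. finite (S n)" "\<And>n. S n \<subseteq> \<Lambda>"
    and S_lim: "filterlim S (finite_subsets_at_top \<Lambda>) sequentially"
    by (rule countable_exhaustion[OF is_lattice_countable[OF \<Lambda>]]) blast
  \<comment> \<open>\<open>wigner\<close> is conjugate-linear in its second window, hence
    \<open>cnj (b l)\<close>; the bracket with \<sigma> conjugates again and restores
    \<open>b l\<close>.\<close>
  define s where "s n \<zeta> = (\<Sum>l\<in>S n. cnj (b l) * W l \<zeta>)" for n \<zeta>
  define d where "d = min e' (2 * e)"
  have "d > 0" using Ke Ke' by (simp add: d_def)
  \<comment> \<open>M may depend on w and z: it only justifies the interchange of limit and
    integral, while the final estimate is carried by R.\<close>
  define M where "M = K * K' * exp (d * (norm (w + z))\<^sup>2) * N"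
  have s_bound: "cmod (s n \<zeta>) \<le> M * exp (- (d / 4) * (norm \<zeta>)\<^sup>2)" for n \<zeta>
  proof -
    let ?G = "exp (d * (norm (w + z))\<^sup>2) * exp (- (d / 4) * (norm \<zeta>)\<^sup>2)"
    have "cmod (cnj (b l) * W l \<zeta>) \<le> K * K' * ?G * exp (- (e / 2) * (norm (z - l))\<^sup>2)" for l
    proof -
      have "cmod (cnj (b l) * W l \<zeta>) \<le> (K * exp (- e * (norm (z - l))\<^sup>2)) * (K' * exp (- e' * (norm (\<zeta> - (w + l) /\<^sub>R 2))\<^sup>2))"
        unfolding norm_mult complex_mod_cnj W_def using Ke by (intro mult_mono b W) auto
      also have "\<dots> = (K * K') * (exp (- e * (norm (z - l))\<^sup>2) * exp (- e' * (norm (\<zeta> - (w + l) /\<^sub>R 2))\<^sup>2))"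
        by (rule mult.assoc[THEN trans]) simp
      also have "\<dots> \<le> (K * K') * (?G * exp (- (e / 2) * (norm (z - l))\<^sup>2))"
        using Ke Ke' by (intro mult_left_mono gaussian_pair_le d_def) auto
      finally show ?thesis by (simp only: mult.assoc)
    qed
    then have "cmod (s n \<zeta>) \<le> (\<Sum>l\<in>S n. K * K' * ?G * exp (- (e / 2) * (norm (z - l))\<^sup>2))"
      unfolding s_def by (rule sum_norm_le)
    also have "\<dots> = K * K' * ?G * (\<Sum>l\<in>S n. exp (- (e / 2) * (norm (z - l))\<^sup>2))"
      by (simp only: sum_distrib_left)
    also have "\<dots> \<le> K * K' * ?G * N"
      using Ke Ke' S by (intro mult_left_mono N) auto
    finally show ?thesis by (simp only: M_def mult.assoc mult.left_commute mult.commute)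
  qed
  have s_lim: "(\<lambda>n. s n \<zeta>) \<longlonglongrightarrow> wigner (tf_shift w g) (tf_shift z g) \<zeta>" for \<zeta>
  proof -
    obtain x \<xi> where \<zeta>: "\<zeta> = (x, \<xi>)" by (cases \<zeta>)
    \<comment> \<open>Remainder of the expansion after the n-th partial sum; \<open>?C\<close> does
      not depend on n.\<close>
    let ?q = "\<lambda>n y. tf_shift z g y - (\<Sum>l\<in>S n. b l * tf_shift l g y)"
    let ?C = "2 ^ DIM(real^'d) * ((L2_norm (tf_shift w g))\<^sup>2 + 1) / 2"
    have "?q n \<in> L2" for n
      using L2_add[OF gL L2_cmult[OF L2_sum[OF S(1) L2_cmult[OF gL]], of "- 1"]] by simp
    then have "cmod (wigner (tf_shift w g) (?q n) \<zeta>) \<le> ?C * L2_norm (?q n)" for n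
      unfolding \<zeta> by (intro wigner_integrable_bound(2) gL)
    moreover have "wigner (tf_shift w g) (?q n) \<zeta> = wigner (tf_shift w g) (tf_shift z g) \<zeta> - s n \<zeta>" for n
      unfolding s_def W_def by (intro wigner_diff_sum gL S(1))
    ultimately have bd: "cmod (wigner (tf_shift w g) (tf_shift z g) \<zeta> - s n \<zeta>) \<le> ?C * L2_norm (?q n)" for n
      by simp
    have "(\<lambda>n. L2_norm (?q n)) \<longlonglongrightarrow> 0"
      using filterlim_compose[OF expansion[unfolded has_L2_sum_def] S_lim] .
    then have "(\<lambda>n. ?C * L2_norm (?q n)) \<longlonglongrightarrow> 0" by (rule tendsto_mult_right_zero)
    then have "(\<lambda>n. wigner (tf_shift w g) (tf_shift z g) \<zeta> - s n \<zeta>) \<longlonglongrightarrow> 0"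
      by (rule Lim_null_comparison[rotated]) (intro always_eventually allI bd)
    from tendsto_diff[OF tendsto_const this, of "wigner (tf_shift w g) (tf_shift z g) \<zeta>"]
    show ?thesis by simp
  qed
  have W_int: "integrable lborel (\<lambda>\<zeta>. \<sigma> \<zeta> * cnj (W l \<zeta>))" for l
  proof (rule Bochner_Integration.integrable_bound)
    let ?c = "(w + l) /\<^sub>R 2"
    show "integrable lborel (\<lambda>\<zeta>. K' * exp (e' * (norm ?c)\<^sup>2) * (cmod (\<sigma> \<zeta>) * exp (- (e' / 2) * (norm \<zeta>)\<^sup>2)))"
      using Ke' by (intro integrable_mult_right \<sigma>_int) auto
    show "AE \<zeta> in lborel. norm (\<sigma> \<zeta> * cnj (W l \<zeta>))
        \<le> norm (K' * exp (e' * (norm ?c)\<^sup>2) * (cmod (\<sigma> \<zeta>) * exp (- (e' / 2) * (norm \<zeta>)\<^sup>2)))"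
    proof (rule AE_I2)
      fix \<zeta>
      have "cmod (W l \<zeta>) \<le> K' * exp (- e' * (norm (\<zeta> - ?c))\<^sup>2)" unfolding W_def by (rule W)
      also have "\<dots> \<le> K' * (exp (e' * (norm ?c)\<^sup>2) * exp (- (e' / 2) * (norm \<zeta>)\<^sup>2))"
        using Ke' by (intro mult_left_mono gaussian_center_le) auto
      finally have "cmod (\<sigma> \<zeta>) * cmod (W l \<zeta>) \<le> cmod (\<sigma> \<zeta>) * (K' * (exp (e' * (norm ?c)\<^sup>2) * exp (- (e' / 2) * (norm \<zeta>)\<^sup>2)))"
        by (rule mult_left_mono) simp
      also have "\<dots> = K' * exp (e' * (norm ?c)\<^sup>2) * (cmod (\<sigma> \<zeta>) * exp (- (e' / 2) * (norm \<zeta>)\<^sup>2))"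
        by (simp only: mult.assoc mult.left_commute)
      finally show "norm (\<sigma> \<zeta> * cnj (W l \<zeta>)) \<le> norm (K' * exp (e' * (norm ?c)\<^sup>2) * (cmod (\<sigma> \<zeta>) * exp (- (e' / 2) * (norm \<zeta>)\<^sup>2)))"
        unfolding norm_mult complex_mod_cnj by (rule order_trans) (use Ke' in simp)
    qed
  qed measurable
  have [measurable]: "s n \<in> borel_measurable borel" for n
    unfolding s_def[abs_def] by measurable
  have wm: "wigner (tf_shift w g) (tf_shift z g) \<in> borel_measurable borel"
    by (intro wigner_measurable gc)
  note [measurable] = wm
  have "(\<lambda>n. LINT \<zeta>|lborel. \<sigma> \<zeta> * cnj (s n \<zeta>)) \<longlonglongrightarrow> (LINT \<zeta>|lborel. \<sigma> \<zeta> * cnj (wigner (tf_shift w g) (tf_shift z g) \<zeta>))"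
  proof (rule integral_dominated_convergence[where w = "\<lambda>\<zeta>. M * (cmod (\<sigma> \<zeta>) * exp (- (d / 4) * (norm \<zeta>)\<^sup>2))"])
    show "integrable lborel (\<lambda>\<zeta>. M * (cmod (\<sigma> \<zeta>) * exp (- (d / 4) * (norm \<zeta>)\<^sup>2)))"
      using \<open>d > 0\<close> by (intro integrable_mult_right \<sigma>_int) auto
    show "AE \<zeta> in lborel. (\<lambda>n. \<sigma> \<zeta> * cnj (s n \<zeta>)) \<longlonglongrightarrow> \<sigma> \<zeta> * cnj (wigner (tf_shift w g) (tf_shift z g) \<zeta>)"
      by (intro AE_I2 tendsto_mult tendsto_const tendsto_cnj s_lim)
    fix n
    show "AE \<zeta> in lborel. norm (\<sigma> \<zeta> * cnj (s n \<zeta>)) \<le> M * (cmod (\<sigma> \<zeta>) * exp (- (d / 4) * (norm \<zeta>)\<^sup>2))"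
    proof (rule AE_I2)
      fix \<zeta>
      have "cmod (\<sigma> \<zeta>) * cmod (s n \<zeta>) \<le> cmod (\<sigma> \<zeta>) * (M * exp (- (d / 4) * (norm \<zeta>)\<^sup>2))"
        by (intro mult_left_mono s_bound) simp
      then show "norm (\<sigma> \<zeta> * cnj (s n \<zeta>)) \<le> M * (cmod (\<sigma> \<zeta>) * exp (- (d / 4) * (norm \<zeta>)\<^sup>2))"
        by (simp only: norm_mult complex_mod_cnj mult.left_commute)
    qed
  qed measurable
  moreover have "(LINT \<zeta>|lborel. \<sigma> \<zeta> * cnj (s n \<zeta>)) = (\<Sum>l\<in>S n. b l * bracket \<sigma> (W l))" for n
  proof -
    have "(LINT \<zeta>|lborel. \<sigma> \<zeta> * cnj (s n \<zeta>)) = (LINT \<zeta>|lborel. (\<Sum>l\<in>S n. b l * (\<sigma> \<zeta> * cnj (W l \<zeta>))))"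
      by (intro Bochner_Integration.integral_cong refl)
         (simp add: s_def sum_distrib_left mult.left_commute)
    also have "\<dots> = (\<Sum>l\<in>S n. (LINT \<zeta>|lborel. b l * (\<sigma> \<zeta> * cnj (W l \<zeta>))))"
      by (intro Bochner_Integration.integral_sum integrable_mult_right W_int)
    finally show ?thesis unfolding bracket_def by (simp only: integral_mult_right_zero)
  qed
  ultimately have lim: "(\<lambda>n. \<Sum>l\<in>S n. b l * bracket \<sigma> (W l)) \<longlonglongrightarrow> bracket \<sigma> (wigner (tf_shift w g) (tf_shift z g))"
    unfolding bracket_def[of \<sigma> "wigner (tf_shift w g) (tf_shift z g)"] by simp
  have "cmod (\<Sum>l\<in>S n. b l * bracket \<sigma> (W l)) \<le> R" for n
  proof -
    have "cmod (\<Sum>l\<in>S n. b l * bracket \<sigma> (W l)) \<le> (\<Sum>l\<in>S n. cmod (b l) * cmod (bracket \<sigma> (W l)))"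
      by (rule sum_norm_le) (simp add: norm_mult)
    also have "\<dots> \<le> R" unfolding W_def by (rule R[OF S])
    finally show ?thesis .
  qed
  then show ?thesis
    by (intro tendsto_upperbound[OF tendsto_norm[OF lim]] always_eventually) auto
qed

text \<open>Frees one variable at a time. The set T holds the range of the other variable, so the
  same statement serves with T = \<open>\<Lambda>\<close> and with T = \<open>UNIV\<close>. On
  \<sigma> it assumes only properties shared by its conjugate.\<close>

lemma weyl_form_decay_off_lattice:
  fixes g \<gamma> :: "real^'d \<Rightarrow> complex" and \<sigma> :: "(real^'d) \<times> (real^'d) \<Rightarrow> complex"
  assumes g: "gauss_class g" and \<gamma>: "gauss_class \<gamma>" and dual: "dual_window g \<Lambda> \<gamma>"
    and \<sigma>: "\<sigma> \<in> borel_measurable borel"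
    and \<sigma>_int: "\<And>d. d > 0 \<Longrightarrow> integrable lborel (\<lambda>\<zeta>. cmod (\<sigma> \<zeta>) * exp (- d * (norm \<zeta>)\<^sup>2))"
    and v: "submult_weight v" and m: "m \<in> moderate_weights v" and p: "0 < p" "p \<le> 2"
    and c: "c > 0" and \<epsilon>: "\<epsilon> > 0"
    and decay: "\<And>w l. w \<in> T \<Longrightarrow> l \<in> \<Lambda> \<Longrightarrow> cmod (bracket \<sigma> (wigner (tf_shift w g) (tf_shift l g)))
        \<le> c * m ((w + l) /\<^sub>R 2) * exp (- \<epsilon> * norm (w - l) powr p)"
  shows "\<exists>c>0. \<exists>\<epsilon>>0. \<forall>w\<in>T. \<forall>z. cmod (bracket \<sigma> (wigner (tf_shift w g) (tf_shift z g)))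
        \<le> c * m ((w + z) /\<^sub>R 2) * exp (- \<epsilon> * norm (w - z) powr p)"
proof -
  have \<Lambda>: "is_lattice \<Lambda>" using dual by (simp add: dual_window_def gabor_frame_def)
  obtain K e where Ke: "K > 0" "e > 0"
    and coeff: "\<And>z \<mu>. cmod (bracket (tf_shift z g) (tf_shift \<mu> \<gamma>)) \<le> K * exp (- e * (norm (z - \<mu>))\<^sup>2)"
    by (rule tf_shift_coeff_decay[OF g \<gamma>]) blast
  have "e / 2 > 0" using Ke by simp
  from lattice_gaussian_sum[OF \<Lambda> this]
  obtain N where N0: "\<forall>S z. finite S \<longrightarrow> S \<subseteq> \<Lambda> \<longrightarrow> (\<Sum>l\<in>S. exp (- (e / 2) * (norm (z - l))\<^sup>2)) \<le> N"
    by (rule exE)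
  have N: "(\<Sum>l\<in>S. exp (- (e / 2) * (norm (z - l))\<^sup>2)) \<le> N" if "finite S" "S \<subseteq> \<Lambda>" for S z
    using N0 that by blast
  have "N \<ge> 0" using N[of "{}"] by simp
  obtain V where V: "V > 0" "\<And>x. v x \<le> V * exp (e * (norm x)\<^sup>2)"
    by (rule submult_weight_le_gaussian[OF v Ke(2)]) blast
  obtain C where C: "C > 0" "\<And>z \<zeta>. m (z + \<zeta>) \<le> C * v z * m \<zeta>" and m_pos: "\<And>z. m z > 0"
    using m unfolding moderate_weights_def by blast
  \<comment> \<open>At most \<epsilon>, so the given decay can be used, and small enough that
    replacing l by z in the exponential costs at most e/4 times |z - l|^2.\<close>
  define \<epsilon>1 where "\<epsilon>1 = min \<epsilon> (e / 16)"
  have \<epsilon>1: "\<epsilon>1 > 0" "\<epsilon>1 \<le> \<epsilon>" "\<epsilon>1 \<le> e / 16" using \<epsilon> Ke by (auto simp: \<epsilon>1_def)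
  define A where "A = K * c * C * V * exp \<epsilon>1"
  have A: "A > 0" using Ke c C V by (simp add: A_def)
  have "cmod (bracket \<sigma> (wigner (tf_shift w g) (tf_shift z g)))
        \<le> (A * (N + 1)) * m ((w + z) /\<^sub>R 2) * exp (- (\<epsilon>1 / 4) * norm (w - z) powr p)"
    if w: "w \<in> T" for w z
  proof (rule weyl_form_expansion_bound[OF g \<sigma> \<sigma>_int \<Lambda>])
    let ?b = "\<lambda>l. bracket (tf_shift z g) (tf_shift l \<gamma>)"
    let ?F = "m ((w + z) /\<^sub>R 2) * exp (- (\<epsilon>1 / 4) * norm (w - z) powr p)"
    show "cmod (?b l) \<le> K * exp (- e * (norm (z - l))\<^sup>2)" for l by (rule coeff)
    show "has_L2_sum (\<lambda>l t. ?b l * tf_shift l g t) (tf_shift z g) \<Lambda>"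
      using dual tf_shift_L2[OF gauss_class_L2[OF g]] by (simp add: dual_window_def)
    have term_le: "cmod (?b l) * cmod (bracket \<sigma> (wigner (tf_shift w g) (tf_shift l g)))
        \<le> A * ?F * exp (- (e / 2) * (norm (z - l))\<^sup>2)" if l: "l \<in> \<Lambda>" for l
    proof -
      let ?n = "(norm (z - l))\<^sup>2"
      have m_le: "m ((w + l) /\<^sub>R 2) \<le> C * V * exp (e / 4 * ?n) * m ((w + z) /\<^sub>R 2)"
      proof -
        \<comment> \<open>Changing l to z moves the midpoint by only (l - z)/2, so the rate e in the
          bound for v becomes e/4.\<close>
        have "m ((w + l) /\<^sub>R 2) = m ((l - z) /\<^sub>R 2 + (w + z) /\<^sub>R 2)"
          by (rule arg_cong[where f = m]) (simp add: algebra_simps)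
        also have "\<dots> \<le> C * v ((l - z) /\<^sub>R 2) * m ((w + z) /\<^sub>R 2)" by (rule C(2))
        also have "\<dots> \<le> C * (V * exp (e * (norm ((l - z) /\<^sub>R 2))\<^sup>2)) * m ((w + z) /\<^sub>R 2)"
          using C m_pos[of "(w + z) /\<^sub>R 2"] by (intro mult_right_mono mult_left_mono V(2)) auto
        also have "e * (norm ((l - z) /\<^sub>R 2))\<^sup>2 = e / 4 * ?n"
          by (simp add: power_divide norm_minus_commute)
        finally show ?thesis by (simp only: mult.assoc)
      qed
      have exp_le: "exp (- \<epsilon> * norm (w - l) powr p) \<le> exp \<epsilon>1 * exp (e / 4 * ?n) * exp (- (\<epsilon>1 / 4) * norm (w - z) powr p)"
      proof -
        have "norm (w - z) powr p \<le> 4 * norm (w - l) powr p + 4 * (1 + ?n)"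
          using powr_norm_triangle_le[OF p, of w z l] by (simp add: norm_minus_commute)
        then have "\<epsilon>1 / 4 * norm (w - z) powr p \<le> \<epsilon>1 / 4 * (4 * norm (w - l) powr p + 4 * (1 + ?n))"
          using \<epsilon>1 by (intro mult_left_mono) auto
        also have "\<dots> = \<epsilon>1 * norm (w - l) powr p + \<epsilon>1 + \<epsilon>1 * ?n" by (simp add: algebra_simps)
        also have "\<dots> \<le> \<epsilon> * norm (w - l) powr p + \<epsilon>1 + e / 4 * ?n"
          using \<epsilon>1 Ke by (intro add_mono mult_right_mono) auto
        finally show ?thesis unfolding exp_add[symmetric] by simp
      qed
      have "cmod (bracket \<sigma> (wigner (tf_shift w g) (tf_shift l g)))
          \<le> c * m ((w + l) /\<^sub>R 2) * exp (- \<epsilon> * norm (w - l) powr p)"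
        by (rule decay[OF w l])
      also have "\<dots> \<le> c * (C * V * exp (e / 4 * ?n) * m ((w + z) /\<^sub>R 2)) *
          (exp \<epsilon>1 * exp (e / 4 * ?n) * exp (- (\<epsilon>1 / 4) * norm (w - z) powr p))"
        using c C V m_pos[of "(w + z) /\<^sub>R 2"]
        by (intro mult_mono m_le exp_le order_refl mult_nonneg_nonneg) (auto simp: less_imp_le[OF m_pos])
      finally have B: "cmod (bracket \<sigma> (wigner (tf_shift w g) (tf_shift l g)))
          \<le> c * (C * V * exp (e / 4 * ?n) * m ((w + z) /\<^sub>R 2)) *
          (exp \<epsilon>1 * exp (e / 4 * ?n) * exp (- (\<epsilon>1 / 4) * norm (w - z) powr p))" .
      have "cmod (?b l) * cmod (bracket \<sigma> (wigner (tf_shift w g) (tf_shift l g)))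
          \<le> (K * exp (- e * ?n)) * (c * (C * V * exp (e / 4 * ?n) * m ((w + z) /\<^sub>R 2)) *
          (exp \<epsilon>1 * exp (e / 4 * ?n) * exp (- (\<epsilon>1 / 4) * norm (w - z) powr p)))"
        using Ke by (intro mult_mono coeff B) auto
      also have "\<dots> = A * ?F * (exp (- e * ?n) * exp (e / 4 * ?n) * exp (e / 4 * ?n))"
        unfolding A_def by algebra
      also have "exp (- e * ?n) * exp (e / 4 * ?n) * exp (e / 4 * ?n) = exp (- (e / 2) * ?n)"
        unfolding exp_add[symmetric] by (simp add: algebra_simps)
      finally show ?thesis .
    qed
    have F: "A * ?F \<ge> 0" using A m_pos[of "(w + z) /\<^sub>R 2"] by simp
    fix S assume S: "finite S" "S \<subseteq> \<Lambda>"
    have "(\<Sum>l\<in>S. cmod (?b l) * cmod (bracket \<sigma> (wigner (tf_shift w g) (tf_shift l g))))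
        \<le> (\<Sum>l\<in>S. A * ?F * exp (- (e / 2) * (norm (z - l))\<^sup>2))"
      using S by (intro sum_mono term_le) auto
    also have "\<dots> = A * ?F * (\<Sum>l\<in>S. exp (- (e / 2) * (norm (z - l))\<^sup>2))"
      by (simp only: sum_distrib_left)
    \<comment> \<open>N is only known to be nonnegative; N + 1 keeps the resulting constant
      positive.\<close>
    also have "\<dots> \<le> A * ?F * (N + 1)"
      using N[OF S, of z] F by (intro mult_left_mono) auto
    finally show "(\<Sum>l\<in>S. cmod (?b l) * cmod (bracket \<sigma> (wigner (tf_shift w g) (tf_shift l g))))
        \<le> (A * (N + 1)) * m ((w + z) /\<^sub>R 2) * exp (- (\<epsilon>1 / 4) * norm (w - z) powr p)"
      by (simp only: mult.assoc mult.left_commute mult.commute)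
  qed (use Ke in auto)
  moreover have "A * (N + 1) > 0" using A \<open>N \<ge> 0\<close> by simp
  ultimately show ?thesis using \<epsilon>1(1) by (intro exI[of _ "A * (N + 1)"] conjI exI[of _ "\<epsilon>1 / 4"]) auto
qed

theorem theorem4p4:
  fixes g :: "real^'d \<Rightarrow> complex"
    and \<Lambda> :: "((real^'d) \<times> (real^'d)) set"
    and v m :: "(real^'d) \<times> (real^'d) \<Rightarrow> real"
    and s :: real
    and \<sigma> :: "(real^'d) \<times> (real^'d) \<Rightarrow> complex"
  assumes "gabor_super_frame g \<Lambda>"
    and "submult_weight v"
    and "m \<in> moderate_weights v"
    and "s \<ge> 1/2"
    and "smooth \<sigma>"
    and "defines_gs_dual (1/2) \<sigma>"
  shows "(\<exists>c>0. \<exists>\<epsilon>>0. \<forall>z w.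
            cmod (weyl_op (bracket \<sigma>) (tf_shift z g) (tf_shift w g))
              \<le> c * m ((w + z) /\<^sub>R 2) * exp (- \<epsilon> * norm (w - z) powr (1 / s)))
     \<longleftrightarrow>
         (\<exists>c>0. \<exists>\<epsilon>>0. \<forall>l\<in>\<Lambda>. \<forall>\<mu>\<in>\<Lambda>.
            cmod (weyl_op (bracket \<sigma>) (tf_shift \<mu> g) (tf_shift l g))
              \<le> c * m ((l + \<mu>) /\<^sub>R 2) * exp (- \<epsilon> * norm (l - \<mu>) powr (1 / s)))"
  (is "?L \<longleftrightarrow> ?R")
proof
  assume ?L
  then show ?R by blast
next
  assume ?R
  then obtain c \<epsilon> where c: "c > 0" "\<epsilon> > 0"
    and decay: "\<And>l \<mu>. l \<in> \<Lambda> \<Longrightarrow> \<mu> \<in> \<Lambda> \<Longrightarrow> cmod (bracket \<sigma> (wigner (tf_shift l g) (tf_shift \<mu> g)))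
        \<le> c * m ((l + \<mu>) /\<^sub>R 2) * exp (- \<epsilon> * norm (l - \<mu>) powr (1 / s))"
    unfolding weyl_op_def by blast
  have p: "0 < 1 / s" "1 / s \<le> 2" using assms(4) by (auto simp: divide_le_eq)
  obtain g' where "\<And>i. hermite_combination (g' i)" "g = tensor_fun g'"
    using assms(1) unfolding gabor_super_frame_def by blast
  then have g: "gauss_class g" by (simp add: gauss_class_hermite_tensor)
  obtain \<gamma> where dual: "dual_window g \<Lambda> \<gamma>" and "\<gamma> \<in> gelfand_shilov (1/2)"
    using assms(1) unfolding gabor_super_frame_def by blast
  then have \<gamma>: "gauss_class \<gamma>" by (simp add: gelfand_shilov_gauss_class)
  have gc: "continuous_on UNIV (tf_shift z g)" for z
    by (intro tf_shift_continuous gauss_class_continuous g)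
  \<comment> \<open>The empty list of directions in \<open>smooth\<close> stands for \<sigma>
    itself.\<close>
  have "continuous_on UNIV \<sigma>"
    using assms(5)[unfolded smooth_def, rule_format, of "[]"] by simp
  then have \<sigma>: "\<sigma> \<in> borel_measurable borel" by (rule borel_measurable_continuous_onI)
  have \<sigma>_int: "integrable lborel (\<lambda>\<zeta>. cmod (\<sigma> \<zeta>) * exp (- d * (norm \<zeta>)\<^sup>2))" if "d > 0" for d
  proof -
    have "integrable lborel (\<lambda>\<zeta>. \<sigma> \<zeta> * cnj (of_real (exp (- d * (norm \<zeta>)\<^sup>2))))"
      using bspec[OF conjunct1[OF assms(6)[unfolded defines_gs_dual_def]] gaussian_in_gelfand_shilov[OF that]] .
    from integrable_norm[OF this] show ?thesis by (simp add: norm_mult)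
  qed
  have "\<exists>c>0. \<exists>\<epsilon>>0. \<forall>w\<in>\<Lambda>. \<forall>z. cmod (bracket \<sigma> (wigner (tf_shift w g) (tf_shift z g)))
        \<le> c * m ((w + z) /\<^sub>R 2) * exp (- \<epsilon> * norm (w - z) powr (1 / s))"
  \<comment> \<open>T = \<open>\<Lambda>\<close>: the first variable stays on the lattice while the
    second becomes arbitrary.\<close>
  proof (rule weyl_form_decay_off_lattice[OF g \<gamma> dual \<sigma> _ assms(2,3) p c])
    show "integrable lborel (\<lambda>\<zeta>. cmod (\<sigma> \<zeta>) * exp (- d * (norm \<zeta>)\<^sup>2))" if "d > 0" for d
      by (rule \<sigma>_int[OF that])
    show "cmod (bracket \<sigma> (wigner (tf_shift w g) (tf_shift l g)))
        \<le> c * m ((w + l) /\<^sub>R 2) * exp (- \<epsilon> * norm (w - l) powr (1 / s))" if "w \<in> \<Lambda>" "l \<in> \<Lambda>" for w l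
      by (rule decay[OF that])
  qed
  then obtain c1 \<epsilon>1 where c1: "c1 > 0" "\<epsilon>1 > 0"
    and decay1: "\<And>l z. l \<in> \<Lambda> \<Longrightarrow> cmod (bracket \<sigma> (wigner (tf_shift l g) (tf_shift z g)))
        \<le> c1 * m ((l + z) /\<^sub>R 2) * exp (- \<epsilon>1 * norm (l - z) powr (1 / s))"
    by blast
  let ?\<sigma> = "\<lambda>\<zeta>. cnj (\<sigma> \<zeta>)"
  have swap: "cmod (bracket ?\<sigma> (wigner (tf_shift z g) (tf_shift w g))) = cmod (bracket \<sigma> (wigner (tf_shift w g) (tf_shift z g)))" for w z
    by (rule bracket_cnj_wigner[OF gc gc])
  have "\<exists>c>0. \<exists>\<epsilon>>0. \<forall>w\<in>UNIV. \<forall>z. cmod (bracket ?\<sigma> (wigner (tf_shift w g) (tf_shift z g)))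
        \<le> c * m ((w + z) /\<^sub>R 2) * exp (- \<epsilon> * norm (w - z) powr (1 / s))"
  \<comment> \<open>T = \<open>UNIV\<close>: for the conjugate symbol the variable just freed comes
    first, and the one still on the lattice is now expanded. The weight and the distance are
    symmetric, so \<open>decay1\<close> is the hypothesis required.\<close>
  proof (rule weyl_form_decay_off_lattice[OF g \<gamma> dual _ _ assms(2,3) p c1])
    show "?\<sigma> \<in> borel_measurable borel" using \<sigma> by measurable
    show "integrable lborel (\<lambda>\<zeta>. cmod (?\<sigma> \<zeta>) * exp (- d * (norm \<zeta>)\<^sup>2))" if "d > 0" for d
      unfolding complex_mod_cnj by (rule \<sigma>_int[OF that])
    show "cmod (bracket ?\<sigma> (wigner (tf_shift w g) (tf_shift l g)))
        \<le> c1 * m ((w + l) /\<^sub>R 2) * exp (- \<epsilon>1 * norm (w - l) powr (1 / s))" if "l \<in> \<Lambda>" for w l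
      unfolding swap using decay1[OF that, of w] by (simp only: add.commute[of w l] norm_minus_commute[of w l])
  qed
  then obtain c2 \<epsilon>2 where c2: "c2 > 0" "\<epsilon>2 > 0"
    and decay2: "\<And>w z. cmod (bracket \<sigma> (wigner (tf_shift z g) (tf_shift w g)))
        \<le> c2 * m ((w + z) /\<^sub>R 2) * exp (- \<epsilon>2 * norm (w - z) powr (1 / s))"
    unfolding swap by blast
  have "cmod (weyl_op (bracket \<sigma>) (tf_shift z g) (tf_shift w g))
      \<le> c2 * m ((w + z) /\<^sub>R 2) * exp (- \<epsilon>2 * norm (w - z) powr (1 / s))" for z w
    using decay2[of w z] by (simp only: weyl_op_def add.commute[of w z] norm_minus_commute[of w z])
  then show ?L using c2 by blast
qed

end
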